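(* For all $(x,i)\in(0,\infty)\times\mathcal I$, the martingale $$\mathcal M^+(n)=\sum_{|u|=n+1}v^+_{\mathcal J_u(0)}\,\mathcal X_u(0)^{\omega_+},\qquad n\ge0,$$ converges to $0$ almost surely under $\mathcal P_{x,i}$.
   Context: **MAPs.** Let $\mathcal I=\{1,\dots,N\}$. A Markov additive process (MAP) $(\xi,\Theta)$ is a regular Feller process in $\mathbb R\times\mathcal I$ with laws $\mathtt P_{x,i}$, cemetery $(-\infty,\dagger)$ and lifetime $\varsigma=\inf\{t>0:\Theta(t)=\dagger\}$ such that, with $(\mathcal G_t)$ its natural filtration, $\mathtt E_{x,i}[f(\xi(t+s)-\xi(t),\Theta(t+s))\mathbf 1_{\{t+s<\varsigma\}}\mid\mathcal G_t]=\mathbf 1_{\{t<\varsigma\}}\mathtt E_{0,\Theta(t)}[f(\xi(s),\Theta(s))\mathbf 1_{\{s<\varsigma\}}]$ for all bounded measurable $f$. The chain $\Theta$ is assumed irreducible and ergodic with intensity matrix $Q=(q_{i,j})$. While $\Theta$ is in state $i$, $\xi$ evolves as a Lévy process $\xi_i$; when $\Theta$ jumps from $i$ to $j\neq i$, $\xi$ makes an additional independent jump distributed as $U_{i,j}$ ($U_{i,i}=0$, and $U_{i,j}=0$ if $q_{i,j}=0$). Write $\mathbb E[\mathrm e^{z\xi_i(t)}]=\mathrm e^{\psi_i(z)t}$, $G_{i,j}(z)=\mathbb E[\mathrm e^{zU_{i,j}}]$. **Self-similar Markov process with types.** Fix $\alpha\in\mathbb R$. With $\varphi(t)=\inf\{s>0:\int_0^s\mathrm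 e^{\alpha\xi(u)}\mathrm du>t\}$, for $x>0$ and under $\mathtt P_{0,i}$ set $X(t)=x\exp(\xi(\varphi(tx^{-\alpha})))$, $J(t)=\Theta(\varphi(tx^{-\alpha}))$ for $t<\zeta:=x^\alpha\int_0^\infty \mathrm e^{\alpha\xi(s)}\mathrm ds$, and $(X,J)=\partial$ for $t\ge\zeta$. Its law is $\mathbb P_{x,i}$, $\mathbb P_i=\mathbb P_{1,i}$. Standing assumption: under every $\mathbb P_{x,i}$, $(X,J)$ is either absorbed at $\partial$ after a finite time or $X$ converges to $0$. Put $\Delta X(s)=(X(s)-X(s^-))\mathbf 1_{\{X(s)<X(s^-)\}}$. **Types of jumps.** Decompositions $\Lambda_i=\sum_k\Lambda_i^{(k)}$ of the Lévy measure of $\xi_i$ and $\Lambda_{U_{i,j}}=\sum_k\Lambda^{(k)}_{U_{i,j}}$ of the law of $U_{i,j}$ ($k\in\mathcal I$) are given. Correspondingly every jump carries a type: jumps of $\xi_i$ are the superposition over $k$ of independent jumps of type $k$ with intensity $\Lambda_i^{(k)}$, and the special jump from $i$ to $j$ has size in $\mathrm dx$ and type $k$ with probability $\Lambda_{U_{i,j}}^{(k)}(\mathrm dx)$. $J_\Delta(s)$ is the type of the jump of $X$ at time $s$. Put $\Pi_{i,k}=\Lambda_i^{(k)}+\sum_{j\ne i}q_{i,j}\Lambda_{U_{i,j}}^{(k)}$ and $\kappa_i(q)=\psi_i(q)+q_{i,i}+\int_{(-\infty,0)}\Pi_{i,i}(\mathrm dx)(1-\mathrm e^x)^q$. **Cell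 system.** Let $\mathbb U=\bigcup_{n\ge0}\mathbb N^n$, $|u|$ the generation of $u$. Under $\mathcal P_{x,i}$ the Eve cell $(\mathcal X_\varnothing,\mathcal J_\varnothing)$ has law $\mathbb P_{x,i}$ and birth time $0$. Recursively, given cell $u$ born at $b_u$, rank the absolute sizes and ages $(x_k,\beta_k)$ of its negative jumps in descending lexicographical order, with types $j_k$; the child $uk$ is born at $b_u+\beta_k$ and, conditionally, the $(\mathcal X_{uk},\mathcal J_{uk})$ are independent with laws $\mathbb P_{x_k,j_k}$, independent across the cells of a generation given the previous generations. **Admissibility.** $m(q)$ has entries $m_{i,j}(q)=\mathbb E_i[\sum_{0<s<\zeta}|\Delta X(s)|^q\mathbf 1_{\{J_\Delta(s)=j\}}]$. Standing assumptions: (A) whenever $m(q)$ has finite entries it is irreducible, and $\mathrm e^{\lambda(q)}$ denotes its Perron–Frobenius eigenvalue; (B) $\lambda$ has a root. $((v_i)_{i},\omega)$ with $v_i>0$, $\omega\ge0$ is admissible if $m(\omega)$ is finite, $\lambda(\omega)=0$ and $v$ is an associated eigenvector of $m(\omega)$; $\omega$ is then called an admissible exponent. For such a pair, the spine matrix exponent is $\widehat F_{i,i}(q)=\kappa_i(\omega+q)$, $\widehat F_{i,j}(q)=\frac{v_j}{v_i}(\int_{(-\infty,0)}\Pi_{i,j}(\mathrm dx)(1-\mathrm e^x)^{q+\omega}+q_{i,j}G_{i,j}(q+\omega))$ for $i\ne j$. **Cramér-type assumption.** There exist two admissible exponents $0<\omega_-<\omega_+$ in the interior of the domain where $m$ is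 finite; $v^\pm$ are the associated positive (Perron–Frobenius) eigenvectors of $m(\omega_\pm)$. With $\widehat\chi_-$ the leading (Perron–Frobenius) eigenvalue of the matrix $\widehat F$ built from $(v^-,\omega_-)$, the derivative $\widehat\chi_-'(\omega_+-\omega_-)$ is assumed finite. *)

theory Defs
  imports "HOL-Probability.Probability"
begin

section \<open>Marked paths\<close>

text \<open>
  The finite type \<open>'i\<close> is the set of types (states of the modulating chain). The value \<open>None\<close> is the
  cemetery. The second component of a marked path gives the type of the jump at each time; it is
  meaningful at jump times only.
\<close>

type_synonym 'i path = "real \<Rightarrow> (real \<times> 'i) option"
type_synonym 'i marked_path = "'i path \<times> (real \<Rightarrow> 'i)"

definition alive :: "'i marked_path \<Rightarrow> real \<Rightarrow> bool" where
  "alive c t \<longleftrightarrow> fst c t \<noteq> None"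

definition pos :: "'i marked_path \<Rightarrow> real \<Rightarrow> real" where
  "pos c t = (case fst c t of None \<Rightarrow> 0 | Some (y, j) \<Rightarrow> y)"

definition ctype :: "'i marked_path \<Rightarrow> real \<Rightarrow> 'i" where
  "ctype c t = snd (the (fst c t))"

definition jump :: "(real \<Rightarrow> real) \<Rightarrow> real \<Rightarrow> real" where
  "jump f s = f s - Lim (at_left s) f"

text \<open>
  The cadlag paths of \<open>(X, J)\<close>, positive up to a lifetime \<open>z\<close>. The lifetime \<open>0\<close> is allowed: it encodes
  the labels of the Ulam-Harris tree at which there is no cell.
\<close>

definition cell_paths :: "'i marked_path set" where
  "cell_paths = {c. \<exists>z::ereal.
      (\<forall>t. alive c t \<longleftrightarrow> 0 \<le> t \<and> ereal t < z) \<and>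
      (\<forall>t. 0 \<le> t \<and> ereal t < z \<longrightarrow>
         0 < pos c t \<and> (pos c \<longlongrightarrow> pos c t) (at_right t) \<and>
         (\<forall>\<^sub>F u in at_right t. ctype c u = ctype c t)) \<and>
      (\<forall>t. 0 < t \<and> ereal t < z \<longrightarrow>
         (\<exists>l. (pos c \<longlongrightarrow> l) (at_left t)) \<and> (\<exists>j. \<forall>\<^sub>F u in at_left t. ctype c u = j))}"

definition typed_jumps :: "'i marked_path \<Rightarrow> real \<Rightarrow> real set \<Rightarrow> 'i \<Rightarrow> real set" where
  "typed_jumps c t A k =
     {s. 0 < s \<and> s \<le> t \<and> alive c s \<and> jump (pos c) s \<noteq> 0 \<and> jump (pos c) s \<in> A \<and> snd c s = k}"

text \<open>
  The sigma-algebra on paths is generated by the evaluations and by the numbers of jumps of each type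
  with sizes in a Borel set. (The evaluations of the marks alone would not do: at a fixed time there is
  almost surely no jump.)
\<close>

definition cell_space :: "'i marked_path measure" where
  "cell_space = sigma cell_paths
     ({{c \<in> cell_paths. \<exists>y\<in>A. fst c t = Some (y, j)} |t A j. 0 \<le> t \<and> A \<in> sets borel} \<union>
      {{c \<in> cell_paths. finite (typed_jumps c t A k) \<and> card (typed_jumps c t A k) = n}
         |t A k n. 0 \<le> t \<and> A \<in> sets borel})"

definition neg_jumps :: "'i marked_path \<Rightarrow> real set" where
  "neg_jumps c = {s. 0 < s \<and> alive c s \<and> jump (pos c) s < 0}"


section \<open>Levy processes\<close>

definition cadlag :: "(real \<Rightarrow> real) \<Rightarrow> bool" where
  "cadlag f \<longleftrightarrow> (\<forall>t\<ge>0. (f \<longlongrightarrow> f t) (at_right t)) \<and> (\<forall>t>0. \<exists>l. (f \<longlongrightarrow> l) (at_left t))"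

definition levy_process :: "'w measure \<Rightarrow> (real \<Rightarrow> 'w \<Rightarrow> real) \<Rightarrow> bool" where
  "levy_process M Y \<longleftrightarrow>
     (\<forall>t\<ge>0. Y t \<in> borel_measurable M) \<and>
     (\<forall>w\<in>space M. Y 0 w = 0 \<and> cadlag (\<lambda>t. Y t w)) \<and>
     (\<forall>s\<ge>0. \<forall>t\<ge>0. distr M borel (\<lambda>w. Y (s + t) w - Y s w) = distr M borel (Y t)) \<and>
     (\<forall>\<tau>::nat \<Rightarrow> real. mono \<tau> \<and> 0 \<le> \<tau> 0 \<longrightarrow>
        prob_space.indep_vars M (\<lambda>_. borel) (\<lambda>n w. Y (\<tau> (Suc n)) w - Y (\<tau> n) w) UNIV)"

text \<open>The Levy measure of \<open>A\<close> is the expected number of jumps in \<open>A\<close> per unit of time.\<close>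

definition has_levy_measure :: "'w measure \<Rightarrow> (real \<Rightarrow> 'w \<Rightarrow> real) \<Rightarrow> real measure \<Rightarrow> bool" where
  "has_levy_measure M Y \<Lambda> \<longleftrightarrow>
     sets \<Lambda> = sets borel \<and> emeasure \<Lambda> {0} = 0 \<and>
     (\<forall>A\<in>sets borel. 0 \<notin> A \<longrightarrow>
        emeasure \<Lambda> A =
          (\<integral>\<^sup>+ w. emeasure (count_space UNIV) {s. 0 < s \<and> s \<le> 1 \<and> jump (\<lambda>t. Y t w) s \<in> A} \<partial>M))"


section \<open>The modulating chain\<close>

definition intensity_matrix :: "real^'i^'i \<Rightarrow> bool" where
  "intensity_matrix Q \<longleftrightarrow>
     (\<forall>i j. i \<noteq> j \<longrightarrow> 0 \<le> Q $ i $ j) \<and> (\<forall>i. (\<Sum>j\<in>UNIV. Q $ i $ j) = 0)"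

text \<open>An irreducible chain on a finite state space is automatically ergodic.\<close>

definition irreducible_chain :: "real^'i^'i \<Rightarrow> bool" where
  "irreducible_chain Q \<longleftrightarrow> (\<forall>i j. (i, j) \<in> {(a, b). a \<noteq> b \<and> 0 < Q $ a $ b}\<^sup>*)"

definition chain_jumps :: "(real \<Rightarrow> 'i) \<Rightarrow> real set" where
  "chain_jumps \<theta> = {s. 0 < s \<and> \<not> (\<forall>\<^sub>F u in at_left s. \<theta> u = \<theta> s)}"

definition left_state :: "(real \<Rightarrow> 'i) \<Rightarrow> real \<Rightarrow> 'i" where
  "left_state \<theta> s = (THE l. \<forall>\<^sub>F u in at_left s. \<theta> u = l)"

definition step_path :: "(real \<Rightarrow> 'i) \<Rightarrow> bool" where
  "step_path \<theta> \<longleftrightarrow> (\<forall>t\<ge>0. \<forall>\<^sub>F u in at_right t. \<theta> u = \<theta> t) \<and>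
                  (\<forall>t>0. \<exists>l. \<forall>\<^sub>F u in at_left t. \<theta> u = l)"

text \<open>
  A continuous-time Markov chain started at \<open>i\<close>, with transition function \<open>p\<close>; the intensity matrix
  is the derivative of \<open>p\<close> at time \<open>0\<close>.
\<close>

definition markov_chain_from ::
  "'w measure \<Rightarrow> real^'i^'i \<Rightarrow> 'i \<Rightarrow> (real \<Rightarrow> 'w \<Rightarrow> 'i::finite) \<Rightarrow> bool" where
  "markov_chain_from M Q i \<theta> \<longleftrightarrow>
     (\<forall>t\<ge>0. \<theta> t \<in> measurable M (count_space UNIV)) \<and>
     (\<forall>w\<in>space M. \<theta> 0 w = i \<and> step_path (\<lambda>t. \<theta> t w)) \<and>
     (\<exists>p::real \<Rightarrow> 'i \<Rightarrow> 'i \<Rightarrow> real.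
        (\<forall>a b. p 0 a b = (if a = b then 1 else 0)) \<and>
        (\<forall>a b. ((\<lambda>h. p h a b) has_real_derivative Q $ a $ b) (at 0 within {0..})) \<and>
        (\<forall>n (\<tau>::nat \<Rightarrow> real) y. mono \<tau> \<and> \<tau> 0 = 0 \<and> y 0 = i \<longrightarrow>
           measure M {w \<in> space M. \<forall>k\<le>n. \<theta> (\<tau> k) w = y k} =
             (\<Prod>k<n. p (\<tau> (Suc k) - \<tau> k) (y k) (y (Suc k)))))"


section \<open>Markov additive processes with typed jumps\<close>

definition state_space :: "(real \<times> 'i) option measure" where
  "state_space = sigma UNIV {Some ` (A \<times> {j}) |A j. A \<in> sets borel}"

definition natural_filtration ::
  "'w measure \<Rightarrow> (real \<Rightarrow> 'w \<Rightarrow> (real \<times> 'i) option) \<Rightarrow> real \<Rightarrow> 'w measure" where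
  "natural_filtration M Z t =
     vimage_algebra (space M) (\<lambda>w. \<lambda>s\<in>{0..t}. Z s w) (PiM {0..t} (\<lambda>_. state_space))"

text \<open>
  \<open>P i\<close> is the law started from \<open>(0, i)\<close>. The law started from \<open>(x, i)\<close> is that of the process translated
  by \<open>x\<close>, so that the Markov additive property for all starting points reduces to \<open>x = 0\<close>.
\<close>

definition markov_additive ::
  "('i::finite \<Rightarrow> 'w measure) \<Rightarrow> (real \<Rightarrow> 'w \<Rightarrow> (real \<times> 'i) option) \<Rightarrow> bool" where
  "markov_additive P Z \<longleftrightarrow>
     (\<forall>i. \<forall>s\<ge>0. \<forall>t\<ge>0. \<forall>f\<in>borel_measurable (borel \<Otimes>\<^sub>M count_space UNIV).
        (\<exists>B. \<forall>p. \<bar>f p :: real\<bar> \<le> B) \<longrightarrow>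
        (AE w in P i.
           real_cond_exp (P i) (natural_filtration (P i) Z t)
             (\<lambda>w. case (Z t w, Z (t + s) w) of
                     (Some (y, l), Some (y', l')) \<Rightarrow> f (y' - y, l')
                   | _ \<Rightarrow> 0) w =
           (case Z t w of
              None \<Rightarrow> 0
            | Some (y, l) \<Rightarrow>
                (LINT w'|P l. (case Z s w' of None \<Rightarrow> 0 | Some p \<Rightarrow> f p)))))"

definition C0 :: "('i \<Rightarrow> real \<Rightarrow> real) \<Rightarrow> bool" where
  "C0 f \<longleftrightarrow> (\<forall>i. continuous_on UNIV (f i) \<and> (f i \<longlongrightarrow> 0) at_infinity)"

definition semigroup ::
  "('i \<Rightarrow> 'w measure) \<Rightarrow> (real \<Rightarrow> 'w \<Rightarrow> (real \<times> 'i) option) \<Rightarrow> real \<Rightarrow>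
   ('i \<Rightarrow> real \<Rightarrow> real) \<Rightarrow> 'i \<Rightarrow> real \<Rightarrow> real" where
  "semigroup P Z t f i x = (LINT w|P i. (case Z t w of None \<Rightarrow> 0 | Some (y, j) \<Rightarrow> f j (x + y)))"

definition feller ::
  "('i \<Rightarrow> 'w measure) \<Rightarrow> (real \<Rightarrow> 'w \<Rightarrow> (real \<times> 'i) option) \<Rightarrow> bool" where
  "feller P Z \<longleftrightarrow>
     (\<forall>f. C0 f \<longrightarrow>
        (\<forall>t\<ge>0. C0 (semigroup P Z t f)) \<and>
        (\<forall>i. uniform_limit UNIV (\<lambda>t x. semigroup P Z t f i x) (f i) (at_right 0)))"

text \<open>
  The independent sources of randomness from which the process is built: the unkilled chain, for every
  state \<open>j\<close> and type \<open>k\<close> a Levy process \<open>Y j k\<close>, for every state \<open>j\<close> the killing time \<open>e j\<close>, and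
  for every \<open>n\<close> and \<open>(a, b)\<close> the special jump \<open>U n a b\<close> and its type \<open>TU n a b\<close>, used if the transition
  number \<open>n\<close> of the chain is from \<open>a\<close> to \<open>b\<close>.
\<close>

datatype 'i source = Chain | Levy 'i 'i | Kill 'i | Special nat 'i 'i

definition path_events :: "'w measure \<Rightarrow> 's measure \<Rightarrow> (real \<Rightarrow> 'w \<Rightarrow> 's) \<Rightarrow> 'w set set" where
  "path_events M N Y =
     sets (vimage_algebra (space M) (\<lambda>w. \<lambda>t\<in>{0..}. Y t w) (PiM {0..} (\<lambda>_. N)))"

definition source_events ::
  "'w measure \<Rightarrow> (real \<Rightarrow> 'w \<Rightarrow> 'i) \<Rightarrow> ('i \<Rightarrow> 'i \<Rightarrow> real \<Rightarrow> 'w \<Rightarrow> real) \<Rightarrow> ('i \<Rightarrow> 'w \<Rightarrow> ereal) \<Rightarrow>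
   (nat \<Rightarrow> 'i \<Rightarrow> 'i \<Rightarrow> 'w \<Rightarrow> real) \<Rightarrow> (nat \<Rightarrow> 'i \<Rightarrow> 'i \<Rightarrow> 'w \<Rightarrow> 'i) \<Rightarrow> 'i source \<Rightarrow> 'w set set" where
  "source_events M \<theta> Y e U TU r =
     (case r of
        Chain \<Rightarrow> path_events M (count_space UNIV) \<theta>
      | Levy j k \<Rightarrow> path_events M borel (Y j k)
      | Kill j \<Rightarrow> sets (vimage_algebra (space M) (e j) borel)
      | Special n a b \<Rightarrow>
          sets (vimage_algebra (space M) (\<lambda>w. (U n a b w, TU n a b w))
                 (borel \<Otimes>\<^sub>M count_space UNIV)))"

text \<open>
  The Levy process \<open>\<xi>\<^sub>j\<close> is the superposition over \<open>k\<close> of the \<open>Y j k\<close>, and its jumps of type \<open>k\<close> are those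
  of \<open>Y j k\<close>, with Levy measure \<open>\<Lambda> j k\<close>. It is killed at time \<open>e j\<close>; the case \<open>z = 0\<close> of the
  identity for \<open>\<psi> j\<close> says that \<open>e j\<close> is exponential with parameter \<open>- \<psi> j 0\<close> (infinite if this is \<open>0\<close>).
  The imaginary axis, where the exponential is always integrable, determines the law of \<open>\<xi>\<^sub>j\<close>.
\<close>

definition map_sources ::
  "real^'i^'i \<Rightarrow> ('i \<Rightarrow> complex \<Rightarrow> complex) \<Rightarrow> ('i \<Rightarrow> 'i \<Rightarrow> real measure) \<Rightarrow>
   ('i \<Rightarrow> 'i \<Rightarrow> 'i \<Rightarrow> real measure) \<Rightarrow> 'w measure \<Rightarrow> 'i \<Rightarrow>
   (real \<Rightarrow> 'w \<Rightarrow> 'i::finite) \<Rightarrow> ('i \<Rightarrow> 'i \<Rightarrow> real \<Rightarrow> 'w \<Rightarrow> real) \<Rightarrow> ('i \<Rightarrow> 'w \<Rightarrow> ereal) \<Rightarrow>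
   (nat \<Rightarrow> 'i \<Rightarrow> 'i \<Rightarrow> 'w \<Rightarrow> real) \<Rightarrow> (nat \<Rightarrow> 'i \<Rightarrow> 'i \<Rightarrow> 'w \<Rightarrow> 'i) \<Rightarrow> bool" where
  "map_sources Q \<psi> \<Lambda> \<Lambda>U M i \<theta> Y e U TU \<longleftrightarrow>
     prob_space.indep_sets M (source_events M \<theta> Y e U TU) UNIV \<and>
     markov_chain_from M Q i \<theta> \<and>
     (\<forall>j k. levy_process M (Y j k) \<and> has_levy_measure M (Y j k) (\<Lambda> j k)) \<and>
     (\<forall>j. e j \<in> borel_measurable M \<and> (\<forall>w\<in>space M. 0 < e j w)) \<and>
     (\<forall>j z. \<forall>t\<ge>0. integrable M (\<lambda>w. exp (z * of_real (\<Sum>k\<in>UNIV. Y j k t w))) \<longrightarrow>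
        (LINT w|M. exp (z * of_real (\<Sum>k\<in>UNIV. Y j k t w)) * indicator {w. ereal t < e j w} w) =
          exp (\<psi> j z * of_real t)) \<and>
     (\<forall>n a b k. \<forall>A\<in>sets borel.
        emeasure M {w \<in> space M. U n a b w \<in> A \<and> TU n a b w = k} = emeasure (\<Lambda>U a b k) A)"

definition occupation :: "(real \<Rightarrow> 'i) \<Rightarrow> 'i \<Rightarrow> real \<Rightarrow> real" where
  "occupation \<theta> j t = measure lborel {s \<in> {0..t}. \<theta> s = j}"

text \<open>
  While the chain is in state \<open>j\<close>, the ordinate moves as \<open>\<xi>\<^sub>j\<close> run with the clock given by the time spent
  in \<open>j\<close>; as \<open>\<xi>\<^sub>j\<close> has independent stationary increments, the motions during the successive sojourns
  in \<open>j\<close> are independent copies.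
\<close>

definition build_path ::
  "(real \<Rightarrow> 'i::finite) \<Rightarrow> ('i \<Rightarrow> 'i \<Rightarrow> real \<Rightarrow> real) \<Rightarrow> ('i \<Rightarrow> ereal) \<Rightarrow> (nat \<Rightarrow> 'i \<Rightarrow> 'i \<Rightarrow> real) \<Rightarrow>
   'i path" where
  "build_path \<theta> Y e U t =
     (if \<forall>j. ereal (occupation \<theta> j t) < e j
      then Some ((\<Sum>j\<in>UNIV. \<Sum>k\<in>UNIV. Y j k (occupation \<theta> j t)) +
                 (\<Sum>s\<in>chain_jumps \<theta> \<inter> {0<..t}.
                    U (card (chain_jumps \<theta> \<inter> {0<..<s})) (left_state \<theta> s) (\<theta> s)),
                 \<theta> t)
      else None)"

definition build_marks ::
  "(real \<Rightarrow> 'i) \<Rightarrow> ('i \<Rightarrow> 'i \<Rightarrow> real \<Rightarrow> real) \<Rightarrow> (nat \<Rightarrow> 'i \<Rightarrow> 'i \<Rightarrow> 'i) \<Rightarrow> real \<Rightarrow> 'i" where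
  "build_marks \<theta> Y TU s =
     (if s \<in> chain_jumps \<theta>
      then TU (card (chain_jumps \<theta> \<inter> {0<..<s})) (left_state \<theta> s) (\<theta> s)
      else (SOME k. jump (Y (\<theta> s) k) (occupation \<theta> (\<theta> s) s) \<noteq> 0))"

text \<open>\<open>Z t = Some (\<xi>(t), \<Theta>(t))\<close> before the lifetime and \<open>None\<close> after it; \<open>D s\<close> is the type of the jump at \<open>s\<close>.\<close>

definition typed_MAP ::
  "real^'i^'i \<Rightarrow> ('i \<Rightarrow> complex \<Rightarrow> complex) \<Rightarrow> ('i \<Rightarrow> 'i \<Rightarrow> real measure) \<Rightarrow>
   ('i \<Rightarrow> 'i \<Rightarrow> 'i \<Rightarrow> real measure) \<Rightarrow> ('i::finite \<Rightarrow> 'w measure) \<Rightarrow>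
   (real \<Rightarrow> 'w \<Rightarrow> (real \<times> 'i) option) \<Rightarrow> (real \<Rightarrow> 'w \<Rightarrow> 'i) \<Rightarrow> bool" where
  "typed_MAP Q \<psi> \<Lambda> \<Lambda>U P Z D \<longleftrightarrow>
     intensity_matrix Q \<and> irreducible_chain Q \<and>
     (\<forall>a b k. sets (\<Lambda>U a b k) = sets borel) \<and>
     (\<forall>a b. (\<Sum>k\<in>UNIV. emeasure (\<Lambda>U a b k) UNIV) = 1) \<and>
     (\<forall>a b. a = b \<or> Q $ a $ b = 0 \<longrightarrow> (\<Sum>k\<in>UNIV. emeasure (\<Lambda>U a b k) {0}) = 1) \<and>
     (\<forall>i. prob_space (P i)) \<and>
     (\<forall>i. \<forall>t\<ge>0. Z t \<in> measurable (P i) state_space) \<and>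
     markov_additive P Z \<and> feller P Z \<and>
     (\<forall>i. \<exists>\<theta> Y e U TU. map_sources Q \<psi> \<Lambda> \<Lambda>U (P i) i \<theta> Y e U TU \<and>
        (\<forall>w\<in>space (P i).
           (\<forall>t\<ge>0. Z t w = build_path (\<lambda>t. \<theta> t w) (\<lambda>j k t. Y j k t w) (\<lambda>j. e j w)
                            (\<lambda>n a b. U n a b w) t) \<and>
           (\<forall>s>0. D s w = build_marks (\<lambda>t. \<theta> t w) (\<lambda>j k t. Y j k t w)
                            (\<lambda>n a b. TU n a b w) s)))"


section \<open>Self-similar Markov processes with types\<close>

text \<open>The integral of \<open>exp (\<alpha> \<xi>)\<close> is over times before the lifetime of the Markov additive process.\<close>

definition exp_functional :: "real \<Rightarrow> 'i path \<Rightarrow> real set \<Rightarrow> ennreal" where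
  "exp_functional \<alpha> z S =
     (\<integral>\<^sup>+ u\<in>S. (case z u of None \<Rightarrow> 0 | Some (y, j) \<Rightarrow> ennreal (exp (\<alpha> * y))) \<partial>lborel)"

definition time_change :: "real \<Rightarrow> 'i path \<Rightarrow> real \<Rightarrow> real" where
  "time_change \<alpha> z t = Inf {s. 0 < s \<and> ennreal t < exp_functional \<alpha> z {0..s}}"

definition lamperti :: "real \<Rightarrow> real \<Rightarrow> 'i marked_path \<Rightarrow> 'i marked_path" where
  "lamperti \<alpha> x c =
     (\<lambda>t. if 0 \<le> t \<and> ennreal t < ennreal (x powr \<alpha>) * exp_functional \<alpha> (fst c) {0..}
           then map_option (\<lambda>(y, j). (x * exp y, j)) (fst c (time_change \<alpha> (fst c) (t * x powr (- \<alpha>))))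
           else None,
      \<lambda>t. snd c (time_change \<alpha> (fst c) (t * x powr (- \<alpha>))))"

definition ssmp ::
  "real \<Rightarrow> (real \<Rightarrow> 'w \<Rightarrow> (real \<times> 'i) option) \<Rightarrow> (real \<Rightarrow> 'w \<Rightarrow> 'i) \<Rightarrow> real \<Rightarrow> 'w \<Rightarrow> 'i marked_path" where
  "ssmp \<alpha> Z D x w = lamperti \<alpha> x (\<lambda>t. Z t w, \<lambda>s. D s w)"

definition ssmp_law ::
  "real \<Rightarrow> ('i \<Rightarrow> 'w measure) \<Rightarrow> (real \<Rightarrow> 'w \<Rightarrow> (real \<times> 'i) option) \<Rightarrow> (real \<Rightarrow> 'w \<Rightarrow> 'i) \<Rightarrow>
   real \<Rightarrow> 'i \<Rightarrow> 'i marked_path measure" where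
  "ssmp_law \<alpha> P Z D x i = distr (P i) cell_space (ssmp \<alpha> Z D x)"

definition absorbed_or_vanishing :: "(real \<Rightarrow> 'i \<Rightarrow> 'i marked_path measure) \<Rightarrow> bool" where
  "absorbed_or_vanishing L \<longleftrightarrow>
     (\<forall>x>0. \<forall>i. AE c in L x i. (\<exists>t\<ge>0. \<not> alive c t) \<or> (pos c \<longlongrightarrow> 0) at_top)"


section \<open>Cell systems\<close>

text \<open>
  The negative jumps of a cell, ranked (from rank \<open>0\<close>) in descending lexicographical order of
  their absolute size and age.
\<close>

definition precedes :: "'i marked_path \<Rightarrow> real \<Rightarrow> real \<Rightarrow> bool" where
  "precedes c s s' \<longleftrightarrow>
     \<bar>jump (pos c) s\<bar> > \<bar>jump (pos c) s'\<bar> \<or> \<bar>jump (pos c) s\<bar> = \<bar>jump (pos c) s'\<bar> \<and> s > s'"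

definition has_rank :: "'i marked_path \<Rightarrow> nat \<Rightarrow> real \<Rightarrow> bool" where
  "has_rank c k s \<longleftrightarrow>
     s \<in> neg_jumps c \<and> finite {s' \<in> neg_jumps c. precedes c s' s} \<and>
     card {s' \<in> neg_jumps c. precedes c s' s} = k"

text \<open>Size, age and type of the jump of rank \<open>k\<close>; \<open>None\<close> if there are not that many negative jumps.\<close>

definition child :: "'i marked_path \<Rightarrow> nat \<Rightarrow> (real \<times> real \<times> 'i) option" where
  "child c k =
     (if \<exists>s. has_rank c k s
      then (let s = (THE s. has_rank c k s) in Some (\<bar>jump (pos c) s\<bar>, s, snd c s))
      else None)"

definition no_cell :: "'i marked_path" where
  "no_cell = (\<lambda>_. None, \<lambda>_. undefined)"

definition child_prob ::
  "(real \<Rightarrow> 'i \<Rightarrow> 'i marked_path measure) \<Rightarrow> 'i marked_path \<Rightarrow> nat \<Rightarrow> 'i marked_path set \<Rightarrow> real" where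
  "child_prob L c k B =
     (case child c k of None \<Rightarrow> indicator B no_cell | Some (x, \<beta>, j) \<Rightarrow> measure (L x j) B)"

definition generations ::
  "'c measure \<Rightarrow> (nat list \<Rightarrow> 'c \<Rightarrow> 'i marked_path) \<Rightarrow> nat \<Rightarrow> 'c measure" where
  "generations M C n =
     vimage_algebra (space M) (\<lambda>w. \<lambda>u\<in>{u. length u \<le> n}. C u w)
       (PiM {u. length u \<le> n} (\<lambda>_. cell_space))"

text \<open>
  \<open>C u\<close> is the cell with label \<open>u\<close> and \<open>b u\<close> its birth time. The conditional independence is expressed
  through the conditional finite-dimensional distributions of a generation given the previous ones.
\<close>

definition cell_system ::
  "(real \<Rightarrow> 'i \<Rightarrow> 'i marked_path measure) \<Rightarrow> real \<Rightarrow> 'i \<Rightarrow> 'c measure \<Rightarrow>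
   (nat list \<Rightarrow> 'c \<Rightarrow> 'i marked_path) \<Rightarrow> (nat list \<Rightarrow> 'c \<Rightarrow> real) \<Rightarrow> bool" where
  "cell_system L x i M C b \<longleftrightarrow>
     prob_space M \<and>
     (\<forall>u. C u \<in> measurable M cell_space) \<and>
     distr M cell_space (C []) = L x i \<and>
     (\<forall>n S B. finite S \<and> S \<subseteq> {u. length u = Suc n} \<and> (\<forall>u\<in>S. B u \<in> sets cell_space) \<longrightarrow>
        (AE w in M.
           real_cond_exp M (generations M C n)
             (indicator {w \<in> space M. \<forall>u\<in>S. C u w \<in> B u}) w =
           (\<Prod>u\<in>S. child_prob L (C (butlast u) w) (last u) (B u)))) \<and>
     (\<forall>w\<in>space M. b [] w = 0 \<and>
        (\<forall>u k y \<beta> j. child (C u w) k = Some (y, \<beta>, j) \<longrightarrow> b (u @ [k]) w = b u w + \<beta>))"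

text \<open>The sum takes its values in \<open>[0, \<infinity>]\<close>, so that no summability is presupposed.\<close>

definition genealogical_sum ::
  "(nat list \<Rightarrow> 'c \<Rightarrow> 'i marked_path) \<Rightarrow> real^'i \<Rightarrow> real \<Rightarrow> nat \<Rightarrow> 'c \<Rightarrow> ennreal" where
  "genealogical_sum C v q n w =
     (\<Sum>\<^sub>\<infinity>u\<in>{u. length u = n + 1 \<and> alive (C u w) 0}.
        ennreal (v $ ctype (C u w) 0 * pos (C u w) 0 powr q))"


section \<open>Admissible exponents\<close>

definition m_entry :: "(real \<Rightarrow> 'i \<Rightarrow> 'i marked_path measure) \<Rightarrow> real \<Rightarrow> 'i \<Rightarrow> 'i \<Rightarrow> ennreal" where
  "m_entry L q i j =
     (\<integral>\<^sup>+ c. (\<Sum>\<^sub>\<infinity>s\<in>{s \<in> neg_jumps c. snd c s = j}. ennreal (\<bar>jump (pos c) s\<bar> powr q)) \<partial>L 1 i)"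

definition m_finite :: "(real \<Rightarrow> 'i \<Rightarrow> 'i marked_path measure) \<Rightarrow> real \<Rightarrow> bool" where
  "m_finite L q \<longleftrightarrow> (\<forall>i j. m_entry L q i j < \<infinity>)"

text \<open>The matrix \<open>m(q)\<close>; meaningful only where \<open>m_finite\<close> holds.\<close>

definition m_matrix :: "(real \<Rightarrow> 'i \<Rightarrow> 'i marked_path measure) \<Rightarrow> real \<Rightarrow> real^'i^'i" where
  "m_matrix L q = (\<chi> i j. enn2real (m_entry L q i j))"

definition irreducible_matrix :: "real^'i^'i \<Rightarrow> bool" where
  "irreducible_matrix A \<longleftrightarrow> (\<forall>i j. (i, j) \<in> {(a, b). 0 < A $ a $ b}\<^sup>+)"

definition spectrum :: "real^'i^'i \<Rightarrow> complex set" where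
  "spectrum A = {l. \<exists>z::complex^'i. z \<noteq> 0 \<and> (\<chi> i j. complex_of_real (A $ i $ j)) *v z = l *s z}"

text \<open>The Perron-Frobenius eigenvalue of a nonnegative matrix is its spectral radius.\<close>

definition pf_eigenvalue :: "real^'i^'i \<Rightarrow> real" where
  "pf_eigenvalue A = Max (cmod ` spectrum A)"

text \<open>For a matrix with nonnegative off-diagonal entries: the eigenvalue of maximal real part.\<close>

definition leading_eigenvalue :: "real^'i^'i \<Rightarrow> real" where
  "leading_eigenvalue A = Max (Re ` spectrum A)"

definition growth_rate :: "(real \<Rightarrow> 'i::finite \<Rightarrow> 'i marked_path measure) \<Rightarrow> real \<Rightarrow> real" where
  "growth_rate L q = ln (pf_eigenvalue (m_matrix L q))"

definition admissible :: "(real \<Rightarrow> 'i \<Rightarrow> 'i marked_path measure) \<Rightarrow> real^'i \<Rightarrow> real \<Rightarrow> bool" where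
  "admissible L v \<omega> \<longleftrightarrow>
     (\<forall>i. 0 < v $ i) \<and> 0 \<le> \<omega> \<and> m_finite L \<omega> \<and> growth_rate L \<omega> = 0 \<and>
     m_matrix L \<omega> *v v = exp (growth_rate L \<omega>) *s v"


section \<open>The spine\<close>

definition Pi_measure ::
  "real^'i^'i \<Rightarrow> ('i \<Rightarrow> 'i \<Rightarrow> real measure) \<Rightarrow> ('i \<Rightarrow> 'i \<Rightarrow> 'i \<Rightarrow> real measure) \<Rightarrow>
   'i::finite \<Rightarrow> 'i \<Rightarrow> real measure" where
  "Pi_measure Q \<Lambda> \<Lambda>U i k =
     measure_of UNIV (sets borel)
       (\<lambda>A. emeasure (\<Lambda> i k) A + (\<Sum>j\<in>UNIV - {i}. ennreal (Q $ i $ j) * emeasure (\<Lambda>U i j k) A))"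

definition jump_moment ::
  "real^'i^'i \<Rightarrow> ('i \<Rightarrow> 'i \<Rightarrow> real measure) \<Rightarrow> ('i \<Rightarrow> 'i \<Rightarrow> 'i \<Rightarrow> real measure) \<Rightarrow>
   real \<Rightarrow> 'i::finite \<Rightarrow> 'i \<Rightarrow> real" where
  "jump_moment Q \<Lambda> \<Lambda>U q i k = (LINT x:{..<0}|Pi_measure Q \<Lambda> \<Lambda>U i k. (1 - exp x) powr q)"

definition kappa ::
  "real^'i^'i \<Rightarrow> ('i \<Rightarrow> complex \<Rightarrow> complex) \<Rightarrow> ('i \<Rightarrow> 'i \<Rightarrow> real measure) \<Rightarrow>
   ('i \<Rightarrow> 'i \<Rightarrow> 'i \<Rightarrow> real measure) \<Rightarrow> 'i::finite \<Rightarrow> real \<Rightarrow> real" where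
  "kappa Q \<psi> \<Lambda> \<Lambda>U i q = Re (\<psi> i (of_real q)) + Q $ i $ i + jump_moment Q \<Lambda> \<Lambda>U q i i"

definition G_entry :: "('i \<Rightarrow> 'i \<Rightarrow> 'i \<Rightarrow> real measure) \<Rightarrow> 'i::finite \<Rightarrow> 'i \<Rightarrow> real \<Rightarrow> real" where
  "G_entry \<Lambda>U i j z = (\<Sum>k\<in>UNIV. LINT x|\<Lambda>U i j k. exp (z * x))"

definition F_hat ::
  "real^'i^'i \<Rightarrow> ('i \<Rightarrow> complex \<Rightarrow> complex) \<Rightarrow> ('i \<Rightarrow> 'i \<Rightarrow> real measure) \<Rightarrow>
   ('i \<Rightarrow> 'i \<Rightarrow> 'i \<Rightarrow> real measure) \<Rightarrow> real^'i \<Rightarrow> real \<Rightarrow> real \<Rightarrow> real^'i::finite^'i" where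
  "F_hat Q \<psi> \<Lambda> \<Lambda>U v \<omega> q =
     (\<chi> i j. if i = j then kappa Q \<psi> \<Lambda> \<Lambda>U i (\<omega> + q)
             else v $ j / v $ i *
                  (jump_moment Q \<Lambda> \<Lambda>U (q + \<omega>) i j + Q $ i $ j * G_entry \<Lambda>U i j (q + \<omega>)))"

definition chi_hat ::
  "real^'i^'i \<Rightarrow> ('i \<Rightarrow> complex \<Rightarrow> complex) \<Rightarrow> ('i \<Rightarrow> 'i \<Rightarrow> real measure) \<Rightarrow>
   ('i \<Rightarrow> 'i \<Rightarrow> 'i \<Rightarrow> real measure) \<Rightarrow> real^'i \<Rightarrow> real \<Rightarrow> real \<Rightarrow> real" where
  "chi_hat Q \<psi> \<Lambda> \<Lambda>U v \<omega> q = leading_eigenvalue (F_hat Q \<psi> \<Lambda> \<Lambda>U v \<omega> q :: real^'i::finite^'i)"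

definition cramer_condition ::
  "(real \<Rightarrow> 'i \<Rightarrow> 'i marked_path measure) \<Rightarrow> real^'i^'i \<Rightarrow> ('i \<Rightarrow> complex \<Rightarrow> complex) \<Rightarrow>
   ('i \<Rightarrow> 'i \<Rightarrow> real measure) \<Rightarrow> ('i \<Rightarrow> 'i \<Rightarrow> 'i \<Rightarrow> real measure) \<Rightarrow>
   real^'i::finite \<Rightarrow> real \<Rightarrow> real^'i \<Rightarrow> real \<Rightarrow> bool" where
  "cramer_condition L Q \<psi> \<Lambda> \<Lambda>U v1 \<omega>1 v2 \<omega>2 \<longleftrightarrow>
     0 < \<omega>1 \<and> \<omega>1 < \<omega>2 \<and>
     admissible L v1 \<omega>1 \<and> admissible L v2 \<omega>2 \<and>
     \<omega>1 \<in> interior {q. m_finite L q} \<and> \<omega>2 \<in> interior {q. m_finite L q} \<and>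
     (chi_hat Q \<psi> \<Lambda> \<Lambda>U v1 \<omega>1) differentiable (at (\<omega>2 - \<omega>1))"

end

theory Submission
  imports Defs
begin

text \<open>
  Put \<open>q = (\<omega>\<^sub>- + \<omega>\<^sub>+) / 2\<close> and \<open>w\<^sub>k = sqrt (v\<^sub>k\<^sup>- v\<^sub>k\<^sup>+)\<close>. The arithmetic-geometric mean inequality, applied to every jump,
  gives \<open>m(q) w \<le> w\<close>. If some row is strict, irreducibility yields a positive vector \<open>w'\<close> and \<open>\<rho> < 1\<close> with
  \<open>m(q) w' \<le> \<rho> w'\<close>; then the means of the sums of \<open>w'\<^sub>J X\<^sup>q\<close> over the generations decay geometrically, so these
  sums tend to \<open>0\<close> almost surely. In particular all cells are eventually smaller than \<open>1\<close>, and as \<open>q < \<omega>\<^sub>+\<close> the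
  sums with exponent \<open>\<omega>\<^sub>+\<close> tend to \<open>0\<close> as well.

  Equality in row \<open>i\<close> forces every negative jump of type \<open>k\<close> of a cell started from \<open>(1, i)\<close> to have the size
  \<open>(a\<^sub>k / a\<^sub>i) powr (1 / (\<omega>\<^sub>+ - \<omega>\<^sub>-))\<close>, where \<open>a\<^sub>k = v\<^sub>k\<^sup>- / v\<^sub>k\<^sup>+\<close>. Take \<open>k\<close> with \<open>a\<^sub>k\<close> maximal, so that this size is at least
  \<open>1\<close>. As \<open>m\<close> is irreducible, jumps of type \<open>k\<close> exist, hence negative ones are produced by a Levy process
  of some state \<open>i\<close> or by the special jumps out of some state \<open>i\<close>. Started from \<open>(1, i)\<close>, the cell has with
  positive probability such a jump so early that it is still close to \<open>1\<close> just before; the size of that jump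
  is less than \<open>1\<close>, and row \<open>i\<close> is strict.
\<close>

section \<open>Sums over the jumps of a cell\<close>

text \<open>The midpoint exponent is taken because there the contribution of each jump is the
  geometric mean of its contributions to the two eigenvector equations, with half a square as
  deficit. Equality in a row thus constrains almost every path, and one kind of path of positive
  probability refutes it. Which state produces jumps of type \<open>k\<close> cannot be prescribed;
  maximality of \<open>a\<^sub>k\<close> makes the forced size at least \<open>1\<close> for every
  starting state, so any jump of size below \<open>1\<close> will do. Such a jump must be extracted
  from the construction of the process. Independence is available only between the sigma-algebras of
  the separate sources, so the scenario is an intersection of events, one for each source. Sizes of
  jumps are not evaluations of a path; the events are therefore described by increments over dyadic
  grids, and right-continuity and compactness carry them over to jumps. The same grids show by
  counting that independent sources almost surely never jump together, without which the mark of a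
  jump would be ambiguous.\<close>

lemma infsum_ennreal_eq_nn_integral:
  fixes f :: "'a \<Rightarrow> ennreal"
  shows "infsum f A = (\<integral>\<^sup>+ x. f x \<partial>count_space A)"
proof -
  have 1: "infsum f A = (SUP F\<in>{F. finite F \<and> F \<subseteq> A}. sum f F)"
    by (rule nonneg_infsum_complete) simp
  show ?thesis
  proof (rule antisym)
    show "infsum f A \<le> (\<integral>\<^sup>+ x. f x \<partial>count_space A)"
      unfolding 1
    proof (rule SUP_least)
      fix F assume F: "F \<in> {F. finite F \<and> F \<subseteq> A}"
      then have "sum f F = (\<integral>\<^sup>+ x. f x * indicator F x \<partial>count_space A)"
        by (subst nn_integral_count_space'[of F]) (auto simp: indicator_def intro!: sum.cong)
      also have "\<dots> \<le> (\<integral>\<^sup>+ x. f x \<partial>count_space A)"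
        by (intro nn_integral_mono) (auto simp: indicator_def)
      finally show "sum f F \<le> (\<integral>\<^sup>+ x. f x \<partial>count_space A)" .
    qed
  next
    show "(\<integral>\<^sup>+ x. f x \<partial>count_space A) \<le> infsum f A"
      unfolding nn_integral_def 1
    proof (rule SUP_least)
      fix g assume "g \<in> {g. simple_function (count_space A) g \<and> g \<le> f}"
      then have g: "finite (g ` A)" "\<And>x. g x \<le> f x" by (auto simp: le_fun_def)
      let ?S = "SUP F\<in>{F. finite F \<and> F \<subseteq> A}. sum f F"
      have fin: "sum g F \<le> ?S" if "finite F" "F \<subseteq> A" for F
        by (rule order_trans[OF sum_mono[of F g f]]) (use that g in \<open>auto intro!: SUP_upper\<close>)
      show "integral\<^sup>S (count_space A) g \<le> ?S"
      proof (cases "finite {x\<in>A. g x \<noteq> 0}")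
        case True
        have "integral\<^sup>S (count_space A) g = (\<integral>\<^sup>+ x. g x \<partial>count_space A)"
          using g by (intro nn_integral_eq_simple_integral[symmetric]) simp
        also have "\<dots> = sum g {x\<in>A. g x \<noteq> 0}"
          using True by (subst nn_integral_count_space'[of "{x\<in>A. g x \<noteq> 0}"]) auto
        also have "\<dots> \<le> ?S" using True by (intro fin) auto
        finally show ?thesis .
      next
        \<comment> \<open>One of the finitely many values of \<open>g\<close> is nonzero and
          attained infinitely often; finite sums then exceed every \<open>of_nat n * y\<close>, and
          the supremum is infinite.\<close>
        case False
        have "{x\<in>A. g x \<noteq> 0} = (\<Union>y\<in>g ` A - {0}. {x\<in>A. g x = y})" by auto
        with False g(1) obtain y where y: "y \<noteq> 0" "infinite {x\<in>A. g x = y}"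
          by (metis (no_types, lifting) Diff_iff finite_Diff finite_UN_I singletonI)
        have "of_nat n * y \<le> ?S" for n
        proof -
          obtain F where F: "F \<subseteq> {x\<in>A. g x = y}" "finite F" "card F = n"
            using infinite_arbitrarily_large[OF y(2)] by blast
          have "of_nat n * y = sum g F" using F by (subst sum.cong[of F F g "\<lambda>_. y"]) auto
          also have "\<dots> \<le> ?S" using F by (intro fin) auto
          finally show ?thesis .
        qed
        then have "(SUP n. of_nat n * y) \<le> ?S" by (rule SUP_least)
        moreover have "(SUP n. of_nat n * y) = (SUP n. of_nat n) * y" by (rule SUP_mult_right_ennreal[symmetric])
        ultimately have "?S = \<infinity>" using y(1) by (metis ennreal_SUP_of_nat_eq_top ennreal_top_mult infinity_ennreal_def top_unique)
        then show ?thesis by (metis infinity_ennreal_def top_greatest)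
      qed
    qed
  qed
qed

text \<open>For \<open>f y = y powr q\<close> the mean under \<open>L 1 i\<close> is an entry of
  \<open>m(q)\<close>. General \<open>f\<close> is kept because rescaled powers and the deficit of
  the mean inequality are summed over the jumps as well.\<close>

definition jump_sum :: "(real \<Rightarrow> ennreal) \<Rightarrow> 'i \<Rightarrow> 'i marked_path \<Rightarrow> ennreal" where
  "jump_sum f k c = (\<integral>\<^sup>+ s. f \<bar>jump (pos c) s\<bar> \<partial>count_space {s \<in> neg_jumps c. snd c s = k})"

section \<open>Measurability of functionals of a cell\<close>

lemma space_cell_space [simp]: "space cell_space = cell_paths"
  unfolding cell_space_def by (rule space_measure_of) auto

lemma sets_cell_space: "sets cell_space = sigma_sets cell_paths
     ({{c \<in> cell_paths. \<exists>y\<in>A. fst c t = Some (y, j)} |t A j. 0 \<le> t \<and> A \<in> sets borel} \<union>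
      {{c \<in> cell_paths. finite (typed_jumps c t A k) \<and> card (typed_jumps c t A k) = n}
         |t A k n. 0 \<le> t \<and> A \<in> sets borel})"
  unfolding cell_space_def by (rule sets_measure_of) auto

text \<open>The generators of \<open>cell_space\<close> fix the count only where it is finite. An
  infinite count, encoded by \<open>None\<close>, is the complement of the countable union of these
  events.\<close>

lemma measurable_count_typed_jumps:
  assumes "0 \<le> t" "A \<in> sets borel"
  shows "(\<lambda>c. emeasure (count_space UNIV) (typed_jumps c t A k)) \<in> borel_measurable cell_space"
proof -
  have s: "{c \<in> cell_paths. finite (typed_jumps c t A k) \<and> card (typed_jumps c t A k) = n} \<in> sets cell_space" for n
    unfolding sets_cell_space using assms by (intro sigma_sets.Basic) blast
  define g where "g c = (if finite (typed_jumps c t A k) then Some (card (typed_jumps c t A k)) else None)" for c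
  have "g \<in> measurable cell_space (count_space UNIV)"
  proof (subst measurable_count_space_eq2_countable, safe)
    fix a
    have S: "g -` {Some n} \<inter> space cell_space = {c \<in> cell_paths. finite (typed_jumps c t A k) \<and> card (typed_jumps c t A k) = n}" for n
      by (auto simp: g_def split: if_splits)
    have N: "g -` {None} \<inter> space cell_space = space cell_space - (\<Union>n. g -` {Some n} \<inter> space cell_space)"
      by (auto simp: g_def split: if_splits)
    show "g -` {a} \<inter> space cell_space \<in> sets cell_space"
      using s by (cases a) (auto simp: S N simp del: space_cell_space intro!: sets.Diff sets.countable_UN)
  qed auto
  then have "(\<lambda>c. case g c of None \<Rightarrow> (\<infinity>::ennreal) | Some n \<Rightarrow> of_nat n) \<in> borel_measurable cell_space"
    by (rule measurable_compose) simp
  moreover have "(\<lambda>c. emeasure (count_space UNIV) (typed_jumps c t A k)) =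
      (\<lambda>c. case g c of None \<Rightarrow> (\<infinity>::ennreal) | Some n \<Rightarrow> of_nat n)"
    by (auto simp: g_def emeasure_count_space)
  ultimately show ?thesis by simp
qed

text \<open>The generators record signed jumps up to a finite time. Reflecting \<open>A\<close> into
  the negative half-line and letting the horizon grow along the integers turns the sum into a
  monotone limit of measurable counts.\<close>

lemma jump_sum_indicator:
  assumes "A \<in> sets borel"
  shows "jump_sum (indicator A) k c =
    (SUP n. emeasure (count_space UNIV) (typed_jumps c (real n) ({y. - y \<in> A} \<inter> {..<0}) k))"
proof -
  let ?B = "{y. - y \<in> A} \<inter> {..<0}"
  have "jump_sum (indicator A) k c = (\<integral>\<^sup>+ s. indicator {s \<in> neg_jumps c. snd c s = k \<and> \<bar>jump (pos c) s\<bar> \<in> A} s \<partial>count_space UNIV)"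
    unfolding jump_sum_def
    by (subst nn_integral_count_space_indicator, simp, rule nn_integral_cong) (auto split: split_indicator)
  also have "\<dots> = emeasure (count_space UNIV) {s \<in> neg_jumps c. snd c s = k \<and> \<bar>jump (pos c) s\<bar> \<in> A}"
    by (rule nn_integral_indicator) simp
  also have "{s \<in> neg_jumps c. snd c s = k \<and> \<bar>jump (pos c) s\<bar> \<in> A} = (\<Union>n. typed_jumps c (real n) ?B k)"
    by (auto simp: neg_jumps_def typed_jumps_def real_arch_simple)
  also have "emeasure (count_space UNIV) \<dots> = (SUP n. emeasure (count_space UNIV) (typed_jumps c (real n) ?B k))"
    by (rule SUP_emeasure_incseq[symmetric]) (auto simp: incseq_def typed_jumps_def)
  finally show ?thesis .
qed

lemma measurable_jump_sum [measurable]: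
  assumes "f \<in> borel_measurable borel"
  shows "jump_sum f k \<in> borel_measurable cell_space"
  using assms
proof (induction f rule: borel_measurable_induct)
  case (cong f g)
  then show ?case by (simp add: fun_eq_iff[symmetric])
next
  case (set A)
  have A: "{y::real. - y \<in> A} \<inter> {..<0} \<in> sets borel"
  proof -
    have "uminus -` A \<inter> space borel \<in> sets (borel::real measure)" using set by (intro measurable_sets[of uminus borel borel]) auto
    then show ?thesis by (auto simp: vimage_def)
  qed
  have "jump_sum (indicator A) k = (\<lambda>c. SUP n. emeasure (count_space UNIV) (typed_jumps c (real n) ({y. - y \<in> A} \<inter> {..<0}) k))"
    using jump_sum_indicator[OF set] by (auto simp: fun_eq_iff)
  then show ?case using measurable_count_typed_jumps[OF _ A, of "real _" k] by (auto intro!: borel_measurable_SUP)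
next
  case (mult u c)
  have "jump_sum (\<lambda>x. c * u x) k = (\<lambda>d. c * jump_sum u k d)"
    by (auto simp: jump_sum_def fun_eq_iff nn_integral_cmult)
  with mult show ?case by simp
next
  case (add u v)
  have "jump_sum (\<lambda>x. v x + u x) k = (\<lambda>d. jump_sum v k d + jump_sum u k d)"
    by (auto simp: jump_sum_def fun_eq_iff nn_integral_add)
  with add show ?case by simp
next
  case (seq U)
  have "jump_sum (\<lambda>x. SUP i. U i x) k = (\<lambda>d. SUP i. jump_sum (U i) k d)"
    unfolding jump_sum_def fun_eq_iff
    by (intro allI nn_integral_monotone_convergence_SUP) (use seq in \<open>auto simp: incseq_def le_fun_def\<close>)
  moreover have "(SUP i. U i) = (\<lambda>x. SUP i. U i x)" by (auto simp: fun_eq_iff image_comp)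
  ultimately show ?case using seq by (auto intro!: borel_measurable_SUP)
qed

text \<open>The value \<open>0\<close> for an absent cell lets sums over a generation run over all
  words of a given length, a fixed countable index set instead of a random one.\<close>

definition cell_value :: "('i \<Rightarrow> real \<Rightarrow> ennreal) \<Rightarrow> 'i marked_path \<Rightarrow> ennreal" where
  "cell_value f c = (case fst c 0 of None \<Rightarrow> 0 | Some (y, j) \<Rightarrow> f j y)"

lemma measurable_cell_value [measurable]:
  fixes f :: "'i::finite \<Rightarrow> real \<Rightarrow> ennreal"
  assumes [measurable]: "\<And>j. f j \<in> borel_measurable borel"
  shows "cell_value f \<in> borel_measurable cell_space"
proof -
  have s: "{c \<in> cell_paths. \<exists>y\<in>A. fst c 0 = Some (y, j)} \<in> sets cell_space" if "A \<in> sets borel" for A :: "real set" and j :: 'i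
    unfolding sets_cell_space using that by (intro sigma_sets.Basic) force
  define h where "h j c = (case fst c 0 of None \<Rightarrow> 0 | Some (y, l) \<Rightarrow> if l = j then y else (0::real))" for j and c :: "'i marked_path"
  define a where "a j c = (case fst c 0 of None \<Rightarrow> 0 | Some (y, l) \<Rightarrow> if l = j then (1::ennreal) else 0)" for j and c :: "'i marked_path"
  have [measurable]: "h j \<in> borel_measurable cell_space" for j
  proof (rule measurableI)
    fix A :: "real set" assume A: "A \<in> sets borel"
    \<comment> \<open>Because of the default \<open>0\<close> of \<open>h\<close>, every cell that
      does not start in type \<open>j\<close> belongs to the preimage of a set containing
      \<open>0\<close>.\<close>
    have "h j -` A \<inter> space cell_space = {c \<in> cell_paths. \<exists>y\<in>A. fst c 0 = Some (y, j)} \<union>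
       (if 0 \<in> A then space cell_space - {c \<in> cell_paths. \<exists>y\<in>UNIV. fst c 0 = Some (y, j)} else {})"
      by (auto simp: h_def split: option.splits if_splits)
    also have "\<dots> \<in> sets cell_space"
    proof (cases "0 \<in> A")
      case True
      have "space cell_space - {c \<in> cell_paths. \<exists>y\<in>UNIV. fst c 0 = Some (y, j)} \<in> sets cell_space"
        by (rule sets.compl_sets, rule s) simp
      with s[OF A, of j] show ?thesis unfolding if_P[OF True] by (rule sets.Un)
    next
      case False
      show ?thesis unfolding if_not_P[OF False] Un_empty_right by (rule s[OF A])
    qed
    finally show "h j -` A \<inter> space cell_space \<in> sets cell_space" .
  qed auto
  have [measurable]: "a j \<in> borel_measurable cell_space" for j
  proof -
    have "a j = indicator {c. \<exists>y\<in>UNIV. fst c 0 = Some (y, j)}"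
      by (auto simp: a_def fun_eq_iff indicator_def split: option.splits)
    moreover have "{c. \<exists>y\<in>UNIV. fst c 0 = Some (y, j)} \<inter> space cell_space \<in> sets cell_space"
    proof -
      have "{c. \<exists>y\<in>UNIV. fst c 0 = Some (y, j)} \<inter> space cell_space = {c \<in> cell_paths. \<exists>y\<in>UNIV. fst c 0 = Some (y, j)}"
        by auto
      then show ?thesis using s[of UNIV j] by simp
    qed
    ultimately show ?thesis by (simp add: borel_measurable_indicator_iff del: space_cell_space)
  qed
  have "cell_value f = (\<lambda>c. \<Sum>j\<in>UNIV. a j c * f j (h j c))"
  proof
    fix c :: "'i marked_path"
    show "cell_value f c = (\<Sum>j\<in>UNIV. a j c * f j (h j c))"
    proof (cases "fst c 0")
      case None then show ?thesis by (simp add: cell_value_def a_def)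
    next
      case (Some p)
      obtain y l where p: "p = (y, l)" by (cases p)
      have "(\<Sum>j\<in>UNIV. a j c * f j (h j c)) = (\<Sum>j\<in>UNIV. if j = l then f j y else 0)"
        by (intro sum.cong) (auto simp: a_def h_def Some p)
      then show ?thesis by (simp add: cell_value_def Some p)
    qed
  qed
  then show ?thesis by simp
qed

section \<open>Ranked negative jumps and children\<close>

lemma neg_jumps_no_cell [simp]: "neg_jumps no_cell = {}"
  by (simp add: neg_jumps_def alive_def no_cell_def)

lemma no_cell_in_cell_paths [simp]: "no_cell \<in> cell_paths"
proof -
  have "\<not> alive no_cell t" for t by (simp add: alive_def no_cell_def)
  then show ?thesis unfolding cell_paths_def
    by (intro CollectI exI[of _ "0::ereal"]) (auto simp: not_less)
qed

lemma precedes_linear: "s \<noteq> s' \<Longrightarrow> precedes c s s' \<or> precedes c s' s"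
  by (auto simp: precedes_def)

lemma precedes_trans: "precedes c s s' \<Longrightarrow> precedes c s' s'' \<Longrightarrow> precedes c s s''"
  by (auto simp: precedes_def)

lemma precedes_irrefl: "\<not> precedes c s s"
  by (auto simp: precedes_def)

text \<open>Whatever precedes \<open>s\<close> precedes \<open>s'\<close>, and \<open>s\<close>
  itself is a further predecessor of \<open>s'\<close>; the counts that define the ranks differ
  strictly. Hence at most one jump has a given rank.\<close>

lemma has_rank_less:
  assumes "has_rank c k s" "has_rank c k' s'" "precedes c s s'"
  shows "k < k'"
proof -
  have "{r \<in> neg_jumps c. precedes c r s} \<subset> {r \<in> neg_jumps c. precedes c r s'}"
    using assms precedes_trans[of c _ s s'] precedes_irrefl[of c s] by (auto simp: has_rank_def)
  then show ?thesis using assms unfolding has_rank_def by (metis (no_types, lifting) psubset_card_mono)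
qed

lemma has_rank_unique: "has_rank c k s \<Longrightarrow> has_rank c k s' \<Longrightarrow> s = s'"
  using has_rank_less[of c k s k s'] has_rank_less[of c k s' k s] precedes_linear[of s s' c] by blast

lemma child_Some:
  assumes "child c k = Some (y, \<beta>, j)"
  shows "has_rank c k \<beta>" "y = \<bar>jump (pos c) \<beta>\<bar>" "j = snd c \<beta>" "\<beta> \<in> neg_jumps c" "0 < y"
proof -
  from assms obtain s where s: "has_rank c k s" unfolding child_def by (auto split: if_splits)
  then have "(THE s. has_rank c k s) = s" using has_rank_unique by blast
  with assms s have "y = \<bar>jump (pos c) s\<bar>" "\<beta> = s" "j = snd c s"
    unfolding child_def by (auto simp: Let_def split: if_splits)
  with s show "has_rank c k \<beta>" "y = \<bar>jump (pos c) \<beta>\<bar>" "j = snd c \<beta>" "\<beta> \<in> neg_jumps c" "0 < y"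
    by (auto simp: has_rank_def neg_jumps_def)
qed

definition child_value :: "('i \<Rightarrow> real \<Rightarrow> ennreal) \<Rightarrow> 'i marked_path \<Rightarrow> nat \<Rightarrow> ennreal" where
  "child_value f c k = (case child c k of None \<Rightarrow> 0 | Some (y, \<beta>, j) \<Rightarrow> f j y)"

text \<open>Only an upper bound: the map from ranks to jumps is injective, but a jump with
  infinitely many predecessors would have no rank and produce no child.\<close>

lemma sum_child_value_le:
  fixes f :: "'i::finite \<Rightarrow> real \<Rightarrow> ennreal"
  shows "(\<integral>\<^sup>+ k. child_value f c k \<partial>count_space UNIV) \<le> (\<Sum>j\<in>UNIV. jump_sum (f j) j c)"
proof -
  define K where "K = {k. child c k \<noteq> None}"
  define S where "S k = fst (snd (the (child c k)))" for k
  have S: "has_rank c k (S k)" "child_value f c k = f (snd c (S k)) \<bar>jump (pos c) (S k)\<bar>" "S k \<in> neg_jumps c" if "k \<in> K" for k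
    using that child_Some[of c k] by (auto simp: K_def S_def child_value_def)
  have 0: "child_value f c k = 0" if "k \<notin> K" for k
  proof -
    have "child c k = None" using that by (simp add: K_def del: not_None_eq)
    then show ?thesis by (simp add: child_value_def)
  qed
  have inj: "inj_on S K"
    by (rule inj_onI) (metis S(1) has_rank_def)
  have "(\<integral>\<^sup>+ k. child_value f c k \<partial>count_space UNIV) = (\<integral>\<^sup>+ k. child_value f c k \<partial>count_space K)"
    by (rule nn_integral_count_space_eq) (use 0 in auto)
  also have "\<dots> = (\<integral>\<^sup>+ k. f (snd c (S k)) \<bar>jump (pos c) (S k)\<bar> \<partial>count_space K)"
    using S by (intro nn_integral_cong) auto
  also have "\<dots> = (\<integral>\<^sup>+ s. f (snd c s) \<bar>jump (pos c) s\<bar> \<partial>count_space (S ` K))"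
    by (rule nn_integral_bij_count_space) (use inj in \<open>simp add: bij_betw_def\<close>)
  also have "\<dots> \<le> (\<integral>\<^sup>+ s. f (snd c s) \<bar>jump (pos c) s\<bar> \<partial>count_space (neg_jumps c))"
    using S by (subst (1 2) nn_integral_count_space_indicator) (auto intro!: nn_integral_mono simp: indicator_def)
  also have "\<dots> = (\<integral>\<^sup>+ s. (\<Sum>j\<in>UNIV. f j \<bar>jump (pos c) s\<bar> * indicator {s. snd c s = j} s) \<partial>count_space (neg_jumps c))"
    by (intro nn_integral_cong) (simp add: indicator_def if_distrib cong: if_cong)
  also have "\<dots> = (\<Sum>j\<in>UNIV. jump_sum (f j) j c)"
    unfolding jump_sum_def
    by (subst nn_integral_sum) (auto intro!: sum.cong nn_integral_cong simp: nn_integral_count_space_indicator split: split_indicator)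
  finally show ?thesis .
qed

text \<open>The kernel \<open>K\<close> is not assumed measurable in \<open>w\<close>. For each
  \<open>B\<close> there is only a measurable version \<open>r\<close> of the map from
  \<open>w\<close> to \<open>emeasure (K w) B\<close>, as a conditional probability provides one;
  the induction over \<open>f\<close> carries such a version along, with almost sure equality at
  every step.\<close>

lemma nn_integral_kernel:
  assumes X: "X \<in> measurable M N"
    and K: "\<And>w. sets (K w) = sets N"
    and KB: "\<And>B. B \<in> sets N \<Longrightarrow> \<exists>r\<in>borel_measurable M. (AE w in M. r w = emeasure (K w) B) \<and>
        emeasure M (X -` B \<inter> space M) = (\<integral>\<^sup>+ w. r w \<partial>M)"
    and f: "f \<in> borel_measurable N"
  shows "\<exists>r\<in>borel_measurable M. (AE w in M. r w = (\<integral>\<^sup>+ c. f c \<partial>K w)) \<and>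
        (\<integral>\<^sup>+ w. f (X w) \<partial>M) = (\<integral>\<^sup>+ w. r w \<partial>M)"
  using f
proof (induction f rule: borel_measurable_induct)
  case (cong f g)
  have "(\<integral>\<^sup>+ w. f (X w) \<partial>M) = (\<integral>\<^sup>+ w. g (X w) \<partial>M)"
    using cong(3) X by (intro nn_integral_cong) (auto dest: measurable_space)
  moreover have "(\<integral>\<^sup>+ c. f c \<partial>K w) = (\<integral>\<^sup>+ c. g c \<partial>K w)" for w
    using cong(3) by (intro nn_integral_cong) (simp add: sets_eq_imp_space_eq[OF K])
  ultimately show ?case using cong(4) by simp
next
  case (set A)
  have "(\<integral>\<^sup>+ w. indicator A (X w) \<partial>M) = (\<integral>\<^sup>+ w. indicator (X -` A \<inter> space M) w \<partial>M)"
    by (intro nn_integral_cong) (auto simp: indicator_def)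
  also have "\<dots> = emeasure M (X -` A \<inter> space M)"
    using measurable_sets[OF X set] by simp
  finally show ?case using KB[OF set] set by (simp add: K)
next
  case (mult u c)
  from mult(4) obtain r where r: "r \<in> borel_measurable M" "AE w in M. r w = (\<integral>\<^sup>+ c. u c \<partial>K w)"
    "(\<integral>\<^sup>+ w. u (X w) \<partial>M) = (\<integral>\<^sup>+ w. r w \<partial>M)" by blast
  have m: "u \<in> borel_measurable (K w)" for w using mult(2) measurable_cong_sets[OF K refl] by blast
  have "(\<integral>\<^sup>+ w. c * u (X w) \<partial>M) = (\<integral>\<^sup>+ w. c * r w \<partial>M)"
    using r mult X by (simp add: nn_integral_cmult)
  moreover have "AE w in M. c * r w = (\<integral>\<^sup>+ x. c * u x \<partial>K w)"
    using r(2) by eventually_elim (simp add: nn_integral_cmult m)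
  ultimately show ?case using r(1) by (intro bexI[of _ "\<lambda>w. c * r w"]) auto
next
  case (add u v)
  from add obtain r where r: "r \<in> borel_measurable M" "AE w in M. r w = (\<integral>\<^sup>+ c. u c \<partial>K w)"
    "(\<integral>\<^sup>+ w. u (X w) \<partial>M) = (\<integral>\<^sup>+ w. r w \<partial>M)" by blast
  from add obtain r' where r': "r' \<in> borel_measurable M" "AE w in M. r' w = (\<integral>\<^sup>+ c. v c \<partial>K w)"
    "(\<integral>\<^sup>+ w. v (X w) \<partial>M) = (\<integral>\<^sup>+ w. r' w \<partial>M)" by blast
  have m: "u \<in> borel_measurable (K w)" "v \<in> borel_measurable (K w)" for w using add measurable_cong_sets[OF K refl] by blast+
  have "(\<integral>\<^sup>+ w. v (X w) + u (X w) \<partial>M) = (\<integral>\<^sup>+ w. r' w + r w \<partial>M)"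
    using r r' add X by (simp add: nn_integral_add)
  moreover have "AE w in M. r' w + r w = (\<integral>\<^sup>+ x. v x + u x \<partial>K w)"
    using r(2) r'(2) by eventually_elim (simp add: nn_integral_add m)
  ultimately show ?case using r(1) r'(1) by (intro bexI[of _ "\<lambda>w. r' w + r w"]) auto
next
  case (seq U)
  then have "\<forall>i. \<exists>r. r \<in> borel_measurable M \<and> (AE w in M. r w = (\<integral>\<^sup>+ c. U i c \<partial>K w)) \<and>
    (\<integral>\<^sup>+ w. U i (X w) \<partial>M) = (\<integral>\<^sup>+ w. r w \<partial>M)" by blast
  then obtain r where r: "\<And>i. r i \<in> borel_measurable M" "\<And>i. AE w in M. r i w = (\<integral>\<^sup>+ c. U i c \<partial>K w)"
    "\<And>i. (\<integral>\<^sup>+ w. U i (X w) \<partial>M) = (\<integral>\<^sup>+ w. r i w \<partial>M)" by metis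
  have m: "U i \<in> borel_measurable (K w)" for w i using seq(1) measurable_cong_sets[OF K refl] by blast
  \<comment> \<open>Countably many versions are exact on a common almost sure set, where their
    supremum is the version for the limit.\<close>
  have ae: "AE w in M. \<forall>i. r i w = (\<integral>\<^sup>+ c. U i c \<partial>K w)" using r(2) by (simp add: AE_all_countable)
  have S: "(SUP i. U i) = (\<lambda>x. SUP i. U i x)" by (auto simp: fun_eq_iff image_comp)
  have inc: "incseq (\<lambda>i. U i c)" for c using seq(3) by (auto simp: incseq_def le_fun_def)
  have "(\<integral>\<^sup>+ w. (SUP i. U i (X w)) \<partial>M) = (SUP i. \<integral>\<^sup>+ w. U i (X w) \<partial>M)"
    using seq X by (intro nn_integral_monotone_convergence_SUP) (auto simp: incseq_def le_fun_def)
  also have "\<dots> = (SUP i. \<integral>\<^sup>+ w. r i w \<partial>M)" using r(3) by simp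
  also have "\<dots> = (\<integral>\<^sup>+ w. (SUP i. r i w) \<partial>M)"
  proof (rule nn_integral_monotone_convergence_SUP_AE[symmetric])
    fix i
    show "AE w in M. r i w \<le> r (Suc i) w"
      using ae by eventually_elim (use seq(3) in \<open>auto intro!: nn_integral_mono simp: incseq_def le_fun_def\<close>)
  qed (use r in auto)
  finally have 1: "(\<integral>\<^sup>+ w. (SUP i. U i (X w)) \<partial>M) = (\<integral>\<^sup>+ w. (SUP i. r i w) \<partial>M)" .
  have "AE w in M. (SUP i. r i w) = (\<integral>\<^sup>+ x. (SUP i. U i x) \<partial>K w)"
    using ae
  proof eventually_elim
    case (elim w)
    have "(\<integral>\<^sup>+ x. (SUP i. U i x) \<partial>K w) = (SUP i. \<integral>\<^sup>+ x. U i x \<partial>K w)"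
      using m seq(3) by (intro nn_integral_monotone_convergence_SUP) auto
    with elim show ?case by simp
  qed
  with 1 r(1) show ?case unfolding S by (intro bexI[of _ "\<lambda>w. SUP i. r i w"]) auto
qed

section \<open>Mean genealogical sums\<close>

lemma subalgebra_vimage_algebra:
  assumes "f \<in> measurable M N"
  shows "subalgebra M (vimage_algebra (space M) f N)"
proof -
  have "{f -` A \<inter> space M |A. A \<in> sets N} \<subseteq> sets M" using assms by (auto dest: measurable_sets)
  then show ?thesis unfolding subalgebra_def sets_vimage_algebra by (simp add: sets.sigma_sets_subset)
qed

text \<open>A missing child gets the point mass at \<open>no_cell\<close>, in agreement with
  \<open>child_prob\<close>, so that every label carries a law.\<close>

definition child_kernel ::
  "(real \<Rightarrow> 'i \<Rightarrow> 'i marked_path measure) \<Rightarrow> 'i marked_path \<Rightarrow> nat \<Rightarrow> 'i marked_path measure" where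
  "child_kernel L c k = (case child c k of None \<Rightarrow> return cell_space no_cell | Some (y, \<beta>, j) \<Rightarrow> L y j)"

text \<open>The branching argument sees the cell laws only through these facts: they are probability
  laws on the cell space, and their paths start in the prescribed state. Self-similarity enters
  later, as an explicit hypothesis on jump sums.\<close>

locale cells =
  fixes L :: "real \<Rightarrow> 'i::finite \<Rightarrow> 'i marked_path measure"
    and x :: real and i :: 'i and M :: "'c measure"
    and C :: "nat list \<Rightarrow> 'c \<Rightarrow> 'i marked_path" and b :: "nat list \<Rightarrow> 'c \<Rightarrow> real"
  assumes cs: "cell_system L x i M C b"
    and x_pos: "0 < x"
    and L_prob: "0 < y \<Longrightarrow> prob_space (L y j)"
    and L_sets [measurable_cong]: "sets (L y j) = sets cell_space"
    and L_start: "0 < y \<Longrightarrow> AE c in L y j. fst c 0 = Some (y, j)"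
begin

sublocale prob_space M
  using cs by (simp add: cell_system_def)

lemma C_measurable [measurable]: "C u \<in> measurable M cell_space"
  using cs by (simp add: cell_system_def)

lemma sets_child_kernel: "sets (child_kernel L c k) = sets cell_space"
  by (auto simp: child_kernel_def L_sets split: option.splits)

lemma emeasure_child_kernel:
  assumes "B \<in> sets cell_space"
  shows "emeasure (child_kernel L c k) B = ennreal (child_prob L c k B)"
proof (cases "child c k")
  case None
  then show ?thesis using assms
    by (simp add: child_kernel_def child_prob_def indicator_def)
next
  case (Some p)
  obtain y \<beta> j where p: "p = (y, \<beta>, j)" by (cases p)
  then have "0 < y" using child_Some[of c k] Some by blast
  then interpret L: prob_space "L y j" by (rule L_prob)
  show ?thesis by (simp add: child_kernel_def child_prob_def Some p L.emeasure_eq_measure)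
qed

lemma subalgebra_generations: "subalgebra M (generations M C n)"
  unfolding generations_def by (rule subalgebra_vimage_algebra) measurable

text \<open>The branching property is applied to the one-element family \<open>{p @ [k]}\<close>.
  The conditional probability is the measurable version of the kernel, and its integral is the
  probability of the event.\<close>

lemma child_probability:
  assumes B: "B \<in> sets cell_space"
  shows "\<exists>r\<in>borel_measurable M. (AE w in M. r w = emeasure (child_kernel L (C p w) k) B) \<and>
        emeasure M (C (p @ [k]) -` B \<inter> space M) = (\<integral>\<^sup>+ w. r w \<partial>M)"
proof -
  define G where "G = generations M C (length p)"
  interpret finite_measure_subalgebra M G
    by unfold_locales (simp add: G_def subalgebra_generations)
  let ?S = "{w \<in> space M. \<forall>u\<in>{p @ [k]}. C u w \<in> B}"
  have SB: "?S = C (p @ [k]) -` B \<inter> space M" by auto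
  have S [measurable]: "?S \<in> sets M" unfolding SB using B by measurable
  have ae: "AE w in M. real_cond_exp M G (indicator ?S) w = child_prob L (C p w) k B"
  proof -
    have "AE w in M. real_cond_exp M (generations M C (length p)) (indicator {w \<in> space M. \<forall>u\<in>{p @ [k]}. C u w \<in> B}) w =
      (\<Prod>u\<in>{p @ [k]}. child_prob L (C (butlast u) w) (last u) B)"
      using cs[unfolded cell_system_def, THEN conjunct2, THEN conjunct2, THEN conjunct2, THEN conjunct1,
          rule_format, of "{p @ [k]}" "length p" "\<lambda>_. B"] B by simp
    then show ?thesis by (simp add: G_def)
  qed
  have nn: "AE w in M. 0 \<le> real_cond_exp M G (indicator ?S) w"
    using ae by eventually_elim (auto simp: child_prob_def split: option.splits)
  have int: "integrable M (indicator ?S :: 'c \<Rightarrow> real)"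
    by (rule integrable_real_indicator[OF S]) (simp add: emeasure_eq_measure)
  have "?S \<inter> space M = ?S" by auto
  then have "emeasure M ?S = ennreal (\<integral>w. indicator ?S w \<partial>M)"
    by (simp only: Bochner_Integration.integral_indicator emeasure_eq_measure)
  also have "\<dots> = ennreal (\<integral>w. real_cond_exp M G (indicator ?S) w \<partial>M)"
    using real_cond_exp_int(2)[OF int] by simp
  also have "\<dots> = (\<integral>\<^sup>+ w. ennreal (real_cond_exp M G (indicator ?S) w) \<partial>M)"
    using real_cond_exp_int(1)[OF int] nn by (intro nn_integral_eq_integral[symmetric])
  finally have 1: "emeasure M (C (p @ [k]) -` B \<inter> space M) = (\<integral>\<^sup>+ w. ennreal (real_cond_exp M G (indicator ?S) w) \<partial>M)"
    unfolding SB .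
  have 2: "AE w in M. ennreal (real_cond_exp M G (indicator ?S) w) = emeasure (child_kernel L (C p w) k) B"
    using ae by eventually_elim (simp add: emeasure_child_kernel[OF B])
  show ?thesis
    by (rule bexI[where x = "\<lambda>w. ennreal (real_cond_exp M G (indicator ?S) w)"]) (use 1 2 in auto)
qed

lemma child_expectation:
  assumes "f \<in> borel_measurable cell_space"
  shows "\<exists>r\<in>borel_measurable M. (AE w in M. r w = (\<integral>\<^sup>+ c. f c \<partial>child_kernel L (C p w) k)) \<and>
        (\<integral>\<^sup>+ w. f (C (p @ [k]) w) \<partial>M) = (\<integral>\<^sup>+ w. r w \<partial>M)"
  using nn_integral_kernel[OF C_measurable _ _ assms, of "\<lambda>w. child_kernel L (C p w) k"]
    sets_child_kernel child_probability by blast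

lemma nn_integral_cell_value:
  assumes "0 < y"
  shows "(\<integral>\<^sup>+ c. cell_value f c \<partial>L y j) = f j y"
proof -
  interpret L: prob_space "L y j" using assms by (rule L_prob)
  have "(\<integral>\<^sup>+ c. cell_value f c \<partial>L y j) = (\<integral>\<^sup>+ c. f j y \<partial>L y j)"
    using L_start[OF assms, of j] by (intro nn_integral_cong_AE) (auto simp: cell_value_def)
  also have "\<dots> = f j y" by (simp add: L.emeasure_space_1)
  finally show ?thesis .
qed

lemma nn_integral_cell_value_child:
  assumes "\<And>j. f j \<in> borel_measurable borel"
  shows "(\<integral>\<^sup>+ d. cell_value f d \<partial>child_kernel L c k) = child_value f c k"
proof (cases "child c k")
  case None
  have "(\<integral>\<^sup>+ d. cell_value f d \<partial>return cell_space no_cell) = cell_value f no_cell"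
    using assms by (intro nn_integral_return) auto
  then show ?thesis using None by (simp add: child_kernel_def child_value_def cell_value_def no_cell_def)
next
  case (Some p)
  obtain y \<beta> j where p: "p = (y, \<beta>, j)" by (cases p)
  then have "0 < y" using child_Some[of c k] Some by blast
  then show ?thesis by (simp add: child_kernel_def child_value_def Some p nn_integral_cell_value)
qed

text \<open>A sum of means over labels, not the mean of a sum; the two are exchanged only in
  \<open>generation_mean_AE_tendsto_0\<close>.\<close>

definition generation_mean :: "('i \<Rightarrow> real \<Rightarrow> ennreal) \<Rightarrow> nat \<Rightarrow> ennreal" where
  "generation_mean f n = (\<integral>\<^sup>+ u. (\<integral>\<^sup>+ w. cell_value f (C u w) \<partial>M) \<partial>count_space {u. length u = n})"

text \<open>The hypothesis concerns a cell with a fixed initial state; integrating it against the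
  law of the parent gives the bound for the cell \<open>p\<close>. The Eve cell is covered by its
  own law, and an absent cell has no jumps.\<close>

lemma jump_sum_mean_le:
  assumes f: "\<And>j. f j \<in> borel_measurable borel" and g: "\<And>j. g j \<in> borel_measurable borel"
    and le: "\<And>y j. 0 < y \<Longrightarrow> (\<integral>\<^sup>+ c. (\<Sum>k\<in>UNIV. jump_sum (f k) k c) \<partial>L y j) \<le> g j y"
  shows "(\<integral>\<^sup>+ w. (\<Sum>k\<in>UNIV. jump_sum (f k) k (C p w)) \<partial>M) \<le> (\<integral>\<^sup>+ w. cell_value g (C p w) \<partial>M)"
proof (cases p rule: rev_cases)
  case Nil
  have L: "L x i = distr M cell_space (C [])" using cs by (simp add: cell_system_def)
  have "(\<integral>\<^sup>+ w. (\<Sum>k\<in>UNIV. jump_sum (f k) k (C [] w)) \<partial>M) = (\<integral>\<^sup>+ c. (\<Sum>k\<in>UNIV. jump_sum (f k) k c) \<partial>L x i)"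
    unfolding L using f by (subst nn_integral_distr) auto
  also have "\<dots> \<le> g i x" using le x_pos by simp
  also have "\<dots> = (\<integral>\<^sup>+ c. cell_value g c \<partial>L x i)" using x_pos by (simp add: nn_integral_cell_value)
  also have "\<dots> = (\<integral>\<^sup>+ w. cell_value g (C [] w) \<partial>M)"
    unfolding L using g by (subst nn_integral_distr) auto
  finally show ?thesis by (simp add: Nil)
next
  case (snoc p' k)
  have m: "(\<lambda>c. \<Sum>k\<in>UNIV. jump_sum (f k) k c) \<in> borel_measurable cell_space" using f by measurable
  have eq: "(\<integral>\<^sup>+ w. h (C p w) \<partial>M) = (\<integral>\<^sup>+ w. (\<integral>\<^sup>+ c. h c \<partial>child_kernel L (C p' w) k) \<partial>M)"
    if h: "h \<in> borel_measurable cell_space" for h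
  proof -
    obtain r where r: "AE w in M. r w = (\<integral>\<^sup>+ c. h c \<partial>child_kernel L (C p' w) k)"
      "(\<integral>\<^sup>+ w. h (C p w) \<partial>M) = (\<integral>\<^sup>+ w. r w \<partial>M)"
      using child_expectation[OF h, of p' k] unfolding snoc by blast
    show ?thesis unfolding r(2) using r(1) by (rule nn_integral_cong_AE)
  qed
  have "(\<integral>\<^sup>+ w. (\<Sum>k\<in>UNIV. jump_sum (f k) k (C p w)) \<partial>M) =
      (\<integral>\<^sup>+ w. (\<integral>\<^sup>+ c. (\<Sum>k\<in>UNIV. jump_sum (f k) k c) \<partial>child_kernel L (C p' w) k) \<partial>M)"
    by (rule eq[OF m])
  also have "\<dots> \<le> (\<integral>\<^sup>+ w. (\<integral>\<^sup>+ c. cell_value g c \<partial>child_kernel L (C p' w) k) \<partial>M)"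
  proof (rule nn_integral_mono)
    fix w
    show "(\<integral>\<^sup>+ c. (\<Sum>k\<in>UNIV. jump_sum (f k) k c) \<partial>child_kernel L (C p' w) k) \<le>
        (\<integral>\<^sup>+ c. cell_value g c \<partial>child_kernel L (C p' w) k)"
    proof (cases "child (C p' w) k")
      case None
      have "(\<integral>\<^sup>+ c. (\<Sum>k\<in>UNIV. jump_sum (f k) k c) \<partial>return cell_space no_cell) = 0"
        using m by (subst nn_integral_return) (simp_all add: jump_sum_def nn_integral_empty)
      then show ?thesis by (simp add: child_kernel_def None)
    next
      case (Some q)
      obtain y \<beta> j where q: "q = (y, \<beta>, j)" by (cases q)
      then have y: "0 < y" using child_Some[of "C p' w" k] Some by blast
      show ?thesis using le[OF y, of j] by (simp add: child_kernel_def Some q nn_integral_cell_value[OF y])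
    qed
  qed
  also have "\<dots> = (\<integral>\<^sup>+ w. cell_value g (C p w) \<partial>M)" using g by (intro eq[symmetric]) auto
  finally show ?thesis .
qed

text \<open>Summation over \<open>k\<close> and expectation are exchanged for the versions
  \<open>r k\<close>; the comparison with the jumps of the parent is then pathwise, on the set where
  all versions are exact.\<close>

lemma children_mean_le:
  assumes f: "\<And>j. f j \<in> borel_measurable borel"
  shows "(\<integral>\<^sup>+ k. (\<integral>\<^sup>+ w. cell_value f (C (p @ [k]) w) \<partial>M) \<partial>count_space UNIV) \<le>
     (\<integral>\<^sup>+ w. (\<Sum>k\<in>UNIV. jump_sum (f k) k (C p w)) \<partial>M)"
proof -
  have m: "cell_value f \<in> borel_measurable cell_space" using f by measurable
  have "\<forall>k. \<exists>r. r \<in> borel_measurable M \<and>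
      (AE w in M. r w = (\<integral>\<^sup>+ c. cell_value f c \<partial>child_kernel L (C p w) k)) \<and>
      (\<integral>\<^sup>+ w. cell_value f (C (p @ [k]) w) \<partial>M) = (\<integral>\<^sup>+ w. r w \<partial>M)"
    using child_expectation[OF m, of p] by blast
  from choice[OF this] obtain r where r: "\<And>k. r k \<in> borel_measurable M"
    "\<And>k. AE w in M. r k w = (\<integral>\<^sup>+ c. cell_value f c \<partial>child_kernel L (C p w) k)"
    "\<And>k. (\<integral>\<^sup>+ w. cell_value f (C (p @ [k]) w) \<partial>M) = (\<integral>\<^sup>+ w. r k w \<partial>M)"
    by blast
  have "(\<integral>\<^sup>+ k. (\<integral>\<^sup>+ w. cell_value f (C (p @ [k]) w) \<partial>M) \<partial>count_space UNIV) =
      (\<integral>\<^sup>+ w. (\<integral>\<^sup>+ k. r k w \<partial>count_space UNIV) \<partial>M)"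
    unfolding r(3) by (rule nn_integral_count_space_nn_integral[symmetric]) (use r(1) in auto)
  also have "\<dots> \<le> (\<integral>\<^sup>+ w. (\<Sum>k\<in>UNIV. jump_sum (f k) k (C p w)) \<partial>M)"
  proof (rule nn_integral_mono_AE)
    have "AE w in M. \<forall>k. r k w = (\<integral>\<^sup>+ c. cell_value f c \<partial>child_kernel L (C p w) k)"
      using r(2) by (simp add: AE_all_countable)
    then show "AE w in M. (\<integral>\<^sup>+ k. r k w \<partial>count_space UNIV) \<le> (\<Sum>k\<in>UNIV. jump_sum (f k) k (C p w))"
      by eventually_elim (simp add: nn_integral_cell_value_child[OF f] sum_child_value_le)
  qed
  finally show ?thesis .
qed

lemma generation_mean_Suc_le:
  assumes f: "\<And>j. f j \<in> borel_measurable borel" and g: "\<And>j. g j \<in> borel_measurable borel"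
    and le: "\<And>y j. 0 < y \<Longrightarrow> (\<integral>\<^sup>+ c. (\<Sum>k\<in>UNIV. jump_sum (f k) k c) \<partial>L y j) \<le> g j y"
  shows "generation_mean f (Suc n) \<le> generation_mean g n"
proof -
  let ?h = "\<lambda>u. \<integral>\<^sup>+ w. cell_value f (C u w) \<partial>M"
  \<comment> \<open>A nonempty word is its parent followed by a last letter, so the sum over a
    generation becomes an iterated sum over parents and ranks.\<close>
  have bij: "bij_betw (\<lambda>(p, k). p @ [k]) ({p. length p = n} \<times> UNIV) {u::nat list. length u = Suc n}"
  proof (rule bij_betw_imageI)
    show "(\<lambda>(p, k). p @ [k]) ` ({p. length p = n} \<times> UNIV) = {u::nat list. length u = Suc n}"
    proof (intro equalityI subsetI)
      fix u :: "nat list" assume "u \<in> {u. length u = Suc n}"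
      then have "u \<noteq> []" and n: "length (butlast u) = n" by auto
      then have "u = butlast u @ [last u]" by simp
      with n show "u \<in> (\<lambda>(p, k). p @ [k]) ` ({p. length p = n} \<times> UNIV)"
        by (intro image_eqI[of _ _ "(butlast u, last u)"]) auto
    qed auto
  qed (auto simp: inj_on_def)
  have "generation_mean f (Suc n) = (\<integral>\<^sup>+ z. ?h (case z of (p, k) \<Rightarrow> p @ [k]) \<partial>count_space ({p. length p = n} \<times> UNIV))"
    unfolding generation_mean_def by (rule nn_integral_bij_count_space[OF bij, symmetric])
  also have "\<dots> = (\<integral>\<^sup>+ z. ?h (fst z @ [snd z]) * indicator {p. length p = n} (fst z) \<partial>count_space UNIV)"
    by (subst nn_integral_count_space_indicator, simp, rule nn_integral_cong) (auto split: split_indicator)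
  also have "\<dots> = (\<integral>\<^sup>+ p. (\<integral>\<^sup>+ k. ?h (p @ [k]) * indicator {p. length p = n} p \<partial>count_space UNIV) \<partial>count_space UNIV)"
    by (subst nn_integral_fst_count_space[symmetric]) simp
  also have "\<dots> = (\<integral>\<^sup>+ p. (\<integral>\<^sup>+ k. ?h (p @ [k]) \<partial>count_space UNIV) \<partial>count_space {p. length p = n})"
    by (subst nn_integral_multc, simp, rule nn_integral_count_space_indicator[symmetric]) simp
  also have "\<dots> \<le> generation_mean g n"
    unfolding generation_mean_def
    by (intro nn_integral_mono order_trans[OF children_mean_le jump_sum_mean_le]) (use f g le in auto)
  finally show ?thesis .
qed

lemma generation_mean_0: 
  assumes f: "\<And>j. f j \<in> borel_measurable borel"
  shows "generation_mean f 0 = f i x"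
proof -
  have L: "L x i = distr M cell_space (C [])" using cs by (simp add: cell_system_def)
  have "f i x = (\<integral>\<^sup>+ w. cell_value f (C [] w) \<partial>M)"
    unfolding nn_integral_cell_value[OF x_pos, symmetric] L using f by (subst nn_integral_distr) auto
  then show ?thesis by (simp add: generation_mean_def nn_integral_count_space_finite)
qed

text \<open>Geometric decay of the means makes the total over all generations integrable, hence
  almost surely finite, and the terms of a convergent series tend to \<open>0\<close>.\<close>

lemma generation_mean_AE_tendsto_0:
  assumes f: "\<And>j. f j \<in> borel_measurable borel" and fin: "f i x < \<infinity>"
    and \<rho>: "0 \<le> \<rho>" "\<rho> < 1"
    and le: "\<And>y j. 0 < y \<Longrightarrow> (\<integral>\<^sup>+ c. (\<Sum>k\<in>UNIV. jump_sum (f k) k c) \<partial>L y j) \<le> ennreal \<rho> * f j y"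
  shows "AE w in M. (\<lambda>n. \<integral>\<^sup>+ u. cell_value f (C u w) \<partial>count_space {u. length u = n}) \<longlonglongrightarrow> 0"
proof -
  have mean: "generation_mean f n \<le> ennreal (\<rho> ^ n) * f i x" for n
  proof (induction n)
    case 0
    then show ?case using generation_mean_0[OF f] by simp
  next
    case (Suc n)
    have m: "(\<lambda>w. cell_value f (C u w)) \<in> borel_measurable M" for u using f by measurable
    have "generation_mean f (Suc n) \<le> generation_mean (\<lambda>j y. ennreal \<rho> * f j y) n"
      using f le by (intro generation_mean_Suc_le) auto
    also have "cell_value (\<lambda>j y. ennreal \<rho> * f j y) = (\<lambda>c. ennreal \<rho> * cell_value f c)"
      by (auto simp: cell_value_def fun_eq_iff split: option.splits)
    then have "generation_mean (\<lambda>j y. ennreal \<rho> * f j y) n = ennreal \<rho> * generation_mean f n"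
      using m by (simp add: generation_mean_def nn_integral_cmult)
    also have "\<dots> \<le> ennreal \<rho> * (ennreal (\<rho> ^ n) * f i x)" using Suc by (intro mult_left_mono) auto
    also have "\<dots> = ennreal (\<rho> ^ Suc n) * f i x" using \<rho> by (simp add: ennreal_mult mult.assoc)
    finally show ?case .
  qed
  define G where "G n w = (\<integral>\<^sup>+ u. cell_value f (C u w) \<partial>count_space {u. length u = n})" for n w
  have m: "(\<lambda>w. cell_value f (C u w)) \<in> borel_measurable M" for u using f by measurable
  have G_mean: "(\<integral>\<^sup>+ w. G n w \<partial>M) = generation_mean f n" for n
    unfolding generation_mean_def G_def using m by (intro nn_integral_count_space_nn_integral) auto
  have Gm: "G n \<in> borel_measurable M" for n
    unfolding G_def
  proof (rule sigma_finite_measure.borel_measurable_nn_integral)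
    show "sigma_finite_measure (count_space {u::nat list. length u = n})"
      by (rule sigma_finite_measure_count_space_countable) simp
    show "(\<lambda>(w, u). cell_value f (C u w)) \<in> borel_measurable (M \<Otimes>\<^sub>M count_space {u. length u = n})"
      unfolding case_prod_beta
      by (rule measurable_compose_countable'[where f = "\<lambda>u z. cell_value f (C u (fst z))" and g = snd and I = "{u. length u = n}"])
        (use measurable_compose[OF measurable_fst m] in auto)
  qed
  have "(\<integral>\<^sup>+ w. (\<Sum>n. G n w) \<partial>M) = (\<Sum>n. \<integral>\<^sup>+ w. G n w \<partial>M)"
    by (rule nn_integral_suminf[OF Gm])
  also have "\<dots> \<le> (\<Sum>n. ennreal (\<rho> ^ n) * f i x)"
    unfolding G_mean using mean by (intro suminf_le) auto
  also have "\<dots> = (\<Sum>n. ennreal (\<rho> ^ n)) * f i x" by simp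
  also have "\<dots> < \<infinity>"
    using fin \<rho> by (simp add: suminf_ennreal2 summable_geometric ennreal_mult_less_top)
  finally have "(\<integral>\<^sup>+ w. (\<Sum>n. G n w) \<partial>M) \<noteq> \<infinity>" by simp
  then have "AE w in M. (\<Sum>n. G n w) \<noteq> \<infinity>"
    by (intro nn_integral_PInf_AE borel_measurable_suminf_order Gm)
  then have "AE w in M. (\<lambda>n. G n w) \<longlonglongrightarrow> 0"
  proof (rule eventually_mono)
    fix w assume elim: "(\<Sum>n. G n w) \<noteq> \<infinity>"
    have "G n w < \<infinity>" for n
      using elim by (auto simp: less_top intro: ennreal_suminf_lessD[of "\<lambda>n. G n w"])
    then have G_real: "G n w = ennreal (enn2real (G n w))" for n by (simp add: less_top)
    have "(\<Sum>n. ennreal (enn2real (G n w))) \<noteq> \<infinity>" unfolding G_real[symmetric] by (rule elim)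
    then have "(\<lambda>n. enn2real (G n w)) \<longlonglongrightarrow> 0"
      by (intro summable_LIMSEQ_zero summable_suminf_not_top) auto
    then have "(\<lambda>n. ennreal (enn2real (G n w))) \<longlonglongrightarrow> ennreal 0" by (rule tendsto_ennrealI)
    then show "(\<lambda>n. G n w) \<longlonglongrightarrow> 0" by (simp only: G_real[symmetric] ennreal_0)
  qed
  then show ?thesis by (simp only: G_def)
qed

end

section \<open>Geometric means of eigenvectors\<close>

text \<open>The iterates \<open>u n\<close> of \<open>w\<close> under \<open>A\<close> decrease.
  Strictness at \<open>i0\<close> travels backwards along positive entries, so by irreducibility
  some \<open>u N\<close> is strictly below \<open>w\<close> in every coordinate. For
  \<open>w' = u 0 + ... + u (N - 1)\<close> the product with \<open>A\<close> telescopes to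
  \<open>w' - w + u N\<close>, which is below \<open>w'\<close> everywhere; \<open>\<rho>\<close> is
  the largest of the finitely many ratios.\<close>

lemma irreducible_contraction:
  fixes A :: "real^'i::finite^'i"
  assumes irr: "irreducible_matrix A" and nonneg: "\<And>i j. 0 \<le> A $ i $ j"
    and w: "\<And>i. 0 < w $ i" and le: "\<And>i. (A *v w) $ i \<le> w $ i" and strict: "(A *v w) $ i0 < w $ i0"
  shows "\<exists>w' \<rho>. (\<forall>i. 0 < w' $ i) \<and> 0 \<le> \<rho> \<and> \<rho> < 1 \<and> (\<forall>i. (A *v w') $ i \<le> \<rho> * w' $ i)"
proof -
  define u where "u n = ((*v) A ^^ n) w" for n
  have u_Suc: "u (Suc n) = A *v u n" and u_0: "u 0 = w" for n by (simp_all add: u_def)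
  have mv: "(A *v z) $ i = (\<Sum>j\<in>UNIV. A $ i $ j * z $ j)" for z :: "real^'i" and i
    by (simp add: matrix_vector_mult_def)
  have mono: "(A *v y) $ i \<le> (A *v z) $ i" if "\<And>j. y $ j \<le> z $ j" for y z i
    unfolding mv using that nonneg by (intro sum_mono mult_left_mono) auto
  have dec: "u (Suc n) $ i \<le> u n $ i" for n i
  proof (induction n arbitrary: i)
    case 0 then show ?case using le by (simp add: u_Suc u_0)
  next
    case (Suc n) then show ?case unfolding u_Suc[of "Suc n"] u_Suc[of n] by (intro mono) (simp add: u_Suc[symmetric])
  qed
  have pos: "0 \<le> u n $ i" for n i
  proof (induction n arbitrary: i)
    case 0 then show ?case using w by (simp add: u_0 less_imp_le)
  next
    case (Suc n) then show ?case unfolding u_Suc mv using nonneg by (intro sum_nonneg mult_nonneg_nonneg) auto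
  qed
  have dec_w: "m \<le> n \<Longrightarrow> u n $ i \<le> u m $ i" for m n i
    by (rule lift_Suc_antimono_le[of "\<lambda>n. u n $ i"]) (use dec in auto)
  have "\<exists>n. u n $ i < w $ i" for i
  proof -
    have "(i, i0) \<in> {(a, b). 0 < A $ a $ b}\<^sup>+" using irr by (simp add: irreducible_matrix_def)
    then show ?thesis
    proof (induction rule: converse_trancl_induct)
      case (base y)
      then have "u 2 $ y < w $ y"
      proof -
        have "u 2 $ y = (A *v (A *v w)) $ y" by (simp add: numeral_2_eq_2 u_Suc u_0)
        also have "\<dots> < (A *v w) $ y" unfolding mv[of "A *v w" y] mv[of w y]
          by (rule sum_strict_mono_ex1) (use base nonneg le strict in \<open>auto intro!: mult_left_mono exI[of _ i0]\<close>)
        also have "\<dots> \<le> w $ y" by (rule le)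
        finally show ?thesis .
      qed
      then show ?case ..
    next
      case (step y z)
      then obtain n where n: "u n $ z < w $ z" by blast
      have "u (Suc n) $ y < (A *v w) $ y" unfolding u_Suc mv
        by (rule sum_strict_mono_ex1) (use step(1) n nonneg dec_w[of 0 n] in \<open>auto simp: u_0 intro!: mult_left_mono exI[of _ z]\<close>)
      also have "\<dots> \<le> w $ y" by (rule le)
      finally show ?case ..
    qed
  qed
  then obtain n where n: "\<And>i. u (n i) $ i < w $ i" by metis
  define N where "N = Max (range n)"
  have N: "u N $ i < w $ i" for i
    using dec_w[of "n i" N i] n[of i] by (simp add: N_def)
  have "N \<noteq> 0" using N[of i0] u_0 by (metis less_irrefl)
  define w' where "w' = (\<Sum>k<N. u k)"
  have w'_pos: "0 < w' $ i" for i
  proof -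
    have "u 0 $ i \<le> (\<Sum>k<N. u k $ i)" using \<open>N \<noteq> 0\<close> pos by (intro member_le_sum) auto
    then show ?thesis using w[of i] by (simp add: w'_def u_0)
  qed
  have Aw': "A *v w' = w' - w + u N"
  proof -
    have "A *v w' = (\<Sum>k<N. u (Suc k))"
      unfolding w'_def u_Suc by (induction N) (auto simp: matrix_vector_right_distrib)
    moreover have "(\<Sum>k<N. u (Suc k)) + w = w' + u N"
      unfolding w'_def u_0[symmetric] by (induction N) (auto simp: algebra_simps)
    ultimately show ?thesis by (simp add: algebra_simps)
  qed
  define \<rho> where "\<rho> = Max (range (\<lambda>i. (A *v w') $ i / w' $ i))"
  have "\<rho> < 1" unfolding \<rho>_def
    using w'_pos N by (subst Max_less_iff) (auto simp: Aw' divide_simps)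
  moreover have "(A *v w') $ i / w' $ i \<le> \<rho>" for i unfolding \<rho>_def by (intro Max_ge) auto
  then have "(A *v w') $ i \<le> \<rho> * w' $ i" for i using w'_pos by (simp add: pos_divide_le_eq)
  moreover have "0 \<le> \<rho>"
  proof -
    have "0 \<le> (A *v w') $ i0 / w' $ i0"
      unfolding mv using w'_pos nonneg
      by (intro divide_nonneg_pos sum_nonneg mult_nonneg_nonneg) (simp_all add: less_imp_le)
    also have "\<dots> \<le> \<rho>" unfolding \<rho>_def by (intro Max_ge) auto
    finally show ?thesis .
  qed
  ultimately show ?thesis using w'_pos by blast
qed

section \<open>Rows of the mean matrix at the midpoint exponent\<close>

lemma cell_paths_pos: "c \<in> cell_paths \<Longrightarrow> alive c t \<Longrightarrow> 0 < pos c t"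
  unfolding cell_paths_def by blast

lemma jump_sum_cong: "(\<And>y. 0 < y \<Longrightarrow> f y = g y) \<Longrightarrow> jump_sum f k c = jump_sum g k c"
  unfolding jump_sum_def by (intro nn_integral_cong) (auto simp: neg_jumps_def)

lemma jump_sum_add: "jump_sum (\<lambda>y. f y + g y) k c = jump_sum f k c + jump_sum g k c"
  unfolding jump_sum_def by (intro nn_integral_add) auto

lemma jump_sum_cmult: "jump_sum (\<lambda>y. a * f y) k c = a * jump_sum f k c"
  unfolding jump_sum_def by (intro nn_integral_cmult) auto

lemma jump_sum_eq_0D:
  assumes "jump_sum f k c = 0" "s \<in> neg_jumps c" "snd c s = k"
  shows "f \<bar>jump (pos c) s\<bar> = 0"
  using assms unfolding jump_sum_def by (subst (asm) nn_integral_0_iff_AE) (auto simp: AE_count_space)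

lemma m_entry_eq: "m_entry L q i j = (\<integral>\<^sup>+ c. jump_sum (\<lambda>y. ennreal (y powr q)) j c \<partial>L 1 i)"
  unfolding m_entry_def jump_sum_def infsum_ennreal_eq_nn_integral ..

lemma m_entry_cmult:
  assumes "sets (L 1 i) = sets cell_space" "0 \<le> a"
  shows "(\<integral>\<^sup>+ c. jump_sum (\<lambda>y. ennreal (a * y powr q)) j c \<partial>L 1 i) = ennreal a * m_entry L q i j"
proof -
  have [measurable_cong]: "sets (L 1 i) = sets cell_space" by fact
  have "(\<integral>\<^sup>+ c. jump_sum (\<lambda>y. ennreal (a * y powr q)) j c \<partial>L 1 i) =
      (\<integral>\<^sup>+ c. ennreal a * jump_sum (\<lambda>y. ennreal (y powr q)) j c \<partial>L 1 i)"
    using assms(2) by (simp add: ennreal_mult jump_sum_cmult)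
  also have "\<dots> = ennreal a * m_entry L q i j"
    unfolding m_entry_eq by (intro nn_integral_cmult) measurable
  finally show ?thesis .
qed

text \<open>Passage from extended to real numbers: \<open>m_matrix\<close> reflects
  \<open>m_entry\<close> only where the latter is finite.\<close>

lemma m_row:
  assumes "sets (L 1 i) = sets cell_space" "\<And>k. 0 \<le> a k" "m_finite L q"
  shows "(\<Sum>k\<in>UNIV. \<integral>\<^sup>+ c. jump_sum (\<lambda>y. ennreal (a k * y powr q)) k c \<partial>L 1 i) =
    ennreal (\<Sum>k\<in>UNIV. m_matrix L q $ i $ k * a k)"
proof -
  have "ennreal (a k) * m_entry L q i k = ennreal (m_matrix L q $ i $ k * a k)" for k
  proof -
    have "m_entry L q i k < \<infinity>" using assms(3) by (simp add: m_finite_def)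
    then obtain r where "m_entry L q i k = ennreal r" "0 \<le> r" by (cases "m_entry L q i k") auto
    then show ?thesis using assms(2) by (simp add: ennreal_mult[symmetric] m_matrix_def mult.commute)
  qed
  then show ?thesis using assms
    by (simp add: m_entry_cmult sum_ennreal m_matrix_def)
qed

text \<open>This is \<open>sqrt (A * B) + (sqrt A - sqrt B)\<^sup>2 / 2 = (A + B) / 2\<close> for
  \<open>A = a / a' * y powr \<omega>1\<close> and \<open>B = b / b' * y powr \<omega>2\<close>.
  Keeping the square makes the case of equality explicit.\<close>

lemma geometric_mean_defect:
  fixes a b a' b' y \<omega>1 \<omega>2 :: real
  assumes "0 < a" "0 < b" "0 < a'" "0 < b'" "0 < y"
  shows "sqrt (a * b) / sqrt (a' * b') * y powr ((\<omega>1 + \<omega>2) / 2) +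
     (sqrt (a / a' * y powr \<omega>1) - sqrt (b / b' * y powr \<omega>2))\<^sup>2 / 2 =
     a / (2 * a') * y powr \<omega>1 + b / (2 * b') * y powr \<omega>2"
proof -
  let ?A = "a / a' * y powr \<omega>1" and ?B = "b / b' * y powr \<omega>2"
  have "0 \<le> ?A" "0 \<le> ?B" using assms by auto
  then have "(sqrt ?A - sqrt ?B)\<^sup>2 = ?A + ?B - 2 * sqrt (?A * ?B)"
    unfolding power2_diff real_sqrt_mult[of ?A ?B] by (simp only: real_sqrt_pow2 mult.assoc)
  moreover have "sqrt (?A * ?B) = sqrt (a * b) / sqrt (a' * b') * y powr ((\<omega>1 + \<omega>2) / 2)"
  proof -
    have "?A * ?B = (a * b) / (a' * b') * y powr (\<omega>1 + \<omega>2)" by (simp add: powr_add)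
    moreover have "sqrt (y powr (\<omega>1 + \<omega>2)) = y powr ((\<omega>1 + \<omega>2) / 2)"
      using assms by (simp add: powr_half_sqrt[symmetric] powr_powr)
    moreover have "sqrt ((a * b) / (a' * b') * y powr (\<omega>1 + \<omega>2)) =
        sqrt (a * b) / sqrt (a' * b') * sqrt (y powr (\<omega>1 + \<omega>2))"
      by (simp only: real_sqrt_mult real_sqrt_divide)
    ultimately show ?thesis by presburger
  qed
  ultimately show ?thesis by (simp add: field_simps)
qed

context cells
begin

text \<open>An identity instead of an inequality: each of the two eigenvector equations contributes
  \<open>1 / 2\<close>, and the second sum is the total deficit of row \<open>j\<close>. Finiteness
  at the midpoint, the bound of the row by \<open>1\<close> and the meaning of equality can all be
  read off.\<close>

lemma geometric_mean_row:
  fixes v1 v2 :: "real^'i"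
  assumes v: "\<And>k. 0 < v1 $ k" "\<And>k. 0 < v2 $ k"
    and fin: "m_finite L \<omega>1" "m_finite L \<omega>2"
    and eig: "m_matrix L \<omega>1 *v v1 = v1" "m_matrix L \<omega>2 *v v2 = v2"
  defines "q \<equiv> (\<omega>1 + \<omega>2) / 2"
  shows "(\<Sum>k\<in>UNIV. ennreal (sqrt (v1 $ k * v2 $ k) / sqrt (v1 $ j * v2 $ j)) * m_entry L q j k) +
    (\<Sum>k\<in>UNIV. \<integral>\<^sup>+ c. jump_sum (\<lambda>y. ennreal ((sqrt (v1 $ k / v1 $ j * y powr \<omega>1) -
        sqrt (v2 $ k / v2 $ j * y powr \<omega>2))\<^sup>2 / 2)) k c \<partial>L 1 j) = 1"
proof -
  \<comment> \<open>Row \<open>j\<close> of an eigenvector equation, divided by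
    \<open>2 * v $ j\<close>.\<close>
  have row: "(\<Sum>k\<in>UNIV. \<integral>\<^sup>+ c. jump_sum (\<lambda>y. ennreal (v $ k / (2 * v $ j) * y powr \<omega>)) k c \<partial>L 1 j) = ennreal (1 / 2)"
    if "\<And>k. 0 < v $ k" "m_finite L \<omega>" "m_matrix L \<omega> *v v = v" for v :: "real^'i" and \<omega>
  proof -
    have "(\<Sum>k\<in>UNIV. m_matrix L \<omega> $ j $ k * (v $ k / (2 * v $ j))) = (m_matrix L \<omega> *v v) $ j / (2 * v $ j)"
      by (simp add: matrix_vector_mult_def sum_divide_distrib)
    also have "\<dots> = 1 / 2" using that(1)[of j] that(3) by simp
    finally have eq: "(\<Sum>k\<in>UNIV. m_matrix L \<omega> $ j $ k * (v $ k / (2 * v $ j))) = 1 / 2" .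
    show ?thesis
      unfolding eq[symmetric] using that by (intro m_row) (auto simp: L_sets less_imp_le)
  qed
  let ?g = "\<lambda>k y. ennreal (sqrt (v1 $ k * v2 $ k) / sqrt (v1 $ j * v2 $ j) * y powr q)"
  let ?h = "\<lambda>k y. ennreal ((sqrt (v1 $ k / v1 $ j * y powr \<omega>1) - sqrt (v2 $ k / v2 $ j * y powr \<omega>2))\<^sup>2 / 2)"
  let ?f = "\<lambda>v \<omega> k y. ennreal (v $ k / (2 * v $ j) * y powr \<omega>)"
  have "(\<integral>\<^sup>+ c. jump_sum (?g k) k c \<partial>L 1 j) + (\<integral>\<^sup>+ c. jump_sum (?h k) k c \<partial>L 1 j) =
      (\<integral>\<^sup>+ c. jump_sum (?f v1 \<omega>1 k) k c \<partial>L 1 j) + (\<integral>\<^sup>+ c. jump_sum (?f v2 \<omega>2 k) k c \<partial>L 1 j)" for k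
  proof -
    have eq: "jump_sum (?g k) k c + jump_sum (?h k) k c = jump_sum (?f v1 \<omega>1 k) k c + jump_sum (?f v2 \<omega>2 k) k c" for c
      unfolding jump_sum_add[symmetric]
    proof (rule jump_sum_cong)
      fix y :: real assume "0 < y"
      with geometric_mean_defect[of "v1 $ k" "v2 $ k" "v1 $ j" "v2 $ j" y \<omega>1 \<omega>2] v
      show "?g k y + ?h k y = ?f v1 \<omega>1 k y + ?f v2 \<omega>2 k y"
        by (simp add: ennreal_plus[symmetric] q_def less_imp_le del: ennreal_plus)
    qed
    have "(\<integral>\<^sup>+ c. jump_sum (?g k) k c \<partial>L 1 j) + (\<integral>\<^sup>+ c. jump_sum (?h k) k c \<partial>L 1 j) =
        (\<integral>\<^sup>+ c. jump_sum (?g k) k c + jump_sum (?h k) k c \<partial>L 1 j)"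
      by (rule nn_integral_add[symmetric]) measurable
    also have "\<dots> = (\<integral>\<^sup>+ c. jump_sum (?f v1 \<omega>1 k) k c + jump_sum (?f v2 \<omega>2 k) k c \<partial>L 1 j)"
      unfolding eq ..
    also have "\<dots> = (\<integral>\<^sup>+ c. jump_sum (?f v1 \<omega>1 k) k c \<partial>L 1 j) + (\<integral>\<^sup>+ c. jump_sum (?f v2 \<omega>2 k) k c \<partial>L 1 j)"
      by (rule nn_integral_add) measurable
    finally show ?thesis .
  qed
  then have "(\<Sum>k\<in>UNIV. \<integral>\<^sup>+ c. jump_sum (?g k) k c \<partial>L 1 j) + (\<Sum>k\<in>UNIV. \<integral>\<^sup>+ c. jump_sum (?h k) k c \<partial>L 1 j) =
      ennreal (1 / 2) + ennreal (1 / 2)"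
    unfolding sum.distrib[symmetric] by (simp only: row[OF v(1) fin(1) eig(1)] row[OF v(2) fin(2) eig(2)] sum.distrib)
  also have "ennreal (1 / 2) + ennreal (1 / 2) = 1"
    by (subst ennreal_plus[symmetric]) simp_all
  finally have "(\<Sum>k\<in>UNIV. \<integral>\<^sup>+ c. jump_sum (?g k) k c \<partial>L 1 j) + (\<Sum>k\<in>UNIV. \<integral>\<^sup>+ c. jump_sum (?h k) k c \<partial>L 1 j) = 1" .
  moreover have "(\<integral>\<^sup>+ c. jump_sum (?g k) k c \<partial>L 1 j) =
      ennreal (sqrt (v1 $ k * v2 $ k) / sqrt (v1 $ j * v2 $ j)) * m_entry L q j k" for k
    using v by (intro m_entry_cmult[OF L_sets]) (simp add: less_imp_le)
  ultimately show ?thesis by (simp only:)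
qed

text \<open>Every term is at most the sum over its generation. Once that sum is below the smallest
  weight, all cells of the generation are smaller than \<open>1\<close>, and there the larger
  exponent gives the smaller power.\<close>

lemma powers_tendsto_0:
  fixes v w :: "real^'i"
  assumes v: "\<And>j. 0 < v $ j" and w: "\<And>j. 0 < w $ j" and q: "0 < q" "q < \<omega>"
    and T: "(\<lambda>n. \<integral>\<^sup>+ u. cell_value (\<lambda>j y. ennreal (w $ j * y powr q)) (C u \<sigma>) \<partial>count_space {u. length u = n}) \<longlonglongrightarrow> 0"
    and \<sigma>: "\<sigma> \<in> space M"
  shows "(\<lambda>n. genealogical_sum C v \<omega> n \<sigma>) \<longlonglongrightarrow> 0"
proof -
  let ?f = "\<lambda>j y. ennreal (w $ j * y powr q)"
  define T where "T n = (\<integral>\<^sup>+ u. cell_value ?f (C u \<sigma>) \<partial>count_space {u. length u = n})" for n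
  have T0: "T \<longlonglongrightarrow> 0" using T by (simp add: T_def[symmetric])
  \<comment> \<open>\<open>\<mu>\<close> bounds the weights \<open>w\<close> from below and
    \<open>K * \<mu>\<close> bounds the weights \<open>v\<close> from above; together they trade one
    weight vector for the other.\<close>
  define \<mu> where "\<mu> = Min (range (($) w))"
  define K where "K = Max (range (($) v)) / \<mu>"
  have \<mu>: "0 < \<mu>" unfolding \<mu>_def using w by (subst Min_gr_iff) auto
  have \<mu>_le: "\<mu> \<le> w $ j" for j unfolding \<mu>_def by (intro Min_le) auto
  have K_ge: "v $ j / \<mu> \<le> K" for j unfolding K_def using \<mu> by (intro divide_right_mono Max_ge) auto
  have K0: "0 \<le> K" using K_ge[of undefined] v[of undefined] \<mu> by (smt (verit) divide_pos_pos)
  \<comment> \<open>The shift arises because \<open>genealogical_sum\<close> with index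
    \<open>n\<close> runs over words of length \<open>n + 1\<close>.\<close>
  have bound: "genealogical_sum C v \<omega> n \<sigma> \<le> ennreal K * T (Suc n)" if small: "T (Suc n) < ennreal \<mu>" for n
  proof -
    have "genealogical_sum C v \<omega> n \<sigma> =
        (\<integral>\<^sup>+ u. ennreal (v $ ctype (C u \<sigma>) 0 * pos (C u \<sigma>) 0 powr \<omega>) \<partial>count_space {u. length u = n + 1 \<and> alive (C u \<sigma>) 0})"
      unfolding genealogical_sum_def infsum_ennreal_eq_nn_integral ..
    also have "\<dots> = (\<integral>\<^sup>+ u. ennreal (v $ ctype (C u \<sigma>) 0 * pos (C u \<sigma>) 0 powr \<omega>) * indicator {u. alive (C u \<sigma>) 0} u \<partial>count_space {u. length u = Suc n})"
      by (subst (1 2) nn_integral_count_space_indicator, simp, simp, rule nn_integral_cong) (auto split: split_indicator)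
    also have "\<dots> \<le> (\<integral>\<^sup>+ u. ennreal K * cell_value ?f (C u \<sigma>) \<partial>count_space {u. length u = Suc n})"
    proof (rule nn_integral_mono)
      fix u :: "nat list" assume "u \<in> space (count_space {u. length u = Suc n})"
      then have u: "length u = Suc n" by simp
      show "ennreal (v $ ctype (C u \<sigma>) 0 * pos (C u \<sigma>) 0 powr \<omega>) * indicator {u. alive (C u \<sigma>) 0} u \<le> ennreal K * cell_value ?f (C u \<sigma>)"
      proof (cases "fst (C u \<sigma>) 0")
        case None
        then show ?thesis by (simp add: alive_def)
      next
        case (Some p)
        obtain y j where p: "p = (y, j)" by (cases p)
        have "C u \<sigma> \<in> cell_paths" using measurable_space[OF C_measurable \<sigma>] by simp
        then have y: "0 < y" using cell_paths_pos[of "C u \<sigma>" 0] Some p by (simp add: alive_def pos_def)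
        have val: "cell_value ?f (C u \<sigma>) = ennreal (w $ j * y powr q)"
          by (simp add: cell_value_def Some p)
        have "cell_value ?f (C u \<sigma>) \<le> T (Suc n)"
          unfolding T_def by (rule nn_integral_ge_point) (use u in simp)
        with small val have "w $ j * y powr q < \<mu>"
          using w \<mu> by (metis ennreal_less_iff le_less_trans mult_nonneg_nonneg less_imp_le powr_ge_zero)
        with \<mu>_le[of j] have "\<mu> * y powr q < \<mu> * 1"
          by (smt (verit) mult_right_mono powr_ge_zero)
        then have "y powr q < 1" using \<mu> by simp
        then have "y < 1" using q y by (smt (verit) ge_one_powr_ge_zero)
        then have "y powr \<omega> \<le> y powr q" using q y by (intro powr_mono') auto
        then have "v $ j * y powr \<omega> \<le> (K * \<mu>) * y powr q"
          using K_ge[of j] \<mu> v[of j] by (intro mult_mono) (auto simp: divide_simps)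
        also have "\<dots> \<le> K * (w $ j * y powr q)"
          using K0 \<mu>_le[of j] by (simp add: mult.assoc mult_left_mono mult_right_mono)
        finally show ?thesis using K0 w[of j]
          by (simp add: val ennreal_mult[symmetric] less_imp_le ctype_def pos_def Some p alive_def ennreal_leI)
      qed
    qed
    also have "\<dots> = ennreal K * T (Suc n)" unfolding T_def by (rule nn_integral_cmult) simp
    finally show ?thesis .
  qed
  have T1: "(\<lambda>n. T (Suc n)) \<longlonglongrightarrow> 0" using T0 by (rule LIMSEQ_Suc)
  have "\<forall>\<^sub>F n in sequentially. T (Suc n) < ennreal \<mu>"
    using order_tendstoD(2)[OF T1, of "ennreal \<mu>"] \<mu> by simp
  then have ev: "\<forall>\<^sub>F n in sequentially. genealogical_sum C v \<omega> n \<sigma> \<le> ennreal K * T (Suc n)"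
    by eventually_elim (rule bound)
  have "(\<lambda>n. ennreal K * T (Suc n)) \<longlonglongrightarrow> ennreal K * 0"
    by (intro ennreal_tendsto_cmult T1) simp
  then show ?thesis
    by (intro tendsto_sandwich[OF _ ev tendsto_const]) auto
qed

text \<open>\<open>small\<close> refutes equality in row \<open>i0\<close>, in which almost every
  negative jump of type \<open>k0\<close> would have one size determined by the eigenvectors, and by
  \<open>max\<close> that size is at least \<open>1\<close>. One strict row is enough for a
  contraction by irreducibility.\<close>

lemma genealogical_sum_tendsto_0:
  fixes v1 v2 :: "real^'i"
  assumes v: "\<And>k. 0 < v1 $ k" "\<And>k. 0 < v2 $ k"
    and \<omega>: "0 < \<omega>1" "\<omega>1 < \<omega>2"
    and fin: "m_finite L \<omega>1" "m_finite L \<omega>2"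
    and eig: "m_matrix L \<omega>1 *v v1 = v1" "m_matrix L \<omega>2 *v v2 = v2"
    and irr: "\<And>q. m_finite L q \<Longrightarrow> irreducible_matrix (m_matrix L q)"
    and scaling: "\<And>f k j y. f \<in> borel_measurable borel \<Longrightarrow> 0 < y \<Longrightarrow>
      (\<integral>\<^sup>+ c. jump_sum f k c \<partial>L y j) = (\<integral>\<^sup>+ c. jump_sum (\<lambda>z. f (y * z)) k c \<partial>L 1 j)"
    and max: "\<And>l. v1 $ l / v2 $ l \<le> v1 $ k0 / v2 $ k0"
    and small: "\<not> (AE c in L 1 i0. \<forall>s\<in>neg_jumps c. snd c s = k0 \<longrightarrow> 1 \<le> \<bar>jump (pos c) s\<bar>)"
  shows "AE \<sigma> in M. (\<lambda>n. genealogical_sum C v2 \<omega>2 n \<sigma>) \<longlonglongrightarrow> 0"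
proof -
  define q where "q = (\<omega>1 + \<omega>2) / 2"
  define w :: "real^'i" where "w = (\<chi> k. sqrt (v1 $ k * v2 $ k))"
  have w: "0 < w $ k" for k using v by (simp add: w_def)
  define H where "H j = (\<Sum>k\<in>UNIV. \<integral>\<^sup>+ c. jump_sum (\<lambda>y. ennreal ((sqrt (v1 $ k / v1 $ j * y powr \<omega>1) -
        sqrt (v2 $ k / v2 $ j * y powr \<omega>2))\<^sup>2 / 2)) k c \<partial>L 1 j)" for j
  have row: "(\<Sum>k\<in>UNIV. ennreal (w $ k / w $ j) * m_entry L q j k) + H j = 1" for j
    using geometric_mean_row[OF v fin eig, of j] by (simp add: H_def w_def q_def)
  \<comment> \<open>Finiteness at the midpoint is derived: each entry, with a positive weight, is a
    summand of a row bounded by \<open>1\<close>.\<close>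
  have "m_entry L q j k < \<infinity>" for j k
  proof -
    have "ennreal (w $ k / w $ j) * m_entry L q j k \<le> (\<Sum>k\<in>UNIV. ennreal (w $ k / w $ j) * m_entry L q j k)"
      by (intro member_le_sum) auto
    also have "\<dots> \<le> 1" unfolding row[of j, symmetric] by simp
    finally have "ennreal (w $ k / w $ j) * m_entry L q j k < \<top>" by (rule le_less_trans) simp
    then show ?thesis using w[of j] w[of k] by (auto simp: ennreal_mult_less_top)
  qed
  then have fin_q: "m_finite L q" by (simp add: m_finite_def)
  define A where "A = m_matrix L q"
  have A0: "0 \<le> A $ j $ k" for j k by (simp add: A_def m_matrix_def)
  have rowA: "ennreal ((A *v w) $ j / w $ j) + H j = 1" for j
  proof -
    have "(\<Sum>k\<in>UNIV. ennreal (w $ k / w $ j) * m_entry L q j k) = ennreal (\<Sum>k\<in>UNIV. A $ j $ k * (w $ k / w $ j))"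
      unfolding A_def using w
      by (subst m_row[OF L_sets _ fin_q, symmetric])
        (auto intro!: sum.cong m_entry_cmult[OF L_sets, symmetric] simp: less_imp_le simp del: times_divide_eq_left)
    also have "(\<Sum>k\<in>UNIV. A $ j $ k * (w $ k / w $ j)) = (A *v w) $ j / w $ j"
      by (simp add: matrix_vector_mult_def sum_divide_distrib)
    finally show ?thesis using row[of j] by simp
  qed
  have Aw: "(A *v w) $ j \<le> w $ j" for j
  proof -
    have "ennreal ((A *v w) $ j / w $ j) \<le> 1" unfolding rowA[of j, symmetric] by simp
    then show ?thesis using w[of j] by (simp add: divide_le_eq_1)
  qed
  have "(A *v w) $ i0 < w $ i0"
  proof (rule ccontr)
    assume "\<not> ?thesis"
    then have "(A *v w) $ i0 / w $ i0 = 1" using Aw[of i0] w[of i0] by simp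
    \<comment> \<open>Equality in row \<open>i0\<close> leaves no deficit, so every summand of the
      deficit vanishes, and then so does the square at almost every jump.\<close>
    then have "1 + H i0 = 1 + 0" using rowA[of i0] by simp
    then have "H i0 = 0" by (simp add: ennreal_add_left_cancel)
    then have "(\<integral>\<^sup>+ c. jump_sum (\<lambda>y. ennreal ((sqrt (v1 $ k0 / v1 $ i0 * y powr \<omega>1) -
        sqrt (v2 $ k0 / v2 $ i0 * y powr \<omega>2))\<^sup>2 / 2)) k0 c \<partial>L 1 i0) = 0"
      unfolding H_def by (subst (asm) sum_eq_0_iff) auto
    then have "AE c in L 1 i0. jump_sum (\<lambda>y. ennreal ((sqrt (v1 $ k0 / v1 $ i0 * y powr \<omega>1) -
        sqrt (v2 $ k0 / v2 $ i0 * y powr \<omega>2))\<^sup>2 / 2)) k0 c = 0"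
      by (subst (asm) nn_integral_0_iff_AE) (auto simp: measurable_cong_sets[OF L_sets refl])
    then have "AE c in L 1 i0. \<forall>s\<in>neg_jumps c. snd c s = k0 \<longrightarrow> 1 \<le> \<bar>jump (pos c) s\<bar>"
    proof eventually_elim
      case (elim c)
      show ?case
      proof (intro ballI impI)
        fix s assume s: "s \<in> neg_jumps c" "snd c s = k0"
        define y where "y = \<bar>jump (pos c) s\<bar>"
        have y: "0 < y" using s by (auto simp: y_def neg_jumps_def)
        have "sqrt (v1 $ k0 / v1 $ i0 * y powr \<omega>1) = sqrt (v2 $ k0 / v2 $ i0 * y powr \<omega>2)"
          using jump_sum_eq_0D[OF elim s] by (simp add: y_def[symmetric] ennreal_eq_0_iff)
        then have "v1 $ k0 / v1 $ i0 * y powr \<omega>1 = v2 $ k0 / v2 $ i0 * y powr \<omega>2" by simp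
        moreover have "y powr \<omega>2 = y powr \<omega>1 * y powr (\<omega>2 - \<omega>1)" using y by (simp add: powr_add[symmetric])
        ultimately have "(v1 $ k0 / v1 $ i0) * y powr \<omega>1 = (v2 $ k0 / v2 $ i0 * y powr (\<omega>2 - \<omega>1)) * y powr \<omega>1"
          by (simp only: mult_ac)
        then have "v1 $ k0 / v1 $ i0 = v2 $ k0 / v2 $ i0 * y powr (\<omega>2 - \<omega>1)"
          using y by (subst (asm) mult_cancel_right) simp
        \<comment> \<open>The square vanishes for this single size, and maximality of the ratio at
          \<open>k0\<close> makes it at least \<open>1\<close>.\<close>
        then have "y powr (\<omega>2 - \<omega>1) = (v1 $ k0 / v2 $ k0) / (v1 $ i0 / v2 $ i0)"
          using v(1)[of k0] v(1)[of i0] v(2)[of k0] v(2)[of i0] by (simp add: field_simps)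
        moreover have "1 \<le> (v1 $ k0 / v2 $ k0) / (v1 $ i0 / v2 $ i0)"
          using max[of i0] v(1)[of i0] v(2)[of i0] by (subst le_divide_eq_1_pos) auto
        ultimately have "1 \<le> y powr (\<omega>2 - \<omega>1)" by simp
        then show "1 \<le> \<bar>jump (pos c) s\<bar>"
          unfolding y_def[symmetric] using y \<omega> powr_less_mono2[of "\<omega>2 - \<omega>1" y 1] by (cases "y < 1") auto
      qed
    qed
    with small show False by simp
  qed
  from irreducible_contraction[OF irr[OF fin_q, folded A_def] A0 w Aw this]
  obtain w' \<rho> where w': "\<And>j. 0 < w' $ j" and \<rho>: "0 \<le> \<rho>" "\<rho> < 1" and le: "\<And>j. (A *v w') $ j \<le> \<rho> * w' $ j"
    by blast
  let ?f = "\<lambda>j y. ennreal (w' $ j * y powr q)"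
  \<comment> \<open>By scaling, a cell of initial size \<open>y\<close> contributes
    \<open>y powr q\<close> times the row for initial size \<open>1\<close>; the contraction of the
    matrix becomes one that is uniform in \<open>y\<close>.\<close>
  have mean: "(\<integral>\<^sup>+ c. (\<Sum>k\<in>UNIV. jump_sum (?f k) k c) \<partial>L y j) \<le> ennreal \<rho> * ?f j y" if y: "0 < y" for y j
  proof -
    have "(\<integral>\<^sup>+ c. (\<Sum>k\<in>UNIV. jump_sum (?f k) k c) \<partial>L y j) = (\<Sum>k\<in>UNIV. \<integral>\<^sup>+ c. jump_sum (?f k) k c \<partial>L y j)"
      by (intro nn_integral_sum) measurable
    also have "\<dots> = (\<Sum>k\<in>UNIV. \<integral>\<^sup>+ c. jump_sum (\<lambda>z. ?f k (y * z)) k c \<partial>L 1 j)"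
      using y by (intro sum.cong refl scaling) auto
    also have "\<dots> = (\<Sum>k\<in>UNIV. \<integral>\<^sup>+ c. jump_sum (\<lambda>z. ennreal ((y powr q * w' $ k) * z powr q)) k c \<partial>L 1 j)"
      using y by (intro sum.cong refl nn_integral_cong jump_sum_cong) (simp add: powr_mult mult_ac)
    also have "\<dots> = ennreal (\<Sum>k\<in>UNIV. A $ j $ k * (y powr q * w' $ k))"
      unfolding A_def using w' by (intro m_row fin_q) (auto simp: L_sets less_imp_le)
    also have "(\<Sum>k\<in>UNIV. A $ j $ k * (y powr q * w' $ k)) = y powr q * (A *v w') $ j"
      by (simp add: matrix_vector_mult_def sum_distrib_left mult_ac)
    also have "ennreal \<dots> \<le> ennreal (\<rho> * (w' $ j * y powr q))"
      using mult_left_mono[OF le[of j], of "y powr q"] by (intro ennreal_leI) (simp add: mult_ac)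
    also have "\<dots> = ennreal \<rho> * ?f j y" using \<rho> w'[of j] by (intro ennreal_mult) auto
    finally show ?thesis .
  qed
  have "AE \<sigma> in M. (\<lambda>n. \<integral>\<^sup>+ u. cell_value ?f (C u \<sigma>) \<partial>count_space {u. length u = n}) \<longlonglongrightarrow> 0"
    by (rule generation_mean_AE_tendsto_0[OF _ _ \<rho> mean]) auto
  with AE_space show ?thesis
  proof eventually_elim
    case (elim \<sigma>)
    show ?case by (rule powers_tendsto_0[OF v(2) w' _ _ elim(2,1)]) (use \<omega> in \<open>auto simp: q_def\<close>)
  qed
qed

end

section \<open>The Lamperti time change\<close>

text \<open>The time is replaced by a grid point strictly to its right. On each grid interval the
  approximation depends on \<open>w\<close> alone, there are countably many intervals, and
  right-continuity gives the limit.\<close>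

lemma borel_measurable_pair_right_continuous:
  fixes f :: "real \<Rightarrow> 'a \<Rightarrow> real"
  assumes right: "\<And>t w. 0 \<le> t \<Longrightarrow> w \<in> space N \<Longrightarrow> ((\<lambda>u. f u w) \<longlongrightarrow> f t w) (at_right t)"
    and m: "\<And>t. 0 \<le> t \<Longrightarrow> f t \<in> borel_measurable N"
  shows "(\<lambda>(t, w). if 0 \<le> t then f t w else 0) \<in> borel_measurable (borel \<Otimes>\<^sub>M N)"
proof (rule borel_measurable_LIMSEQ_real)
  \<comment> \<open>The \<open>1\<close> added to the floor keeps the grid point strictly above
    \<open>t\<close>, as a limit along \<open>at_right t\<close> requires; rounding up would return
    \<open>t\<close> itself at a grid point.\<close>
  let ?c = "\<lambda>(n::nat) t. (of_int \<lfloor>t * real (Suc n)\<rfloor> + 1) / real (Suc n)"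
  let ?f = "\<lambda>n z q. if 0 \<le> fst q then f ((of_int z + 1) / real (Suc n)) (snd q) else (0::real)"
  show "(\<lambda>q. if 0 \<le> fst q then f (?c n (fst q)) (snd q) else 0) \<in> borel_measurable (borel \<Otimes>\<^sub>M N)" for n
  proof -
    have "(\<lambda>q. if 0 \<le> (fst q :: real) \<and> 0 \<le> z then f ((of_int z + 1) / real (Suc n)) (snd q) else 0) \<in> borel_measurable (borel \<Otimes>\<^sub>M N)" for z
    proof (cases "0 \<le> z")
      case True
      have "f ((of_int z + 1) / real (Suc n)) \<in> borel_measurable N" using True by (intro m) auto
      then have "(\<lambda>q. f ((of_int z + 1) / real (Suc n)) (snd q)) \<in> borel_measurable (borel \<Otimes>\<^sub>M N)"
        by (rule measurable_compose[OF measurable_snd])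
      moreover have "(\<lambda>q. indicator {0::real..} (fst q) :: real) \<in> borel_measurable (borel \<Otimes>\<^sub>M N)"
        by (rule measurable_compose[OF measurable_fst borel_measurable_indicator]) (rule borel_closed, rule closed_atLeast)
      ultimately have "(\<lambda>q. indicator {0::real..} (fst q) * f ((of_int z + 1) / real (Suc n)) (snd q)) \<in> borel_measurable (borel \<Otimes>\<^sub>M N)"
        by (intro borel_measurable_times)
      moreover have "(\<lambda>q. if 0 \<le> (fst q :: real) \<and> 0 \<le> z then f ((of_int z + 1) / real (Suc n)) (snd q) else 0) =
          (\<lambda>q. indicator {0::real..} (fst q) * f ((of_int z + 1) / real (Suc n)) (snd q))"
        using True by (simp add: fun_eq_iff indicator_def)
      ultimately show ?thesis by (simp only:)
    qed simp
    then have "(\<lambda>q. if 0 \<le> fst q \<and> 0 \<le> \<lfloor>fst q * real (Suc n)\<rfloor> then f (?c n (fst q)) (snd q) else 0) \<in> borel_measurable (borel \<Otimes>\<^sub>M N)"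
      by (rule measurable_compose_countable[where g = "\<lambda>q. \<lfloor>fst q * real (Suc n)\<rfloor>"]) measurable
    moreover have "(0 \<le> t \<and> 0 \<le> \<lfloor>t * real (Suc n)\<rfloor>) = (0 \<le> t)" for t by (auto simp del: of_nat_Suc)
    ultimately show ?thesis by (simp only:)
  qed
  fix q :: "real \<times> 'a" assume "q \<in> space (borel \<Otimes>\<^sub>M N)"
  then obtain t w where q: "q = (t, w)" and w: "w \<in> space N" by (cases q) (auto simp: space_pair_measure)
  show "(\<lambda>n. if 0 \<le> fst q then f (?c n (fst q)) (snd q) else 0) \<longlonglongrightarrow> (case q of (t, w) \<Rightarrow> if 0 \<le> t then f t w else 0)"
  proof (cases "0 \<le> t")
    case True
    have gt: "t < ?c n t" for n
      using floor_correct[of "t * real (Suc n)"] by (simp add: pos_less_divide_eq del: of_nat_Suc)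
    have le: "?c n t \<le> t + 1 / real (Suc n)" for n
    proof -
      have "of_int \<lfloor>t * real (Suc n)\<rfloor> / real (Suc n) \<le> t"
        using floor_correct[of "t * real (Suc n)"] by (simp add: pos_divide_le_eq del: of_nat_Suc)
      then show ?thesis by (simp only: add_divide_distrib add_le_cancel_right)
    qed
    have lim: "(\<lambda>n. t + 1 / real (Suc n)) \<longlonglongrightarrow> t"
      using tendsto_add[OF tendsto_const LIMSEQ_inverse_real_of_nat, of t] by (simp add: inverse_eq_divide)
    have "(\<lambda>n. ?c n t) \<longlonglongrightarrow> t"
      by (rule tendsto_sandwich[OF always_eventually[OF allI[OF less_imp_le[OF gt]]]
            always_eventually[OF allI[OF le]] tendsto_const lim])
    then have "filterlim (\<lambda>n. ?c n t) (at_right t) sequentially"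
      unfolding filterlim_at using gt by (intro conjI always_eventually allI) (simp_all add: less_imp_neq[symmetric] del: of_nat_Suc)
    with right[OF True w] have "(\<lambda>n. f (?c n t) w) \<longlonglongrightarrow> f t w" by (rule filterlim_compose)
    then show ?thesis using True by (simp add: q)
  qed (simp add: q)
qed

lemma borel_measurable_right_continuous:
  fixes f :: "real \<Rightarrow> real"
  assumes "\<And>t. 0 \<le> t \<Longrightarrow> (f \<longlongrightarrow> f t) (at_right t)"
  shows "(\<lambda>t. if 0 \<le> t then f t else 0) \<in> borel_measurable borel"
proof -
  have "(\<lambda>(t, w). if 0 \<le> t then f t else 0) \<in> borel_measurable (borel \<Otimes>\<^sub>M count_space {()})"
    by (rule borel_measurable_pair_right_continuous[OF assms borel_measurable_const])
  from measurable_compose[OF _ this, of "\<lambda>t. (t, ())" borel] show ?thesis by simp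
qed

text \<open>Bisection in place of a covering argument: near each point the one-sided limits bound
  the function on both sides, and its value at the point is added to the bound.\<close>

lemma locally_bounded_imp_bounded_interval:
  fixes f :: "real \<Rightarrow> real"
  assumes "a \<le> b"
    and "\<And>t. a \<le> t \<Longrightarrow> t < b \<Longrightarrow> \<exists>l. (f \<longlongrightarrow> l) (at_right t)"
    and "\<And>t. a < t \<Longrightarrow> t \<le> b \<Longrightarrow> \<exists>l. (f \<longlongrightarrow> l) (at_left t)"
  shows "\<exists>B. \<forall>t\<in>{a..b}. \<bar>f t\<bar> \<le> B"
proof -
  define P where "P c d = (\<exists>B. \<forall>t\<in>{c..d} \<inter> {a..b}. \<bar>f t\<bar> \<le> B)" for c d
  have "P a b"
  proof (rule Bolzano[OF assms(1)])
    fix c d e assume "P c d" "P d e" "c \<le> d" "d \<le> e"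
    then obtain B B' where "\<forall>t\<in>{c..d} \<inter> {a..b}. \<bar>f t\<bar> \<le> B" "\<forall>t\<in>{d..e} \<inter> {a..b}. \<bar>f t\<bar> \<le> B'"
      by (auto simp: P_def)
    then have "\<bar>f t\<bar> \<le> max B B'" if "t \<in> {c..e} \<inter> {a..b}" for t
      using that by (cases "t \<le> d") (auto simp: le_max_iff_disj)
    then show "P c e" unfolding P_def by blast
  next
    fix x assume x: "a \<le> x" "x \<le> b"
    have R: "\<exists>r>x. \<exists>B. \<forall>t. x < t \<and> t < r \<and> t \<le> b \<longrightarrow> \<bar>f t\<bar> \<le> B"
    proof (cases "x < b")
      case True
      with assms(2) x obtain l where "(f \<longlongrightarrow> l) (at_right x)" by blast
      then have "\<forall>\<^sub>F t in at_right x. dist (f t) l < 1" by (rule tendstoD) simp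
      then obtain r where r: "r > x" "\<And>t. x < t \<Longrightarrow> t < r \<Longrightarrow> dist (f t) l < 1" unfolding eventually_at_right_field by blast
      have "\<bar>f t\<bar> \<le> \<bar>l\<bar> + 1" if "x < t" "t < r" for t
        using r(2)[OF that] unfolding dist_real_def by linarith
      then show ?thesis using r(1) by blast
    next
      case False
      then show ?thesis using x by (intro exI[of _ "x + 1"]) auto
    qed
    have L: "\<exists>r<x. \<exists>B. \<forall>t. r < t \<and> t < x \<and> a \<le> t \<longrightarrow> \<bar>f t\<bar> \<le> B"
    proof (cases "a < x")
      case True
      with assms(3) x obtain l where "(f \<longlongrightarrow> l) (at_left x)" by blast
      then have "\<forall>\<^sub>F t in at_left x. dist (f t) l < 1" by (rule tendstoD) simp
      then obtain r where r: "r < x" "\<And>t. r < t \<Longrightarrow> t < x \<Longrightarrow> dist (f t) l < 1" unfolding eventually_at_left_field by blast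
      have "\<bar>f t\<bar> \<le> \<bar>l\<bar> + 1" if "r < t" "t < x" for t
        using r(2)[OF that] unfolding dist_real_def by linarith
      then show ?thesis using r(1) by blast
    next
      case False
      then show ?thesis using x by (intro exI[of _ "x - 1"]) auto
    qed
    from R obtain r B where r: "r > x" "\<And>t. x < t \<Longrightarrow> t < r \<Longrightarrow> t \<le> b \<Longrightarrow> \<bar>f t\<bar> \<le> B" by blast
    from L obtain r' B' where r': "r' < x" "\<And>t. r' < t \<Longrightarrow> t < x \<Longrightarrow> a \<le> t \<Longrightarrow> \<bar>f t\<bar> \<le> B'" by blast
    show "\<exists>d>0. \<forall>c e. c \<le> x \<and> x \<le> e \<and> e - c < d \<longrightarrow> P c e"
    proof (intro exI[of _ "min (r - x) (x - r')"] conjI allI impI)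
      fix c e assume ce: "c \<le> x \<and> x \<le> e \<and> e - c < min (r - x) (x - r')"
      have "\<bar>f t\<bar> \<le> max \<bar>f x\<bar> (max B B')" if "t \<in> {c..e} \<inter> {a..b}" for t
        using that ce r(2)[of t] r'(2)[of t] by (cases t x rule: linorder_cases) auto
      then show "P c e" unfolding P_def by blast
    qed (use r r' in auto)
  qed
  then show ?thesis by (auto simp: P_def)
qed

section \<open>Cadlag paths with a lifetime and their clock\<close>

definition ordinate :: "'i path \<Rightarrow> real \<Rightarrow> real" where
  "ordinate z t = (case z t of None \<Rightarrow> 0 | Some (y, j) \<Rightarrow> y)"

text \<open>What the Lamperti transform uses of a path: the ordinate is cadlag while alive, and the
  living times form an initial interval open on the right. No left limit is imposed at the time of
  death.\<close>

definition regular_path :: "'i path \<Rightarrow> bool" where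
  "regular_path z \<longleftrightarrow> z 0 \<noteq> None \<and>
     (\<forall>t\<ge>0. z t \<noteq> None \<longrightarrow> (\<forall>s\<in>{0..t}. z s \<noteq> None) \<and>
        (\<forall>\<^sub>F u in at_right t. z u \<noteq> None) \<and> (ordinate z \<longlongrightarrow> ordinate z t) (at_right t)) \<and>
     (\<forall>t>0. z t \<noteq> None \<longrightarrow> (\<exists>l. (ordinate z \<longlongrightarrow> l) (at_left t)))"

locale regular =
  fixes \<alpha> :: real and z :: "'i path"
  assumes reg: "regular_path z"
begin

definition g :: "real \<Rightarrow> real" where
  "g u = (case z u of None \<Rightarrow> 0 | Some (y, j) \<Rightarrow> exp (\<alpha> * y))"

lemma alive_down: "0 \<le> s \<Longrightarrow> s \<le> t \<Longrightarrow> z t \<noteq> None \<Longrightarrow> z s \<noteq> None"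
proof -
  assume s: "0 \<le> s" "s \<le> t" "z t \<noteq> None"
  then have "0 \<le> t" by simp
  with s(3) reg have "\<forall>s\<in>{0..t}. z s \<noteq> None" unfolding regular_path_def by blast
  with s show ?thesis by simp
qed

lemma alive_right: "0 \<le> t \<Longrightarrow> z t \<noteq> None \<Longrightarrow> \<exists>r>t. \<forall>u\<in>{t..<r}. z u \<noteq> None"
proof -
  assume t: "0 \<le> t" "z t \<noteq> None"
  then have "\<forall>\<^sub>F u in at_right t. z u \<noteq> None" using reg unfolding regular_path_def by blast
  then obtain r where r: "r > t" "\<And>u. t < u \<Longrightarrow> u < r \<Longrightarrow> z u \<noteq> None" unfolding eventually_at_right_field by blast
  have "z u \<noteq> None" if "u \<in> {t..<r}" for u
  proof (cases "u = t")
    case False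
    with that have "t < u" "u < r" by auto
    then show ?thesis by (rule r(2))
  qed (use t in simp)
  with r(1) show ?thesis by blast
qed

lemma g_dead: "z u = None \<Longrightarrow> g u = 0"
  by (simp add: g_def)

lemma g_alive: "z u \<noteq> None \<Longrightarrow> g u = exp (\<alpha> * ordinate z u)"
  by (auto simp: g_def ordinate_def split: option.splits)

lemma g_right: "0 \<le> t \<Longrightarrow> (g \<longlongrightarrow> g t) (at_right t)"
proof (cases "z t = None")
  case True
  assume t: "0 \<le> t"
  have "g u = 0" if "t \<le> u" for u using alive_down[of t u] t that True g_dead by blast
  then have "\<forall>\<^sub>F u in at_right t. g u = g t" using eventually_at_right_less[of t] by (auto elim!: eventually_mono)
  then show ?thesis by (rule tendsto_eventually)
next
  case False
  assume t: "0 \<le> t"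
  then have ev: "\<forall>\<^sub>F u in at_right t. z u \<noteq> None" and lim: "(ordinate z \<longlongrightarrow> ordinate z t) (at_right t)"
    using reg False unfolding regular_path_def by blast+
  have "((\<lambda>u. exp (\<alpha> * ordinate z u)) \<longlongrightarrow> exp (\<alpha> * ordinate z t)) (at_right t)"
    by (intro tendsto_intros lim)
  moreover have "\<forall>\<^sub>F u in at_right t. exp (\<alpha> * ordinate z u) = g u"
    using ev by eventually_elim (simp add: g_alive)
  ultimately show ?thesis unfolding g_alive[OF False] by (rule Lim_transform_eventually)
qed

lemma g_left: "0 < t \<Longrightarrow> z t \<noteq> None \<Longrightarrow> \<exists>l. (g \<longlongrightarrow> l) (at_left t)"
proof -
  assume t: "0 < t" "z t \<noteq> None"
  with reg obtain l where lim: "(ordinate z \<longlongrightarrow> l) (at_left t)" unfolding regular_path_def by blast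
  have "((\<lambda>u. exp (\<alpha> * ordinate z u)) \<longlongrightarrow> exp (\<alpha> * l)) (at_left t)"
    by (intro tendsto_intros lim)
  moreover have "\<forall>\<^sub>F u in at_left t. exp (\<alpha> * ordinate z u) = g u"
    unfolding eventually_at_left_field using t alive_down[of _ t]
    by (intro exI[of _ 0]) (simp add: g_alive del: not_None_eq)
  ultimately show ?thesis using Lim_transform_eventually by blast
qed

text \<open>The values are extended because the integral may diverge as the lifetime is approached;
  at living times it is finite by \<open>A_finite\<close>.\<close>

definition A :: "real \<Rightarrow> ennreal" where
  "A s = exp_functional \<alpha> z {0..s}"

lemma measurable_g: "(\<lambda>u. g u * indicator {0..} u) \<in> borel_measurable borel"
proof -
  have "(\<lambda>u. g u * indicator {0..} u) = (\<lambda>u. if 0 \<le> u then g u else 0)" by (auto simp: fun_eq_iff)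
  then show ?thesis using borel_measurable_right_continuous[OF g_right] by simp
qed

lemma exp_functional_eq:
  assumes "S \<subseteq> {0..}"
  shows "exp_functional \<alpha> z S = (\<integral>\<^sup>+ u. ennreal (g u * indicator {0..} u) * indicator S u \<partial>lborel)"
  unfolding exp_functional_def
  by (intro nn_integral_cong) (use assms in \<open>auto simp: g_def indicator_def split: option.splits\<close>)

lemma A_split:
  assumes "0 \<le> s" "s \<le> t"
  shows "A t = A s + (\<integral>\<^sup>+ u. ennreal (g u * indicator {0..} u) * indicator {s<..t} u \<partial>lborel)"
proof -
  have "A t = (\<integral>\<^sup>+ u. ennreal (g u * indicator {0..} u) * indicator {0..s} u +
      ennreal (g u * indicator {0..} u) * indicator {s<..t} u \<partial>lborel)"
    unfolding A_def using assms
    by (subst exp_functional_eq) (auto intro!: nn_integral_cong simp: indicator_def)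
  also have "\<dots> = A s + (\<integral>\<^sup>+ u. ennreal (g u * indicator {0..} u) * indicator {s<..t} u \<partial>lborel)"
    unfolding A_def using measurable_g
    by (subst nn_integral_add) (auto simp: exp_functional_eq)
  finally show ?thesis .
qed

lemma A_mono: "s \<le> t \<Longrightarrow> A s \<le> A t"
  unfolding A_def exp_functional_def by (intro nn_integral_mono) (auto simp: indicator_def)

lemma A_0 [simp]: "s \<le> 0 \<Longrightarrow> A s = 0"
proof -
  assume "s \<le> 0"
  then have "A s \<le> A 0" by (rule A_mono)
  also have "A 0 = (\<integral>\<^sup>+ u. ennreal (g u * indicator {0..} u) * indicator {0..0} u \<partial>lborel)"
    unfolding A_def by (rule exp_functional_eq) simp
  also have "\<dots> = 0"
    by (rule nn_integral_null_set) (simp add: null_sets_def)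
  finally show ?thesis by simp
qed

text \<open>Up to a living time the rate \<open>g\<close> has one-sided limits on a compact interval
  and is bounded there, so its integral is Lipschitz.\<close>

lemma A_bound:
  assumes "0 \<le> t" "z t \<noteq> None"
  shows "\<exists>B\<ge>0. \<forall>s u. 0 \<le> s \<and> s \<le> u \<and> u \<le> t \<longrightarrow> A u \<le> A s + ennreal (B * (u - s))"
proof -
  obtain B where B: "\<forall>u\<in>{0..t}. \<bar>g u\<bar> \<le> B"
    using locally_bounded_imp_bounded_interval[of 0 t g] assms g_right g_left alive_down[of _ t] by (metis less_imp_le)
  have B0: "0 \<le> B" using B assms by force
  have "A u \<le> A s + ennreal (B * (u - s))" if "0 \<le> s" "s \<le> u" "u \<le> t" for s u
  proof -
    have "(\<integral>\<^sup>+ r. ennreal (g r * indicator {0..} r) * indicator {s<..u} r \<partial>lborel) \<le>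
        (\<integral>\<^sup>+ r. ennreal B * indicator {s<..u} r \<partial>lborel)"
    proof (rule nn_integral_mono)
      fix r
      show "ennreal (g r * indicator {0..} r) * indicator {s<..u} r \<le> ennreal B * indicator {s<..u} r"
      proof (cases "r \<in> {s<..u}")
        case True
        then have "r \<in> {0..t}" using that by auto
        with B have "g r \<le> B" by (meson abs_le_D1)
        then show ?thesis using True \<open>r \<in> {0..t}\<close> by (simp add: ennreal_leI)
      qed simp
    qed
    also have "\<dots> = ennreal (B * (u - s))" using that B0
      by (simp add: nn_integral_cmult_indicator ennreal_mult)
    finally show ?thesis unfolding A_split[OF that(1,2)] by (rule add_left_mono)
  qed
  with B0 show ?thesis by blast
qed

lemma A_finite: "z t \<noteq> None \<Longrightarrow> A t < \<infinity>"
proof (cases "0 \<le> t")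
  case True
  assume "z t \<noteq> None"
  from A_bound[OF True this] obtain B
    where B: "\<And>s u. 0 \<le> s \<and> s \<le> u \<and> u \<le> t \<Longrightarrow> A u \<le> A s + ennreal (B * (u - s))" by blast
  from B[of 0 t] True have "A t \<le> ennreal (B * t)" by simp
  then show ?thesis by (simp add: le_less_trans)
qed simp

text \<open>The rate is positive at \<open>s\<close> and right-continuous, so it exceeds
  \<open>g s / 2\<close> for some time after \<open>s\<close>.\<close>

lemma A_strict:
  assumes "0 \<le> s" "s < t" "z s \<noteq> None"
  shows "A s < A t"
proof -
  have g0: "0 < g s" using assms(3) by (simp add: g_alive)
  have "\<forall>\<^sub>F u in at_right s. g s / 2 < g u"
    using order_tendstoD(1)[OF g_right[OF assms(1)], of "g s / 2"] g0 by simp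
  then obtain r where r: "r > s" "\<And>u. s < u \<Longrightarrow> u < r \<Longrightarrow> g s / 2 < g u" unfolding eventually_at_right_field by blast
  define r' where "r' = (min r t + s) / 2"
  have r': "s < r'" "r' < r" "r' < t" using r assms by (auto simp: r'_def min_def field_simps)
  have "0 < ennreal (g s / 2 * (r' - s))" using g0 r' by simp
  also have "\<dots> = ennreal (g s / 2) * ennreal (r' - s)" using g0 r' by (intro ennreal_mult) auto
  also have "\<dots> = (\<integral>\<^sup>+ u. ennreal (g s / 2) * indicator {s<..r'} u \<partial>lborel)"
    using r' g0 by (simp add: nn_integral_cmult_indicator)
  also have "\<dots> \<le> (\<integral>\<^sup>+ u. ennreal (g u * indicator {0..} u) * indicator {s<..t} u \<partial>lborel)"
  proof (intro nn_integral_mono)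
    fix u
    show "ennreal (g s / 2) * indicator {s<..r'} u \<le> ennreal (g u * indicator {0..} u) * indicator {s<..t} u"
      using r(2)[of u] r' assms by (auto simp: indicator_def intro!: ennreal_leI)
  qed
  finally show ?thesis
    using A_finite[OF assms(3)] assms by (subst A_split[of s t]) (auto simp: less_top)
qed

lemma A_dead: "0 \<le> s \<Longrightarrow> s \<le> t \<Longrightarrow> z s = None \<Longrightarrow> A t = A s"
proof -
  assume s: "0 \<le> s" "s \<le> t" "z s = None"
  have "g u = 0" if "s < u" for u using alive_down[of s u] s that g_dead by (metis less_imp_le)
  then have "(\<integral>\<^sup>+ u. ennreal (g u * indicator {0..} u) * indicator {s<..t} u \<partial>lborel) = (\<integral>\<^sup>+ u. 0 \<partial>lborel)"
    by (subst nn_integral_cong[where v = "\<lambda>_. 0"]) (auto simp: indicator_def)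
  then show ?thesis using A_split[OF s(1,2)] by simp
qed

lemma A_less_sup: "0 \<le> s \<Longrightarrow> z s \<noteq> None \<Longrightarrow> A s < exp_functional \<alpha> z {0..}"
proof -
  assume s: "0 \<le> s" "z s \<noteq> None"
  then have "A s < A (s + 1)" by (intro A_strict) auto
  also have "\<dots> \<le> exp_functional \<alpha> z {0..}"
    unfolding A_def exp_functional_def by (intro nn_integral_mono) (auto simp: indicator_def)
  finally show ?thesis .
qed

lemma A_sup: "exp_functional \<alpha> z {0..} = (SUP n. A (real n))"
proof -
  have "exp_functional \<alpha> z {0..} = (\<integral>\<^sup>+ u. (SUP n. ennreal (g u * indicator {0..} u) * indicator {0..real n} u) \<partial>lborel)"
    unfolding exp_functional_eq[OF subset_refl]
  proof (intro nn_integral_cong antisym)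
    fix u
    obtain n where "u \<le> real n" using real_arch_simple by blast
    then have "ennreal (g u * indicator {0..} u) * indicator {0..} u \<le> ennreal (g u * indicator {0..} u) * indicator {0..real n} u"
      by (auto simp: indicator_def)
    also have "\<dots> \<le> (SUP n. ennreal (g u * indicator {0..} u) * indicator {0..real n} u)" by (intro SUP_upper) auto
    finally show "ennreal (g u * indicator {0..} u) * indicator {0..} u \<le> \<dots>" .
    show "\<dots> \<le> ennreal (g u * indicator {0..} u) * indicator {0..} u"
      by (intro SUP_least) (auto simp: indicator_def)
  qed
  also have "\<dots> = (SUP n. \<integral>\<^sup>+ u. ennreal (g u * indicator {0..} u) * indicator {0..real n} u \<partial>lborel)"
    using measurable_g by (intro nn_integral_monotone_convergence_SUP) (auto simp: incseq_def le_fun_def indicator_def)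
  also have "\<dots> = (SUP n. A (real n))" unfolding A_def by (subst exp_functional_eq) auto
  finally show ?thesis .
qed

definition clock :: "real \<Rightarrow> real" where
  "clock s = enn2real (A s)"

lemma clock: "z s \<noteq> None \<Longrightarrow> ennreal (clock s) = A s"
  using A_finite[of s] by (simp add: clock_def less_top)

lemma clock_nonneg: "0 \<le> clock s" by (simp add: clock_def)

lemma clock_0: "clock 0 = 0" by (simp add: clock_def)

lemma clock_less: "0 \<le> s \<Longrightarrow> s < t \<Longrightarrow> z t \<noteq> None \<Longrightarrow> clock s < clock t"
  using A_strict[of s t] alive_down[of s t] clock[of s] clock[of t] clock_nonneg
  by (metis ennreal_less_iff less_imp_le)

text \<open>Strict growth after a living time, together with monotonicity, identifies the times at
  which the integral exceeds \<open>A s\<close> as exactly those after \<open>s\<close>.\<close>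

lemma time_change_clock:
  assumes "0 \<le> s" "z s \<noteq> None"
  shows "time_change \<alpha> z (clock s) = s"
proof -
  have "{r. 0 < r \<and> ennreal (clock s) < exp_functional \<alpha> z {0..r}} = {s<..}"
    unfolding clock[OF assms(2)] A_def[symmetric]
    using A_strict[OF assms(1) _ assms(2)] A_mono[of _ s] assms(1) by (auto simp: not_less[symmetric])
  then show ?thesis by (simp add: time_change_def)
qed

text \<open>The candidate is the infimum of the times at which the integral exceeds
  \<open>t\<close>. There the integral is at most \<open>t\<close> by left-continuity; the path is
  alive since the integral stops growing after death; and the Lipschitz bound to the right gives the
  opposite inequality.\<close>

lemma clock_surj:
  assumes "0 \<le> t" "ennreal t < exp_functional \<alpha> z {0..}"
  shows "\<exists>s\<ge>0. z s \<noteq> None \<and> clock s = t"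
proof -
  define R where "R = {r. 0 < r \<and> ennreal t < A r}"
  obtain n where n: "ennreal t < A (real n)" using assms(2) unfolding A_sup less_SUP_iff by blast
  have n0: "0 < real n" using n A_0[of "real n"] by (cases "0 < real n") (auto simp: not_less)
  then have R: "real n \<in> R" using n by (simp add: R_def)
  have bdd: "bdd_below R" by (rule bdd_belowI[of _ 0]) (auto simp: R_def)
  define s where "s = Inf R"
  have s0: "0 \<le> s" unfolding s_def
  proof (rule cInf_greatest)
    show "R \<noteq> {}" using R by blast
  qed (simp add: R_def)
  have below: "A r \<le> ennreal t" if "r < s" for r
  proof (rule ccontr)
    assume "\<not> ?thesis"
    then have A: "ennreal t < A r" by simp
    then have "0 < r" using A_0[of r] by (cases "0 < r") (auto simp: not_less)
    with A have "r \<in> R" by (simp add: R_def)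
    then have "s \<le> r" unfolding s_def by (rule cInf_lower[OF _ bdd])
    with that show False by simp
  qed
  have above: "ennreal t < A r" if sr: "s < r" for r
  proof -
    obtain r' where "r' \<in> R" "r' < r" using cInf_lessD[of R r] sr R unfolding s_def by blast
    then show ?thesis using A_mono[of r' r] by (auto simp: R_def)
  qed
  have As: "A s \<le> ennreal t"
  proof (cases "s = 0")
    case False
    then have s: "0 < s" using s0 by simp
    \<comment> \<open>Left-continuity at \<open>s\<close> by monotone convergence over
      \<open>{0..s - s / real (Suc k)}\<close>; the endpoint \<open>s\<close> that is lost has
      measure zero.\<close>
    have "A s = (\<integral>\<^sup>+ u. (SUP k. ennreal (g u * indicator {0..} u) * indicator {0..s - s / real (Suc k)} u) \<partial>lborel)"
      unfolding A_def exp_functional_eq[of "{0..s}", simplified]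
    proof (intro nn_integral_cong_AE AE_I[where N = "{s}"])
      show "{u \<in> space lborel. ennreal (g u * indicator {0..} u) * indicator {0..s} u \<noteq>
          (SUP k. ennreal (g u * indicator {0..} u) * indicator {0..s - s / real (Suc k)} u)} \<subseteq> {s}"
      proof (rule subsetI, rule ccontr)
        fix u assume u: "u \<in> {u \<in> space lborel. ennreal (g u * indicator {0..} u) * indicator {0..s} u \<noteq>
          (SUP k. ennreal (g u * indicator {0..} u) * indicator {0..s - s / real (Suc k)} u)}" and "u \<notin> {s}"
        let ?S = "SUP k. ennreal (g u * indicator {0..} u) * indicator {0..s - s / real (Suc k)} u"
        have "ennreal (g u * indicator {0..} u) * indicator {0..s} u \<le> ?S"
        proof (cases "0 \<le> u \<and> u < s")
          case True
          then obtain k where "inverse (real (Suc k)) < (s - u) / s" using reals_Archimedean[of "(s - u) / s"] s by auto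
          then have "s / real (Suc k) < s - u" using s by (simp add: field_simps)
          then have "ennreal (g u * indicator {0..} u) * indicator {0..s} u \<le>
              ennreal (g u * indicator {0..} u) * indicator {0..s - s / real (Suc k)} u"
            using True by (auto simp: indicator_def)
          also have "\<dots> \<le> ?S" by (intro SUP_upper) auto
          finally show ?thesis .
        next
          case False
          then show ?thesis using \<open>u \<notin> {s}\<close> by (auto simp: indicator_def)
        qed
        moreover have "?S \<le> ennreal (g u * indicator {0..} u) * indicator {0..s} u"
        proof (intro SUP_least)
          fix k
          have "0 \<le> s / real (Suc k)" using s by simp
          then show "ennreal (g u * indicator {0..} u) * indicator {0..s - s / real (Suc k)} u \<le>
              ennreal (g u * indicator {0..} u) * indicator {0..s} u"
            unfolding indicator_def by auto
        qed
        ultimately show False using u by auto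
      qed
    qed auto
    also have "\<dots> = (SUP k. \<integral>\<^sup>+ u. ennreal (g u * indicator {0..} u) * indicator {0..s - s / real (Suc k)} u \<partial>lborel)"
    proof (intro nn_integral_monotone_convergence_SUP)
      show "incseq (\<lambda>k u. ennreal (g u * indicator {0..} u) * indicator {0..s - s / real (Suc k)} u)"
      proof (intro incseq_SucI le_funI)
        fix k u
        have "s / real (Suc (Suc k)) \<le> s / real (Suc k)" using s by (intro divide_left_mono) auto
        then show "ennreal (g u * indicator {0..} u) * indicator {0..s - s / real (Suc k)} u \<le>
            ennreal (g u * indicator {0..} u) * indicator {0..s - s / real (Suc (Suc k))} u"
          unfolding indicator_def by auto
      qed
    qed (use measurable_g in measurable)
    also have "\<dots> = (SUP k. A (s - s / real (Suc k)))" unfolding A_def by (subst exp_functional_eq) auto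
    also have "\<dots> \<le> ennreal t" using s by (intro SUP_least below) simp
    finally show ?thesis .
  qed simp
  have alive: "z s \<noteq> None"
  proof
    assume "z s = None"
    then have "A (s + 1) = A s" using s0 by (intro A_dead) auto
    with above[of "s + 1"] As show False by simp
  qed
  then obtain r where r: "s < r" "z r \<noteq> None"
    using alive_right[OF s0 alive] by (metis atLeastLessThan_iff dense less_imp_le)
  then obtain B where B: "0 \<le> B" "\<And>u. s \<le> u \<Longrightarrow> u \<le> r \<Longrightarrow> A u \<le> A s + ennreal (B * (u - s))"
    using A_bound[of r] s0 by force
  have "t \<le> clock s"
  proof (rule field_le_epsilon)
    fix e :: real assume e: "0 < e"
    \<comment> \<open>The denominator \<open>B + 1\<close> covers the case
      \<open>B = 0\<close>.\<close>
    define u where "u = min r (s + e / (B + 1))"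
    have u: "s < u" "u \<le> r" using r e B by (auto simp: u_def)
    have "B * (u - s) \<le> B * (e / (B + 1))" using B by (intro mult_left_mono) (auto simp: u_def)
    also have "\<dots> \<le> e" using B e by (simp add: field_simps)
    finally have le: "B * (u - s) \<le> e" .
    have "ennreal t < A u" using above u by simp
    also have "\<dots> \<le> ennreal (clock s) + ennreal (B * (u - s))" using B(2)[of u] u clock[OF alive] by simp
    also have "\<dots> = ennreal (clock s + B * (u - s))" using B u clock_nonneg by (simp add: ennreal_plus)
    finally have "t < clock s + B * (u - s)" using assms(1) by (simp add: ennreal_less_iff)
    then show "t \<le> clock s + e" using le by simp
  qed
  moreover have "clock s \<le> t" using As clock[OF alive] assms(1) by (metis ennreal_le_iff)
  ultimately show ?thesis using s0 alive by (intro exI[of _ s]) auto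
qed

lemma lamperti_0:
  assumes "0 < x"
  shows "fst (lamperti \<alpha> x (z, d)) 0 = map_option (\<lambda>(y, j). (x * exp y, j)) (z 0)"
proof -
  have z0: "z 0 \<noteq> None" using reg unfolding regular_path_def by blast
  have "0 < exp_functional \<alpha> z {0..}" using A_less_sup[OF _ z0] by simp
  then have "0 < ennreal (x powr \<alpha>) * exp_functional \<alpha> z {0..}" using assms by (simp add: ennreal_zero_less_mult_iff)
  moreover have "time_change \<alpha> z 0 = 0" using time_change_clock[OF _ z0] clock_0 by simp
  ultimately show ?thesis by (simp add: lamperti_def)
qed

lemma lamperti_clock:
  assumes "0 \<le> s" "z s \<noteq> None"
  shows "alive (lamperti \<alpha> 1 (z, d)) (clock s)"
    and "pos (lamperti \<alpha> 1 (z, d)) (clock s) = exp (ordinate z s)"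
    and "snd (lamperti \<alpha> 1 (z, d)) (clock s) = d s"
proof -
  have "ennreal (clock s) < exp_functional \<alpha> z {0..}" using A_less_sup[OF assms] clock[OF assms(2)] by simp
  then have "fst (lamperti \<alpha> 1 (z, d)) (clock s) = map_option (\<lambda>(y, j). (exp y, j)) (z s)"
    using time_change_clock[OF assms] clock_nonneg by (simp add: lamperti_def)
  with assms(2) show "alive (lamperti \<alpha> 1 (z, d)) (clock s)" "pos (lamperti \<alpha> 1 (z, d)) (clock s) = exp (ordinate z s)"
    by (auto simp: alive_def pos_def ordinate_def)
  show "snd (lamperti \<alpha> 1 (z, d)) (clock s) = d s"
    using time_change_clock[OF assms] by (simp add: lamperti_def)
qed

lemma alive_lamperti:
  assumes "0 < t" "alive (lamperti \<alpha> 1 (z, d)) t"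
  shows "\<exists>s>0. z s \<noteq> None \<and> t = clock s"
proof -
  have "ennreal t < exp_functional \<alpha> z {0..}"
    using assms by (auto simp: alive_def lamperti_def split: if_splits)
  then obtain s where s: "0 \<le> s" "z s \<noteq> None" "clock s = t" using clock_surj[of t] assms(1) by auto
  with clock_0 assms(1) have "s \<noteq> 0" by auto
  with s show ?thesis by (intro exI[of _ s]) auto
qed

text \<open>The clock is strictly increasing and takes every value below its total, so each time
  shortly before \<open>clock s\<close> is the image of a time shortly before \<open>s\<close>, and
  the left limit is transported.\<close>

lemma jump_lamperti:
  assumes s: "0 < s" "z s \<noteq> None" and l: "(ordinate z \<longlongrightarrow> l) (at_left s)"
  shows "jump (pos (lamperti \<alpha> 1 (z, d))) (clock s) = exp (ordinate z s) - exp l"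
proof -
  let ?p = "pos (lamperti \<alpha> 1 (z, d))"
  have "((\<lambda>u. exp (ordinate z u)) \<longlongrightarrow> exp l) (at_left s)" by (intro tendsto_intros l)
  then have lim: "\<forall>\<^sub>F u in at_left s. exp (ordinate z u) \<in> S" if "open S" "exp l \<in> S" for S
    using that by (rule topological_tendstoD)
  have "(?p \<longlongrightarrow> exp l) (at_left (clock s))"
  proof (rule topological_tendstoI)
    fix S :: "real set" assume "open S" "exp l \<in> S"
    from lim[OF this] obtain r0 where r0: "r0 < s" "\<And>u. r0 < u \<Longrightarrow> u < s \<Longrightarrow> exp (ordinate z u) \<in> S"
      unfolding eventually_at_left_field by blast
    define r where "r = max 0 r0"
    have r: "0 \<le> r" "r < s" "r0 \<le> r" using s r0 by (auto simp: r_def)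
    have "?p u \<in> S" if u: "clock r < u" "u < clock s" for u
    proof -
      have u0: "0 \<le> u" using clock_nonneg[of r] u by simp
      have "ennreal u < A s" using u u0 clock[OF s(2)] by (metis ennreal_lessI le_less_trans)
      also have "\<dots> < exp_functional \<alpha> z {0..}" using A_less_sup[of s] s by simp
      finally obtain v where v: "0 \<le> v" "z v \<noteq> None" "clock v = u" using clock_surj[OF u0] by blast
      have "r < v"
      proof (rule ccontr)
        assume "\<not> r < v"
        then have "v \<le> r" by simp
        moreover have "z r \<noteq> None" using alive_down[of r s] r s by simp
        ultimately have "clock v \<le> clock r" using clock_less[of v r] v by (cases "v = r") auto
        with u v show False by simp
      qed
      moreover have "v < s"
      proof (rule ccontr)
        assume "\<not> v < s"
        then have "clock s \<le> clock v" using clock_less[of s v] v s by (cases "v = s") auto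
        with u v show False by simp
      qed
      ultimately have "exp (ordinate z v) \<in> S" using r r0(2)[of v] by simp
      then show ?thesis using lamperti_clock(2)[OF v(1,2), of d] v(3) by simp
    qed
    moreover have "clock r < clock s" using r s by (intro clock_less) auto
    ultimately show "\<forall>\<^sub>F u in at_left (clock s). ?p u \<in> S"
      unfolding eventually_at_left_field by blast
  qed
  then have "Lim (at_left (clock s)) ?p = exp l" by (intro tendsto_Lim) simp
  moreover have "?p (clock s) = exp (ordinate z s)" using lamperti_clock(2)[of s d] s by simp
  ultimately show ?thesis by (simp add: jump_def)
qed

end

section \<open>Self-similarity, path by path\<close>

lemma lamperti_scale:
  assumes "0 < x"
  shows "fst (lamperti \<alpha> x c) t = map_option (\<lambda>(y, j). (x * y, j)) (fst (lamperti \<alpha> 1 c) (x powr (- \<alpha>) * t))"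
    and "snd (lamperti \<alpha> x c) t = snd (lamperti \<alpha> 1 c) (x powr (- \<alpha>) * t)"
proof -
  have "(ennreal t < ennreal (x powr \<alpha>) * E) = (ennreal (x powr (- \<alpha>) * t) < E)" if "0 \<le> t" for E
  proof -
    have p: "0 < ennreal (x powr \<alpha>)" "ennreal (x powr \<alpha>) < \<top>" using assms by auto
    have "ennreal t = ennreal (x powr \<alpha>) * ennreal (x powr (- \<alpha>) * t)"
      using that assms by (simp add: ennreal_mult[symmetric] powr_minus field_simps)
    moreover have "ennreal (x powr \<alpha>) * a < ennreal (x powr \<alpha>) * b \<longleftrightarrow> a < b" for a b
      using ennreal_mult_strict_left_mono[OF _ p, of a b] mult_left_mono[of b a "ennreal (x powr \<alpha>)"]
      by (auto simp: not_le[symmetric])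
    ultimately show ?thesis by simp
  qed
  note key = this[of "exp_functional \<alpha> (fst c) {0..}"]
  have le: "0 \<le> x powr (- \<alpha>) * t \<longleftrightarrow> 0 \<le> t" using assms by (simp add: zero_le_mult_iff)
  have comm: "t * x powr (- \<alpha>) = x powr (- \<alpha>) * t" by (rule mult.commute)
  have m: "map_option (\<lambda>(y, j). (x * exp y, j)) z =
      map_option (\<lambda>(y, j). (x * y, j)) (map_option (\<lambda>(y, j). (1 * exp y, j)) z)" for z :: "(real \<times> 'a) option"
    by (cases z) auto
  show "fst (lamperti \<alpha> x c) t = map_option (\<lambda>(y, j). (x * y, j)) (fst (lamperti \<alpha> 1 c) (x powr (- \<alpha>) * t))"
  proof (cases "0 \<le> t \<and> ennreal t < ennreal (x powr \<alpha>) * exp_functional \<alpha> (fst c) {0..}")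
    case True
    then have "0 \<le> x powr (- \<alpha>) * t \<and> ennreal (x powr (- \<alpha>) * t) < exp_functional \<alpha> (fst c) {0..}"
      using key le by blast
    then show ?thesis unfolding lamperti_def fst_conv if_P[OF True] comm m by simp
  next
    case False
    then have "\<not> (0 \<le> x powr (- \<alpha>) * t \<and> ennreal (x powr (- \<alpha>) * t) < exp_functional \<alpha> (fst c) {0..})"
      using key le by blast
    then show ?thesis unfolding lamperti_def fst_conv if_not_P[OF False] by auto
  qed
  show "snd (lamperti \<alpha> x c) t = snd (lamperti \<alpha> 1 c) (x powr (- \<alpha>) * t)"
    by (simp add: lamperti_def mult.commute)
qed

lemma filterlim_times_pos_at_left:
  fixes a :: real
  assumes "0 < a"
  shows "filterlim ((*) a) (at_left (a * t)) (at_left t)"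
  unfolding filterlim_at
proof
  show "\<forall>\<^sub>F u in at_left t. a * u \<in> {..<a * t} \<and> a * u \<noteq> a * t"
    unfolding eventually_at_left_field using assms by (intro exI[of _ "t - 1"]) auto
qed (intro tendsto_intros)

text \<open>Multiplication of time by \<open>x powr (- \<alpha>)\<close> matches the jumps of the
  two paths. Membership in \<open>cell_paths\<close> supplies the left limits; without them
  \<open>jump\<close>, being a value of \<open>Lim\<close>, could not be scaled.\<close>

lemma jump_sum_lamperti_scale:
  assumes x: "0 < x" and c1: "lamperti \<alpha> 1 c \<in> cell_paths"
  shows "jump_sum f k (lamperti \<alpha> x c) = jump_sum (\<lambda>y. f (x * y)) k (lamperti \<alpha> 1 c)"
proof -
  let ?c = "lamperti \<alpha> 1 c" and ?d = "lamperti \<alpha> x c"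
  define a where "a = x powr (- \<alpha>)"
  have a: "0 < a" using x by (simp add: a_def)
  have al: "alive ?d t \<longleftrightarrow> alive ?c (a * t)" for t
    by (simp add: alive_def lamperti_scale(1)[OF x] a_def)
  have ps: "pos ?d t = x * pos ?c (a * t)" for t
    by (auto simp: pos_def lamperti_scale(1)[OF x] a_def split: option.splits)
  have jp: "jump (pos ?d) t = x * jump (pos ?c) (a * t)" if t: "0 < t" "alive ?d t" for t
  proof -
    have "0 < a * t" "alive ?c (a * t)" using a t al by auto
    then obtain l where l: "(pos ?c \<longlongrightarrow> l) (at_left (a * t))" using c1 unfolding cell_paths_def by blast
    have "filterlim ((*) a) (at_left (a * t)) (at_left t)"
      by (rule filterlim_times_pos_at_left[OF a])
    with l have "((\<lambda>u. pos ?c (a * u)) \<longlongrightarrow> l) (at_left t)" by (rule filterlim_compose)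
    then have "(pos ?d \<longlongrightarrow> x * l) (at_left t)" unfolding ps by (intro tendsto_intros)
    then have "Lim (at_left t) (pos ?d) = x * l" by (intro tendsto_Lim) simp
    moreover have "Lim (at_left (a * t)) (pos ?c) = l" using l by (intro tendsto_Lim) simp
    ultimately show ?thesis by (simp add: jump_def ps algebra_simps)
  qed
  have iff: "t \<in> neg_jumps ?d \<longleftrightarrow> a * t \<in> neg_jumps ?c" for t
    using a x jp[of t] al[of t] by (auto simp: neg_jumps_def zero_less_mult_iff mult_less_0_iff)
  have "bij_betw ((*) a) {s \<in> neg_jumps ?d. snd ?d s = k} {s \<in> neg_jumps ?c. snd ?c s = k}"
  proof (rule bij_betwI[where g = "\<lambda>t. t / a"])
    show "(*) a \<in> {s \<in> neg_jumps ?d. snd ?d s = k} \<rightarrow> {s \<in> neg_jumps ?c. snd ?c s = k}"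
      by (auto simp: iff lamperti_scale(2)[OF x] a_def[symmetric])
    show "(\<lambda>t. t / a) \<in> {s \<in> neg_jumps ?c. snd ?c s = k} \<rightarrow> {s \<in> neg_jumps ?d. snd ?d s = k}"
      using a by (auto simp: iff lamperti_scale(2)[OF x] a_def[symmetric])
  qed (use a in auto)
  then have "jump_sum (\<lambda>y. f (x * y)) k ?c =
      (\<integral>\<^sup>+ s. f (x * \<bar>jump (pos ?c) (a * s)\<bar>) \<partial>count_space {s \<in> neg_jumps ?d. snd ?d s = k})"
    unfolding jump_sum_def by (rule nn_integral_bij_count_space[symmetric])
  also have "\<dots> = jump_sum f k ?d"
    unfolding jump_sum_def
    by (intro nn_integral_cong) (use x in \<open>auto simp: jp neg_jumps_def abs_mult\<close>)
  finally show ?thesis ..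
qed

section \<open>Paths of Markov additive processes\<close>

locale steps =
  fixes \<theta> :: "real \<Rightarrow> 'i::finite"
  assumes step: "step_path \<theta>"
begin

lemma step_right: "0 \<le> t \<Longrightarrow> \<exists>r>t. \<forall>u. t \<le> u \<longrightarrow> u < r \<longrightarrow> \<theta> u = \<theta> t"
proof -
  assume "0 \<le> t"
  then have "\<forall>\<^sub>F u in at_right t. \<theta> u = \<theta> t" using step unfolding step_path_def by blast
  then obtain r where r: "r > t" "\<And>u. t < u \<Longrightarrow> u < r \<Longrightarrow> \<theta> u = \<theta> t" unfolding eventually_at_right_field by blast
  have "\<theta> u = \<theta> t" if "t \<le> u" "u < r" for u using r(2)[of u] that by (cases "u = t") auto
  with r(1) show ?thesis by blast
qed

lemma left_state_eqI: "\<forall>\<^sub>F u in at_left t. \<theta> u = l \<Longrightarrow> left_state \<theta> t = l"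
  unfolding left_state_def
proof (rule the_equality)
  fix l' assume "\<forall>\<^sub>F u in at_left t. \<theta> u = l" "\<forall>\<^sub>F u in at_left t. \<theta> u = l'"
  then have "\<forall>\<^sub>F u in at_left t. l = l'" by eventually_elim simp
  then show "l' = l" by (simp add: trivial_limit_at_left_real)
qed

lemma step_left: "0 < t \<Longrightarrow> \<exists>r<t. 0 \<le> r \<and> (\<forall>u. r < u \<longrightarrow> u < t \<longrightarrow> \<theta> u = left_state \<theta> t)"
proof -
  assume t: "0 < t"
  then obtain l where l: "\<forall>\<^sub>F u in at_left t. \<theta> u = l" using step unfolding step_path_def by blast
  then obtain r where r: "r < t" "\<And>u. r < u \<Longrightarrow> u < t \<Longrightarrow> \<theta> u = l" unfolding eventually_at_left_field by blast
  with t left_state_eqI[OF l] show ?thesis by (intro exI[of _ "max 0 r"]) auto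
qed

lemma chain_jumps_iff: "s \<in> chain_jumps \<theta> \<longleftrightarrow> 0 < s \<and> left_state \<theta> s \<noteq> \<theta> s"
proof (cases "0 < s")
  case True
  from step_left[OF True] obtain r where r: "r < s" "\<And>u. r < u \<Longrightarrow> u < s \<Longrightarrow> \<theta> u = left_state \<theta> s" by blast
  then have ev: "\<forall>\<^sub>F u in at_left s. \<theta> u = left_state \<theta> s" unfolding eventually_at_left_field by blast
  have "(\<forall>\<^sub>F u in at_left s. \<theta> u = \<theta> s) \<longleftrightarrow> left_state \<theta> s = \<theta> s"
    using ev left_state_eqI[where t = s and l = "\<theta> s"] by metis
  then show ?thesis using True by (simp add: chain_jumps_def)
qed (simp add: chain_jumps_def)

lemma no_chain_jumps_const:
  assumes "\<And>u. u \<in> {a<..<b} \<Longrightarrow> \<theta> u = i" "0 \<le> a"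
  shows "chain_jumps \<theta> \<inter> {a<..<b} = {}"
proof -
  have "s \<notin> chain_jumps \<theta>" if "s \<in> {a<..<b}" for s
  proof -
    have "\<forall>\<^sub>F u in at_left s. \<theta> u = i"
      unfolding eventually_at_left_field using that assms(1) by (intro exI[of _ a]) auto
    then have "left_state \<theta> s = i" by (rule left_state_eqI)
    then show ?thesis using assms(1)[OF that] by (simp add: chain_jumps_iff)
  qed
  then show ?thesis by blast
qed

text \<open>Bisection again: on either side of each time there is an interval on which the path is
  constant, so each time has a neighbourhood with at most one jump.\<close>

lemma finite_chain_jumps: "finite (chain_jumps \<theta> \<inter> {0<..t})"
proof (cases "0 \<le> t")
  case True
  define P where "P c d = finite (chain_jumps \<theta> \<inter> {c..d} \<inter> {0<..t})" for c d
  have "P 0 t"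
  proof (rule Bolzano[OF True])
    fix c d e assume "P c d" "P d e" "c \<le> d" "d \<le> e"
    moreover have "chain_jumps \<theta> \<inter> {c..e} \<inter> {0<..t} \<subseteq>
        (chain_jumps \<theta> \<inter> {c..d} \<inter> {0<..t}) \<union> (chain_jumps \<theta> \<inter> {d..e} \<inter> {0<..t})" by auto
    ultimately show "P c e" unfolding P_def by (meson finite_Un finite_subset)
  next
    fix x assume x: "0 \<le> x" "x \<le> t"
    obtain r where r: "r > x" "\<And>u. x \<le> u \<Longrightarrow> u < r \<Longrightarrow> \<theta> u = \<theta> x" using step_right[OF x(1)] by blast
    have R: "chain_jumps \<theta> \<inter> {x<..<r} = {}"
    proof (rule no_chain_jumps_const[OF _ x(1)])
      fix u assume "u \<in> {x<..<r}"
      then show "\<theta> u = \<theta> x" by (intro r(2)) auto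
    qed
    obtain r' where r': "r' < x" "chain_jumps \<theta> \<inter> {r'<..<x} \<inter> {0<..} = {}"
    proof (cases "0 < x")
      case True
      from step_left[OF True] obtain r' where r': "r' < x" "0 \<le> r'" "\<And>u. r' < u \<Longrightarrow> u < x \<Longrightarrow> \<theta> u = left_state \<theta> x" by blast
      have "chain_jumps \<theta> \<inter> {r'<..<x} = {}"
      proof (rule no_chain_jumps_const[OF _ r'(2)])
        fix u assume "u \<in> {r'<..<x}"
        then show "\<theta> u = left_state \<theta> x" by (intro r'(3)) auto
      qed
      then show ?thesis using r'(1) by (intro that[of r']) auto
    next
      case False
      then show ?thesis using x by (intro that[of "x - 1"]) auto
    qed
    show "\<exists>d>0. \<forall>c e. c \<le> x \<and> x \<le> e \<and> e - c < d \<longrightarrow> P c e"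
    proof (intro exI[of _ "min (r - x) (x - r')"] conjI allI impI)
      fix c e assume ce: "c \<le> x \<and> x \<le> e \<and> e - c < min (r - x) (x - r')"
      have "chain_jumps \<theta> \<inter> {c..e} \<inter> {0<..t} \<subseteq> {x}"
      proof
        fix s assume s: "s \<in> chain_jumps \<theta> \<inter> {c..e} \<inter> {0<..t}"
        then show "s \<in> {x}" using R r'(2) ce by (cases s x rule: linorder_cases) auto
      qed
      then show "P c e" unfolding P_def by (rule finite_subset) simp
    qed (use r(1) r'(1) in auto)
  qed
  moreover have "chain_jumps \<theta> \<inter> {0..t} \<inter> {0<..t} = chain_jumps \<theta> \<inter> {0<..t}" by auto
  ultimately show ?thesis by (simp add: P_def)
qed (simp add: not_le)

lemma measurable_state: "{s \<in> {0..}. \<theta> s = j} \<in> sets borel"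
proof -
  let ?f = "\<lambda>s. of_bool (\<theta> s = j) :: real"
  have "(\<lambda>t. if 0 \<le> t then ?f t else 0) \<in> borel_measurable borel"
  proof (rule borel_measurable_right_continuous)
    fix t :: real assume "0 \<le> t"
    then have "\<forall>\<^sub>F u in at_right t. \<theta> u = \<theta> t" using step unfolding step_path_def by blast
    then have "\<forall>\<^sub>F u in at_right t. ?f u = ?f t" by eventually_elim simp
    then show "(?f \<longlongrightarrow> ?f t) (at_right t)" by (rule tendsto_eventually)
  qed
  then have "(\<lambda>t. if 0 \<le> t then ?f t else 0) -` {1} \<inter> space borel \<in> sets borel" by (rule measurable_sets) simp
  moreover have "(\<lambda>t. if 0 \<le> t then ?f t else 0) -` {1} \<inter> space borel = {s \<in> {0..}. \<theta> s = j}" by (auto split: if_splits)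
  ultimately show ?thesis by simp
qed

lemma occ_measurable: "{s \<in> {a<..b}. 0 \<le> s \<and> \<theta> s = j} \<in> sets borel" "{s \<in> {0..b}. \<theta> s = j} \<in> sets borel"
proof -
  have "{s \<in> {a<..b}. 0 \<le> s \<and> \<theta> s = j} = {s \<in> {0..}. \<theta> s = j} \<inter> {a<..b}"
    "{s \<in> {0..b}. \<theta> s = j} = {s \<in> {0..}. \<theta> s = j} \<inter> {0..b}" by auto
  then show "{s \<in> {a<..b}. 0 \<le> s \<and> \<theta> s = j} \<in> sets borel" "{s \<in> {0..b}. \<theta> s = j} \<in> sets borel"
    using measurable_state by auto
qed

lemma occupation_split:
  assumes "0 \<le> s" "s \<le> t"
  shows "occupation \<theta> j t = occupation \<theta> j s + measure lborel {u \<in> {s<..t}. 0 \<le> u \<and> \<theta> u = j}"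
proof -
  have "{u \<in> {0..t}. \<theta> u = j} = {u \<in> {0..s}. \<theta> u = j} \<union> {u \<in> {s<..t}. 0 \<le> u \<and> \<theta> u = j}" using assms by auto
  moreover have "measure lborel ({u \<in> {0..s}. \<theta> u = j} \<union> {u \<in> {s<..t}. 0 \<le> u \<and> \<theta> u = j}) =
      measure lborel {u \<in> {0..s}. \<theta> u = j} + measure lborel {u \<in> {s<..t}. 0 \<le> u \<and> \<theta> u = j}"
  proof (rule measure_Union)
    show "emeasure lborel {u \<in> {0..s}. \<theta> u = j} \<noteq> \<infinity>"
    proof -
      have "emeasure lborel {u \<in> {0..s}. \<theta> u = j} \<le> emeasure lborel {0..s}" by (rule emeasure_mono) auto
      then show ?thesis using assms by (auto simp: top_unique)
    qed
    show "emeasure lborel {u \<in> {s<..t}. 0 \<le> u \<and> \<theta> u = j} \<noteq> \<infinity>"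
    proof -
      have "emeasure lborel {u \<in> {s<..t}. 0 \<le> u \<and> \<theta> u = j} \<le> emeasure lborel {s<..t}" by (rule emeasure_mono) auto
      then show ?thesis using assms by (auto simp: top_unique)
    qed
  qed (use occ_measurable in auto)
  ultimately show ?thesis by (simp add: occupation_def)
qed

lemma occupation_nonneg: "0 \<le> occupation \<theta> j t"
  by (simp add: occupation_def)

lemma occupation_0: "occupation \<theta> j 0 = 0"
proof -
  have "{u \<in> {0..0}. \<theta> u = j} = (if \<theta> 0 = j then {0} else {})" by auto
  then show ?thesis by (simp add: occupation_def)
qed

lemma occupation_mono: "0 \<le> s \<Longrightarrow> s \<le> t \<Longrightarrow> occupation \<theta> j s \<le> occupation \<theta> j t"
  by (subst occupation_split[of s t]) auto

lemma occupation_lipschitz: "0 \<le> s \<Longrightarrow> s \<le> t \<Longrightarrow> occupation \<theta> j t \<le> occupation \<theta> j s + (t - s)"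
proof -
  assume st: "0 \<le> s" "s \<le> t"
  have "measure lborel {u \<in> {s<..t}. 0 \<le> u \<and> \<theta> u = j} \<le> measure lborel {s<..t}"
    using occ_measurable(1)[of s t j] st by (intro measure_mono_fmeasurable) (auto simp: fmeasurable_def)
  then show ?thesis using st by (subst occupation_split[of s t]) auto
qed

lemma occupation_in_state:
  assumes "0 \<le> s" "s \<le> t" "\<And>u. s < u \<Longrightarrow> u < t \<Longrightarrow> \<theta> u = i"
  shows "occupation \<theta> j t = occupation \<theta> j s + (if j = i then t - s else 0)"
proof -
  let ?S = "{u \<in> {s<..t}. 0 \<le> u \<and> \<theta> u = j}"
  \<comment> \<open>At the endpoint \<open>t\<close> the chain may already be in another state; that
    single time has measure zero.\<close>
  have "AE u in lborel. (u \<in> ?S) = (u \<in> (if j = i then {s<..t} else {}))"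
    using AE_lborel_singleton[of t]
  proof eventually_elim
    case (elim u)
    then have "u \<in> {s<..t} \<Longrightarrow> \<theta> u = i" using assms(3)[of u] by auto
    then show ?case using assms(1) by auto
  qed
  then have "measure lborel ?S = measure lborel (if j = i then {s<..t} else {})"
    by (rule measure_eq_AE) (use occ_measurable in auto)
  then show ?thesis using occupation_split[OF assms(1,2), of j] assms by auto
qed

end

lemma jump_eqI: "(f \<longlongrightarrow> l) (at_left s) \<Longrightarrow> jump f s = f s - l" for f :: "real \<Rightarrow> real"
  unfolding jump_def by (subst tendsto_Lim) simp_all

text \<open>One fixed realization of the sources. The statements of this context are deterministic
  and hold on every path; almost sure exclusions come later.\<close>

locale sources = steps \<theta> for \<theta> :: "real \<Rightarrow> 'i::finite" +
  fixes Y :: "'i \<Rightarrow> 'i \<Rightarrow> real \<Rightarrow> real" and e :: "'i \<Rightarrow> ereal" and U :: "nat \<Rightarrow> 'i \<Rightarrow> 'i \<Rightarrow> real"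
  assumes Y_cadlag: "\<And>j k. cadlag (Y j k)" and Y_0: "\<And>j k. Y j k 0 = 0" and e_pos: "\<And>j. 0 < e j"
begin

definition V :: "real \<Rightarrow> real" where
  "V s = U (card (chain_jumps \<theta> \<inter> {0<..<s})) (left_state \<theta> s) (\<theta> s)"

text \<open>The ordinate without killing, defined at all times; it agrees with
  \<open>ordinate z\<close> while the path is alive.\<close>

definition \<xi> :: "real \<Rightarrow> real" where
  "\<xi> t = (\<Sum>j\<in>UNIV. \<Sum>k\<in>UNIV. Y j k (occupation \<theta> j t)) + (\<Sum>s\<in>chain_jumps \<theta> \<inter> {0<..t}. V s)"

abbreviation z :: "'i path" where
  "z \<equiv> build_path \<theta> Y e U"

lemma z_eq: "z t = (if \<forall>j. ereal (occupation \<theta> j t) < e j then Some (\<xi> t, \<theta> t) else None)"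
  by (simp add: build_path_def \<xi>_def V_def)

lemma ordinate_z: "z t \<noteq> None \<Longrightarrow> ordinate z t = \<xi> t"
  by (auto simp: ordinate_def z_eq split: if_splits)

text \<open>During a sojourn in \<open>i\<close> only the clock of \<open>i\<close> runs. The chain
  is prescribed on the open interval alone, so a special jump can still occur at its right end, and
  only there.\<close>

lemma \<xi>_increment:
  assumes st: "0 \<le> s" "s \<le> t" and c: "\<And>u. s < u \<Longrightarrow> u < t \<Longrightarrow> \<theta> u = i"
  shows "\<xi> t = \<xi> s + (\<Sum>k\<in>UNIV. Y i k (occupation \<theta> i s + (t - s)) - Y i k (occupation \<theta> i s)) +
     (if s < t \<and> t \<in> chain_jumps \<theta> then V t else 0)"
proof -
  have occ: "occupation \<theta> j t = occupation \<theta> j s + (if j = i then t - s else 0)" for j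
    by (rule occupation_in_state[OF st c])
  have "(\<Sum>j\<in>UNIV. \<Sum>k\<in>UNIV. Y j k (occupation \<theta> j t)) - (\<Sum>j\<in>UNIV. \<Sum>k\<in>UNIV. Y j k (occupation \<theta> j s)) =
      (\<Sum>j\<in>UNIV. if j = i then (\<Sum>k\<in>UNIV. Y i k (occupation \<theta> i s + (t - s)) - Y i k (occupation \<theta> i s)) else 0)"
    unfolding sum_subtractf[symmetric] by (intro sum.cong) (auto simp: occ)
  then have 1: "(\<Sum>j\<in>UNIV. \<Sum>k\<in>UNIV. Y j k (occupation \<theta> j t)) = (\<Sum>j\<in>UNIV. \<Sum>k\<in>UNIV. Y j k (occupation \<theta> j s)) +
      (\<Sum>k\<in>UNIV. Y i k (occupation \<theta> i s + (t - s)) - Y i k (occupation \<theta> i s))"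
    by (simp add: algebra_simps)
  have E: "chain_jumps \<theta> \<inter> {s<..<t} = {}" using no_chain_jumps_const[of s t i] c st by simp
  have "chain_jumps \<theta> \<inter> {0<..t} = (chain_jumps \<theta> \<inter> {0<..s}) \<union> (if s < t \<and> t \<in> chain_jumps \<theta> then {t} else {})"
  proof (intro equalityI subsetI)
    fix u assume u: "u \<in> chain_jumps \<theta> \<inter> {0<..t}"
    then have "u \<notin> {s<..<t}" using E by blast
    with u show "u \<in> (chain_jumps \<theta> \<inter> {0<..s}) \<union> (if s < t \<and> t \<in> chain_jumps \<theta> then {t} else {})" by auto
  qed (use st in \<open>auto split: if_splits\<close>)
  moreover have "(\<Sum>u\<in>chain_jumps \<theta> \<inter> {0<..s} \<union> (if s < t \<and> t \<in> chain_jumps \<theta> then {t} else {}). V u) =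
      (\<Sum>u\<in>chain_jumps \<theta> \<inter> {0<..s}. V u) + (if s < t \<and> t \<in> chain_jumps \<theta> then V t else 0)"
    using finite_chain_jumps[of s] by (subst sum.union_disjoint) auto
  ultimately have "(\<Sum>u\<in>chain_jumps \<theta> \<inter> {0<..t}. V u) = (\<Sum>u\<in>chain_jumps \<theta> \<inter> {0<..s}. V u) +
      (if s < t \<and> t \<in> chain_jumps \<theta> then V t else 0)" by simp
  with 1 show ?thesis by (simp add: \<xi>_def)
qed

lemma Y_right: "0 \<le> t \<Longrightarrow> (Y j k \<longlongrightarrow> Y j k t) (at_right t)"
  using Y_cadlag by (simp add: cadlag_def)

lemma Y_left: "0 < t \<Longrightarrow> (Y j k \<longlongrightarrow> Y j k t - jump (Y j k) t) (at_left t)"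
proof -
  assume "0 < t"
  then obtain l where l: "(Y j k \<longlongrightarrow> l) (at_left t)" using Y_cadlag[of j k] unfolding cadlag_def by blast
  then show ?thesis using jump_eqI[OF l] by simp
qed

lemma \<xi>_right: "0 \<le> t \<Longrightarrow> (\<xi> \<longlongrightarrow> \<xi> t) (at_right t)"
proof -
  assume t: "0 \<le> t"
  obtain r where r: "r > t" "\<And>u. t \<le> u \<Longrightarrow> u < r \<Longrightarrow> \<theta> u = \<theta> t" using step_right[OF t] by blast
  let ?o = "occupation \<theta> (\<theta> t) t"
  have nj: "u \<notin> chain_jumps \<theta>" if "t < u" "u < r" for u
  proof -
    have "chain_jumps \<theta> \<inter> {t<..<r} = {}"
    proof (rule no_chain_jumps_const[OF _ t])
      fix v assume "v \<in> {t<..<r}"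
      then show "\<theta> v = \<theta> t" by (intro r(2)) auto
    qed
    with that show ?thesis by auto
  qed
  have eq: "\<xi> u = \<xi> t + (\<Sum>k\<in>UNIV. Y (\<theta> t) k (?o + (u - t)) - Y (\<theta> t) k ?o)" if "t < u" "u < r" for u
  proof -
    have "\<theta> v = \<theta> t" if "t < v" "v < u" for v by (rule r(2)) (use that \<open>u < r\<close> in auto)
    then show ?thesis using \<xi>_increment[OF t, of u "\<theta> t"] nj[OF that] that(1) by simp
  qed
  have "filterlim (\<lambda>u. ?o + (u - t)) (at_right ?o) (at_right t)"
    unfolding filterlim_at
  proof
    show "\<forall>\<^sub>F u in at_right t. ?o + (u - t) \<in> {?o<..} \<and> ?o + (u - t) \<noteq> ?o"
      using eventually_at_right_less[of t] by eventually_elim auto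
  qed (auto intro!: tendsto_eq_intros)
  then have "((\<lambda>u. Y (\<theta> t) k (?o + (u - t))) \<longlongrightarrow> Y (\<theta> t) k ?o) (at_right t)" for k
    by (rule filterlim_compose[OF Y_right[OF occupation_nonneg]])
  then have "((\<lambda>u. \<xi> t + (\<Sum>k\<in>UNIV. Y (\<theta> t) k (?o + (u - t)) - Y (\<theta> t) k ?o)) \<longlongrightarrow>
      \<xi> t + (\<Sum>k\<in>UNIV. Y (\<theta> t) k ?o - Y (\<theta> t) k ?o)) (at_right t)"
    by (intro tendsto_intros)
  moreover have "\<forall>\<^sub>F u in at_right t. \<xi> t + (\<Sum>k\<in>UNIV. Y (\<theta> t) k (?o + (u - t)) - Y (\<theta> t) k ?o) = \<xi> u"
    unfolding eventually_at_right_field using r(1) eq by (intro exI[of _ r]) auto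
  ultimately show ?thesis by (simp add: Lim_transform_eventually)
qed

text \<open>The left state counts: at a transition the Levy processes that may jump are those of the
  state being left. The formula admits special and Levy jumps at the same time; their coincidence is
  excluded almost surely later.\<close>

lemma \<xi>_left:
  assumes t: "0 < t"
  defines "l \<equiv> left_state \<theta> t"
  shows "0 < occupation \<theta> l t"
    and "(\<xi> \<longlongrightarrow> \<xi> t - ((if t \<in> chain_jumps \<theta> then V t else 0) + (\<Sum>k\<in>UNIV. jump (Y l k) (occupation \<theta> l t)))) (at_left t)"
proof -
  from step_left[OF t] obtain r where r: "r < t" "0 \<le> r" "\<And>u. r < u \<Longrightarrow> u < t \<Longrightarrow> \<theta> u = l" unfolding l_def by blast
  let ?o = "occupation \<theta> l t"
  have occ: "occupation \<theta> l u = ?o - (t - u)" if "r < u" "u < t" for u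
  proof -
    have "\<theta> v = l" if "u < v" "v < t" for v by (rule r(3)) (use that \<open>r < u\<close> in auto)
    then show ?thesis using occupation_in_state[of u t l l] r(2) that by simp
  qed
  show o: "0 < ?o"
    using occ[of "(r + t) / 2"] occupation_nonneg[of l "(r + t) / 2"] r(1) by (simp add: field_simps)
  have eq: "\<xi> u = \<xi> t - ((if t \<in> chain_jumps \<theta> then V t else 0) + (\<Sum>k\<in>UNIV. Y l k ?o - Y l k (?o - (t - u))))"
    if "r < u" "u < t" for u
  proof -
    have "\<theta> v = l" if "u < v" "v < t" for v by (rule r(3)) (use that \<open>r < u\<close> in auto)
    then show ?thesis using \<xi>_increment[of u t l] r(2) occ[OF that] that by simp
  qed
  have "filterlim (\<lambda>u. ?o - (t - u)) (at_left ?o) (at_left t)"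
    unfolding filterlim_at
  proof
    show "\<forall>\<^sub>F u in at_left t. ?o - (t - u) \<in> {..<?o} \<and> ?o - (t - u) \<noteq> ?o"
      unfolding eventually_at_left_field by (intro exI[of _ "t - 1"]) auto
  qed (auto intro!: tendsto_eq_intros)
  then have "((\<lambda>u. Y l k (?o - (t - u))) \<longlongrightarrow> Y l k ?o - jump (Y l k) ?o) (at_left t)" for k
    by (rule filterlim_compose[OF Y_left[OF o]])
  then have "((\<lambda>u. \<xi> t - ((if t \<in> chain_jumps \<theta> then V t else 0) + (\<Sum>k\<in>UNIV. Y l k ?o - Y l k (?o - (t - u))))) \<longlongrightarrow>
      \<xi> t - ((if t \<in> chain_jumps \<theta> then V t else 0) + (\<Sum>k\<in>UNIV. Y l k ?o - (Y l k ?o - jump (Y l k) ?o)))) (at_left t)"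
    by (intro tendsto_intros)
  moreover have "\<forall>\<^sub>F u in at_left t. \<xi> t - ((if t \<in> chain_jumps \<theta> then V t else 0) + (\<Sum>k\<in>UNIV. Y l k ?o - Y l k (?o - (t - u)))) = \<xi> u"
    unfolding eventually_at_left_field using r(1) eq by (intro exI[of _ r]) auto
  ultimately show "(\<xi> \<longlongrightarrow> \<xi> t - ((if t \<in> chain_jumps \<theta> then V t else 0) + (\<Sum>k\<in>UNIV. jump (Y l k) ?o))) (at_left t)"
    by (simp add: Lim_transform_eventually)
qed

lemma alive_z_iff: "z t \<noteq> None \<longleftrightarrow> (\<forall>j. ereal (occupation \<theta> j t) < e j)"
  by (simp add: z_eq)

lemma alive_z_mono: "0 \<le> s \<Longrightarrow> s \<le> t \<Longrightarrow> z t \<noteq> None \<Longrightarrow> z s \<noteq> None"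
  unfolding alive_z_iff by (meson ereal_less_eq(3) le_less_trans occupation_mono)

lemma z_0: "z 0 = Some (0, \<theta> 0)"
  using e_pos by (simp add: z_eq occupation_0 \<xi>_def Y_0 zero_ereal_def[symmetric])

lemma ordinate_left: "0 < t \<Longrightarrow> z t \<noteq> None \<Longrightarrow> (\<xi> \<longlongrightarrow> m) (at_left t) \<Longrightarrow> (ordinate z \<longlongrightarrow> m) (at_left t)"
proof -
  assume t: "0 < t" "z t \<noteq> None" and m: "(\<xi> \<longlongrightarrow> m) (at_left t)"
  have "\<xi> u = ordinate z u" if "0 < u" "u < t" for u
    using ordinate_z[of u] alive_z_mono[of u t] that t by simp
  then have "\<forall>\<^sub>F u in at_left t. \<xi> u = ordinate z u"
    unfolding eventually_at_left_field using t by (intro exI[of _ 0]) simp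
  with m show ?thesis by (rule Lim_transform_eventually)
qed

lemma regular_z: "regular_path z"
  unfolding regular_path_def
proof (intro conjI allI impI)
  show "z 0 \<noteq> None" by (simp add: z_0)
next
  fix t :: real assume t: "0 \<le> t" "z t \<noteq> None"
  then show "\<forall>s\<in>{0..t}. z s \<noteq> None" using alive_z_mono[of _ t] by auto
  have "\<forall>\<^sub>F u in at_right t. ereal (occupation \<theta> j u) < e j" for j
  proof -
    have "ereal (occupation \<theta> j t) < e j" using t alive_z_iff by blast
    then obtain q where q: "ereal (occupation \<theta> j t) < ereal q" "ereal q < e j" using ereal_dense2 by blast
    show ?thesis unfolding eventually_at_right_field
    proof (intro exI[of _ "t + (q - occupation \<theta> j t)"] conjI allI impI)
      fix u assume u: "t < u" "u < t + (q - occupation \<theta> j t)"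
      \<comment> \<open>Occupation times grow at most at unit speed, so a killing time not yet
        reached stays ahead for a while.\<close>
      then have "occupation \<theta> j u < q" using occupation_lipschitz[of t u j] t by simp
      then show "ereal (occupation \<theta> j u) < e j" using q(2) by (metis ereal_less_eq(3) le_less_trans less_imp_le)
    qed (use q in simp)
  qed
  then have ev: "\<forall>\<^sub>F u in at_right t. z u \<noteq> None" unfolding alive_z_iff by (rule eventually_all_finite)
  then show "\<forall>\<^sub>F u in at_right t. z u \<noteq> None" .
  from ev have "\<forall>\<^sub>F u in at_right t. \<xi> u = ordinate z u" by eventually_elim (simp add: ordinate_z)
  with \<xi>_right[OF t(1)] show "(ordinate z \<longlongrightarrow> ordinate z t) (at_right t)"
    unfolding ordinate_z[OF t(2)] by (rule Lim_transform_eventually)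
next
  fix t :: real assume t: "0 < t" "z t \<noteq> None"
  show "\<exists>l. (ordinate z \<longlongrightarrow> l) (at_left t)"
    using ordinate_left[OF t \<xi>_left(2)[OF t(1)]] by blast
qed

end

section \<open>Levy processes on a dyadic grid\<close>

text \<open>Lying in all \<open>D n\<close> from some \<open>N\<close> on is null, as it implies
  lying in later \<open>D n\<close> of arbitrarily small probability. This is how jumps are
  excluded: a jump would put \<open>w\<close> into \<open>D n\<close> for all large
  \<open>n\<close>.\<close>

lemma (in prob_space) AE_not_eventually_mem:
  assumes D: "\<And>n. D n \<in> events" and small: "\<And>c N. 0 < c \<Longrightarrow> \<exists>n\<ge>N. prob (D n) \<le> c"
  shows "AE w in M. \<not> (\<forall>\<^sub>F n in sequentially. w \<in> D n)"
proof -
  let ?L = "\<lambda>N. (\<Inter>n\<in>{N..}. D n)"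
  have L: "?L N \<in> events" for N using D by (intro sets.countable_INT') auto
  have "prob (?L N) \<le> c" if c: "0 < c" for N c
  proof -
    obtain n where n: "N \<le> n" "prob (D n) \<le> c" using small[OF c, of N] by blast
    have "prob (?L N) \<le> prob (D n)" using n(1) D by (intro finite_measure_mono) auto
    with n(2) show ?thesis by simp
  qed
  then have "prob (?L N) = 0" for N
    by (meson dense_ge antisym measure_nonneg)
  then have "?L N \<in> null_sets M" for N using L by (simp add: null_sets_def emeasure_eq_measure)
  then have "AE w in M. w \<notin> ?L N" for N by (rule AE_not_in)
  then have "AE w in M. \<forall>N. w \<notin> ?L N" unfolding AE_all_countable by blast
  then show ?thesis by eventually_elim (auto simp: eventually_sequentially)
qed

text \<open>Reverse Fatou for sets, by which jumps are produced: a lower bound uniform in the mesh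
  survives for the event that infinitely many meshes show the pattern.\<close>

lemma (in prob_space) prob_frequently_mem_ge:
  fixes F :: "nat \<Rightarrow> 'a set"
  assumes F: "\<And>n. F n \<in> events" and ge: "\<And>n. N \<le> n \<Longrightarrow> c \<le> prob (F n)"
  shows "c \<le> prob (\<Inter>k. \<Union>n\<in>{k..}. F n)"
proof (rule LIMSEQ_le_const)
  show "(\<lambda>k. prob (\<Union>n\<in>{k..}. F n)) \<longlonglongrightarrow> prob (\<Inter>k. \<Union>n\<in>{k..}. F n)"
  proof (rule finite_Lim_measure_decseq)
    show "decseq (\<lambda>k. \<Union>n\<in>{k..}. F n)" unfolding decseq_def by (intro allI impI UN_mono) auto
  qed (use F in auto)
  show "\<exists>K. \<forall>k\<ge>K. c \<le> prob (\<Union>n\<in>{k..}. F n)"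
  proof (intro exI[of _ N] allI impI)
    fix k assume "N \<le> k"
    then have "c \<le> prob (F k)" by (rule ge)
    also have "\<dots> \<le> prob (\<Union>n\<in>{k..}. F n)" using F by (intro finite_measure_mono) auto
    finally show "c \<le> prob (\<Union>n\<in>{k..}. F n)" .
  qed
qed

lemma disjoint_family_on_natI:
  fixes F :: "nat \<Rightarrow> 'a set"
  assumes "\<And>m m' w. m < m' \<Longrightarrow> w \<in> F m \<Longrightarrow> w \<in> F m' \<Longrightarrow> False"
  shows "disjoint_family_on F S"
  unfolding disjoint_family_on_def
proof (intro ballI impI)
  fix m m' :: nat assume "m \<noteq> m'"
  then consider "m < m'" | "m' < m" by linarith
  then show "F m \<inter> F m' = {}" using assms by cases blast+
qed

text \<open>Cells are open on the left and closed on the right, so the increment over the cell of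
  \<open>s\<close> contains a jump at \<open>s\<close> even if \<open>s\<close> is a grid
  point.\<close>

definition grid_cell :: "nat \<Rightarrow> real \<Rightarrow> nat" where
  "grid_cell n s = nat (\<lceil>s * 2 ^ n\<rceil> - 1)"

lemma grid_cell:
  assumes "0 < s"
  shows "real (grid_cell n s) / 2 ^ n < s" "s \<le> real (Suc (grid_cell n s)) / 2 ^ n"
    and "s \<le> real T \<Longrightarrow> grid_cell n s < T * 2 ^ n"
proof -
  have p: "0 < s * 2 ^ n" using assms by simp
  then have "0 < \<lceil>s * 2 ^ n\<rceil>" by simp
  then have c: "real (grid_cell n s) = of_int \<lceil>s * 2 ^ n\<rceil> - 1" by (simp add: grid_cell_def)
  show 1: "real (grid_cell n s) / 2 ^ n < s" unfolding c using ceiling_correct[of "s * 2 ^ n"] by (simp add: divide_less_eq)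
  show "s \<le> real (Suc (grid_cell n s)) / 2 ^ n" using c ceiling_correct[of "s * 2 ^ n"] by (simp add: le_divide_eq)
  assume "s \<le> real T"
  with 1 have "real (grid_cell n s) / 2 ^ n < real T" by simp
  then have "real (grid_cell n s) < real (T * 2 ^ n)" by (simp add: divide_less_eq)
  then show "grid_cell n s < T * 2 ^ n" by (simp only: of_nat_less_iff)
qed

lemma cadlag_left:
  assumes "cadlag y" "0 < s" "0 < \<eta>"
  shows "\<exists>r>0. \<forall>u. s - r < u \<and> u < s \<longrightarrow> \<bar>y u - (y s - jump y s)\<bar> < \<eta>"
proof -
  obtain l where l: "(y \<longlongrightarrow> l) (at_left s)" using assms(1,2) by (auto simp: cadlag_def)
  then have "jump y s = y s - l" by (simp add: jump_def tendsto_Lim)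
  moreover obtain r where "r < s" "\<And>u. r < u \<Longrightarrow> u < s \<Longrightarrow> dist (y u) l < \<eta>"
    using tendstoD[OF l assms(3)] unfolding eventually_at_left_field by blast
  ultimately show ?thesis by (intro exI[of _ "s - r"]) (auto simp: dist_real_def)
qed

lemma cadlag_right:
  assumes "cadlag y" "0 \<le> s" "0 < \<eta>"
  shows "\<exists>r>0. \<forall>u. s \<le> u \<and> u < s + r \<longrightarrow> \<bar>y u - y s\<bar> < \<eta>"
proof -
  have lim: "(y \<longlongrightarrow> y s) (at_right s)" using assms by (simp add: cadlag_def)
  obtain r where r: "s < r" "\<And>u. s < u \<Longrightarrow> u < r \<Longrightarrow> dist (y u) (y s) < \<eta>"
    using tendstoD[OF lim assms(3)] unfolding eventually_at_right_field by blast
  have "\<bar>y u - y s\<bar> < \<eta>" if "s \<le> u" "u < r" for u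
    using r(2)[of u] that assms(3) by (cases "u = s") (auto simp: dist_real_def)
  then show ?thesis using r(1) by (intro exI[of _ "r - s"]) auto
qed

text \<open>The left end of the cell approaches \<open>s\<close> strictly from below, where the path
  tends to its left limit; the right end approaches from \<open>s\<close> upwards, where
  right-continuity applies.\<close>

lemma eventually_grid_increment:
  assumes y: "cadlag y" and s: "0 < s" and \<eta>: "0 < \<eta>"
  shows "\<forall>\<^sub>F n in sequentially.
    \<bar>y (real (Suc (grid_cell n s)) / 2 ^ n) - y (real (grid_cell n s) / 2 ^ n) - jump y s\<bar> < \<eta>"
proof -
  obtain r where r: "0 < r" "\<And>u. s - r < u \<and> u < s \<Longrightarrow> \<bar>y u - (y s - jump y s)\<bar> < \<eta> / 2"
    using cadlag_left[OF y s, of "\<eta> / 2"] \<eta> by auto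
  obtain r' where r': "0 < r'" "\<And>u. s \<le> u \<and> u < s + r' \<Longrightarrow> \<bar>y u - y s\<bar> < \<eta> / 2"
    using cadlag_right[OF y, of s "\<eta> / 2"] s \<eta> by auto
  obtain N where N: "(1 / 2) ^ N < min r r'" using real_arch_pow_inv[of "min r r'" "1 / 2"] r r' by auto
  show ?thesis unfolding eventually_sequentially
  proof (intro exI[of _ N] allI impI)
    fix n assume "N \<le> n"
    then have "(1 / 2 :: real) ^ n \<le> (1 / 2) ^ N" by (intro power_decreasing) auto
    then have n: "1 / 2 ^ n < min r r'" using N by (simp add: power_one_over)
    have e: "real (Suc (grid_cell n s)) / 2 ^ n = real (grid_cell n s) / 2 ^ n + 1 / 2 ^ n" by (simp add: add_divide_distrib)
    have "s - r < real (grid_cell n s) / 2 ^ n \<and> real (grid_cell n s) / 2 ^ n < s" using grid_cell[OF s, of n] n e by simp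
    from r(2)[OF this] have 1: "\<bar>y (real (grid_cell n s) / 2 ^ n) - (y s - jump y s)\<bar> < \<eta> / 2" .
    have "s \<le> real (Suc (grid_cell n s)) / 2 ^ n \<and> real (Suc (grid_cell n s)) / 2 ^ n < s + r'" using grid_cell[OF s, of n] n e by simp
    from r'(2)[OF this] have 2: "\<bar>y (real (Suc (grid_cell n s)) / 2 ^ n) - y s\<bar> < \<eta> / 2" .
    show "\<bar>y (real (Suc (grid_cell n s)) / 2 ^ n) - y (real (grid_cell n s) / 2 ^ n) - jump y s\<bar> < \<eta>"
      using 1 2 by linarith
  qed
qed

text \<open>Compactness gives a time \<open>s\<close> at which cells with increments in
  \<open>A\<close> accumulate. An increment of size at least \<open>c\<close> cannot come from one
  side of \<open>s\<close>, where the path is nearly constant, so these cells contain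
  \<open>s\<close> and their increments approach the jump. Closedness keeps the limit in
  \<open>A\<close>.\<close>

lemma jump_from_grid:
  assumes y: "cadlag y" and \<delta>: "0 \<le> \<delta>" and A: "closed A" "\<And>x. x \<in> A \<Longrightarrow> c \<le> \<bar>x\<bar>" and c: "0 < c"
    and grid: "\<And>k. \<exists>n\<ge>k. \<exists>m. real (Suc m) / 2 ^ n \<le> \<delta> \<and> \<bar>y (real m / 2 ^ n)\<bar> \<le> \<epsilon> \<and>
       y (real (Suc m) / 2 ^ n) - y (real m / 2 ^ n) \<in> A"
  shows "\<exists>s. 0 < s \<and> s \<le> \<delta> \<and> jump y s \<in> A \<and> \<bar>y s - jump y s\<bar> \<le> \<epsilon>"
proof -
  define Q where "Q n m \<longleftrightarrow> real (Suc m) / 2 ^ n \<le> \<delta> \<and> \<bar>y (real m / 2 ^ n)\<bar> \<le> \<epsilon> \<and>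
     y (real (Suc m) / 2 ^ n) - y (real m / 2 ^ n) \<in> A" for n m :: nat
  have "\<forall>k. \<exists>n. k \<le> n \<and> (\<exists>m. Q n m)" using grid unfolding Q_def by blast
  from choice[OF this] obtain n where n: "\<And>k. k \<le> n k" "\<forall>k. \<exists>m. Q (n k) m" by blast
  from choice[OF n(2)] obtain m where "\<And>k. Q (n k) (m k)" by blast
  with n(1) have nm: "\<And>k. k \<le> n k" "\<And>k. real (Suc (m k)) / 2 ^ n k \<le> \<delta>"
    "\<And>k. \<bar>y (real (m k) / 2 ^ n k)\<bar> \<le> \<epsilon>" "\<And>k. y (real (Suc (m k)) / 2 ^ n k) - y (real (m k) / 2 ^ n k) \<in> A"
    by (auto simp: Q_def simp del: of_nat_Suc)
  define a where "a k = real (m k) / 2 ^ n k" for k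
  define b where "b k = real (Suc (m k)) / 2 ^ n k" for k
  have b: "b k = a k + 1 / 2 ^ n k" for k by (simp add: a_def b_def add_divide_distrib)
  have ab: "0 \<le> a k" "a k < b k" "b k \<le> \<delta>" "b k \<le> a k + (1 / 2) ^ k" for k
  proof -
    have "(1 / 2 :: real) ^ n k \<le> (1 / 2) ^ k" using nm(1)[of k] by (intro power_decreasing) auto
    then show "b k \<le> a k + (1 / 2) ^ k" by (simp add: b power_one_over)
  qed (use nm(2)[of k] in \<open>auto simp: a_def b_def divide_strict_right_mono\<close>)
  have "\<forall>k. a k \<in> {0..\<delta>}" using ab by (metis atLeastAtMost_iff less_imp_le order_trans)
  then obtain s r where s: "s \<in> {0..\<delta>}" and r: "strict_mono r" "(a \<circ> r) \<longlonglongrightarrow> s"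
    using compact_imp_seq_compact[OF compact_Icc[of 0 \<delta>]] unfolding seq_compact_def by metis
  have close: "\<exists>k. \<bar>a k - s\<bar> < \<rho> \<and> \<bar>b k - s\<bar> < \<rho>" if "0 < \<rho>" for \<rho>
  proof -
    obtain K where K: "(1 / 2 :: real) ^ K < \<rho> / 2" using real_arch_pow_inv[of "\<rho> / 2" "1 / 2"] \<open>0 < \<rho>\<close> by auto
    from LIMSEQ_D[OF r(2), of "\<rho> / 2"] that obtain K' where K': "\<And>k. K' \<le> k \<Longrightarrow> \<bar>a (r k) - s\<bar> < \<rho> / 2" by auto
    let ?k = "r (max K K')"
    have "K \<le> ?k" using strict_mono_imp_increasing[OF r(1), of "max K K'"] by simp
    then have "(1 / 2 :: real) ^ ?k \<le> (1 / 2) ^ K" by (intro power_decreasing) auto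
    then have "b ?k \<le> a ?k + \<rho> / 2" using ab(4)[of ?k] K by linarith
    moreover have "\<bar>a ?k - s\<bar> < \<rho> / 2" using K'[of "max K K'"] by simp
    ultimately have "\<bar>a ?k - s\<bar> < \<rho> \<and> \<bar>b ?k - s\<bar> < \<rho>" using ab(2)[of ?k] by linarith
    then show ?thesis by blast
  qed
  \<comment> \<open>With \<open>\<eta> \<le> c / 2\<close>, two values within \<open>\<eta>\<close>
    of the same one-sided limit differ by less than \<open>c\<close>.\<close>
  have straddle: "\<exists>k. a k < s \<and> s \<le> b k \<and> (0 < s \<longrightarrow> \<bar>y (a k) - (y s - jump y s)\<bar> < \<eta> \<and> \<bar>y (b k) - y s\<bar> < \<eta>)"
    if \<eta>: "0 < \<eta>" "\<eta> \<le> c / 2" for \<eta>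
  proof -
    obtain r1 where r1: "0 < r1" "\<And>u. s \<le> u \<and> u < s + r1 \<Longrightarrow> \<bar>y u - y s\<bar> < \<eta>"
      using cadlag_right[OF y _ \<eta>(1), of s] s by auto
    obtain r2 where r2: "0 < r2" "\<And>u. 0 < s \<Longrightarrow> s - r2 < u \<and> u < s \<Longrightarrow> \<bar>y u - (y s - jump y s)\<bar> < \<eta>"
    proof (cases "0 < s")
      case True
      from cadlag_left[OF y True \<eta>(1)] that show ?thesis by blast
    next
      case False
      then show ?thesis using that[of 1] by simp
    qed
    obtain k where k: "\<bar>a k - s\<bar> < min r1 r2" "\<bar>b k - s\<bar> < min r1 r2" using close[of "min r1 r2"] r1 r2 by auto
    have big: "c \<le> \<bar>y (b k) - y (a k)\<bar>" using A(2) nm(4)[of k] by (simp add: a_def b_def)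
    have as: "a k < s"
    proof (rule ccontr)
      assume "\<not> a k < s"
      then have "\<bar>y (a k) - y s\<bar> < \<eta>" "\<bar>y (b k) - y s\<bar> < \<eta>" using r1(2)[of "a k"] r1(2)[of "b k"] k ab(2)[of k] by auto
      with big \<eta> show False by linarith
    qed
    then have s0: "0 < s" using ab(1)[of k] by linarith
    have "s \<le> b k"
    proof (rule ccontr)
      assume "\<not> s \<le> b k"
      then have "\<bar>y (a k) - (y s - jump y s)\<bar> < \<eta>" "\<bar>y (b k) - (y s - jump y s)\<bar> < \<eta>"
        using r2(2)[of "a k", OF s0] r2(2)[of "b k", OF s0] k as by auto
      with big \<eta> show False by linarith
    qed
    with as r1(2)[of "b k"] r2(2)[of "a k"] k show ?thesis by (intro exI[of _ k]) auto
  qed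
  have s0: "0 < s" using straddle[of "c / 2"] c ab(1) by (meson half_gt_zero le_less_trans order_refl)
  have near: "\<exists>k. \<bar>y (a k) - (y s - jump y s)\<bar> < \<eta> \<and> \<bar>y (b k) - y (a k) - jump y s\<bar> < 2 * \<eta>" if "0 < \<eta>" for \<eta>
  proof -
    have "0 < min \<eta> (c / 2)" "min \<eta> (c / 2) \<le> c / 2" using that c by auto
    from straddle[OF this] s0 obtain k
      where "\<bar>y (a k) - (y s - jump y s)\<bar> < min \<eta> (c / 2)" "\<bar>y (b k) - y s\<bar> < min \<eta> (c / 2)" by blast
    then have "\<bar>y (a k) - (y s - jump y s)\<bar> < \<eta>" "\<bar>y (b k) - y s\<bar> < \<eta>" by (simp_all only: min_less_iff_conj)
    then have "\<bar>y (a k) - (y s - jump y s)\<bar> < \<eta> \<and> \<bar>y (b k) - y (a k) - jump y s\<bar> < 2 * \<eta>" by linarith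
    then show ?thesis by blast
  qed
  have "jump y s \<in> closure A" unfolding closure_approachable
  proof (intro allI impI)
    fix e :: real assume "0 < e"
    then obtain k where "\<bar>y (b k) - y (a k) - jump y s\<bar> < e" using near[of "e / 2"] by auto
    then show "\<exists>z\<in>A. dist z (jump y s) < e" using nm(4)[of k] by (auto simp: a_def b_def dist_real_def)
  qed
  then have "jump y s \<in> A" using A(1) by simp
  moreover have "\<bar>y s - jump y s\<bar> \<le> \<epsilon>"
  proof (rule field_le_epsilon)
    fix e :: real assume "0 < e"
    then obtain k where "\<bar>y (a k) - (y s - jump y s)\<bar> < e" using near[of e] by auto
    then show "\<bar>y s - jump y s\<bar> \<le> \<epsilon> + e" using nm(3)[of k] unfolding a_def[symmetric] by linarith
  qed
  ultimately show ?thesis using s0 s by auto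
qed

lemma measurable_path_component:
  assumes "0 \<le> t" "\<And>t w. 0 \<le> t \<Longrightarrow> w \<in> X \<Longrightarrow> Y t w \<in> space N"
  shows "Y t \<in> measurable (vimage_algebra X (\<lambda>w. \<lambda>t\<in>{0..}. Y t w) (PiM {0..} (\<lambda>_. N))) N"
proof -
  have "(\<lambda>w. \<lambda>t\<in>{0..}. Y t w) \<in> measurable (vimage_algebra X (\<lambda>w. \<lambda>t\<in>{0..}. Y t w) (PiM {0..} (\<lambda>_. N))) (PiM {0..} (\<lambda>_. N))"
    by (rule measurable_vimage_algebra1) (use assms in \<open>auto simp: space_PiM\<close>)
  then have "(\<lambda>w. (\<lambda>t\<in>{0..}. Y t w) t) \<in> measurable (vimage_algebra X (\<lambda>w. \<lambda>t\<in>{0..}. Y t w) (PiM {0..} (\<lambda>_. N))) N"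
    by (rule measurable_compose[OF _ measurable_component_singleton]) (use assms in simp)
  then show ?thesis using assms(1) by simp
qed

section \<open>Increments and jumps of one Levy process\<close>

locale levy = prob_space M for M :: "'w measure" +
  fixes Y :: "real \<Rightarrow> 'w \<Rightarrow> real"
  assumes levy: "levy_process M Y"
begin

abbreviation dY :: "'w \<Rightarrow> real \<Rightarrow> real" where
  "dY w \<equiv> jump (\<lambda>t. Y t w)"

text \<open>The sigma-algebra generated by the path, in the guise of a measure space. Events are
  placed in it and not merely among those of \<open>M\<close>, because independence between sources
  is stated for path events.\<close>

definition PM :: "'w measure" where
  "PM = vimage_algebra (space M) (\<lambda>w. \<lambda>t\<in>{0..}. Y t w) (PiM {0..} (\<lambda>_. borel))"

lemma space_PM [simp]: "space PM = space M"
  by (simp add: PM_def)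

lemma sets_PM: "sets PM = path_events M borel Y"
  by (simp add: PM_def path_events_def)

lemma Y_PM [measurable]: "0 \<le> t \<Longrightarrow> Y t \<in> borel_measurable PM"
  unfolding PM_def by (rule measurable_path_component) auto

lemma Y_M [measurable]: "0 \<le> t \<Longrightarrow> Y t \<in> borel_measurable M"
  using levy by (simp add: levy_process_def)

lemma subalgebra_PM: "subalgebra M PM"
  unfolding PM_def by (rule subalgebra_vimage_algebra, rule measurable_restrict) simp

lemma PM_events: "A \<in> sets PM \<Longrightarrow> A \<in> events"
  using subalgebra_PM by (auto simp: subalgebra_def)

lemma Y_cadlag: "w \<in> space M \<Longrightarrow> cadlag (\<lambda>t. Y t w)" and Y_0: "w \<in> space M \<Longrightarrow> Y 0 w = 0"
  using levy by (auto simp: levy_process_def)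

definition incr :: "nat \<Rightarrow> nat \<Rightarrow> 'w \<Rightarrow> real" where
  "incr n m w = Y (real (Suc m) / 2 ^ n) w - Y (real m / 2 ^ n) w"

lemma incr_PM [measurable]: "incr n m \<in> borel_measurable PM"
  unfolding incr_def by (intro borel_measurable_diff Y_PM) auto

lemma incr_mem_PM: "A \<in> sets borel \<Longrightarrow> {w \<in> space M. incr n m w \<in> A} \<in> sets PM"
proof -
  assume A: "A \<in> sets borel"
  have "{w \<in> space M. incr n m w \<in> A} = incr n m -` A \<inter> space PM" by auto
  then show ?thesis using measurable_sets[OF incr_PM A, of n m] by simp
qed

lemma incr_M [measurable]: "incr n m \<in> borel_measurable M"
  unfolding incr_def by (intro borel_measurable_diff Y_M) auto

lemma indep_incr: "indep_vars (\<lambda>_. borel) (incr n) UNIV"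
proof -
  have "mono (\<lambda>m. real m / 2 ^ n)" by (auto intro!: monoI divide_right_mono)
  then have "indep_vars (\<lambda>_. borel) (\<lambda>m w. Y (real (Suc m) / 2 ^ n) w - Y (real m / 2 ^ n) w) UNIV"
    using levy[unfolded levy_process_def, THEN conjunct2, THEN conjunct2, THEN conjunct2, rule_format, of "\<lambda>m. real m / 2 ^ n"]
    by simp
  then show ?thesis by (simp add: incr_def[abs_def])
qed

definition p :: "nat \<Rightarrow> real set \<Rightarrow> real" where
  "p n A = prob {w \<in> space M. Y (1 / 2 ^ n) w \<in> A}"

lemma prob_incr:
  assumes "A \<in> sets borel"
  shows "prob {w \<in> space M. incr n m w \<in> A} = p n A"
proof -
  have e: "real (Suc m) / 2 ^ n = real m / 2 ^ n + 1 / 2 ^ n" by (simp add: add_divide_distrib)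
  have D: "distr M borel (incr n m) = distr M borel (Y (1 / 2 ^ n))"
    unfolding incr_def[abs_def] e using levy unfolding levy_process_def by simp
  have "prob {w \<in> space M. incr n m w \<in> A} = measure (distr M borel (incr n m)) A"
    using assms by (subst measure_distr) (auto intro!: arg_cong[where f = prob])
  also have "\<dots> = measure (distr M borel (Y (1 / 2 ^ n))) A" unfolding D ..
  also have "\<dots> = p n A" unfolding p_def
    using assms by (subst measure_distr) (auto intro!: arg_cong[where f = prob] Y_M)
  finally show ?thesis .
qed

definition below :: "real \<Rightarrow> nat \<Rightarrow> nat \<Rightarrow> 'w set" where
  "below \<epsilon> n m = {w \<in> space M. \<forall>m'\<le>m. \<bar>Y (real m' / 2 ^ n) w\<bar> \<le> \<epsilon>}"

lemma Y_le_PM: "0 \<le> r \<Longrightarrow> {w \<in> space PM. \<bar>Y r w\<bar> \<le> \<epsilon>} \<in> sets PM"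
  by (intro borel_measurable_le borel_measurable_abs Y_PM borel_measurable_const)

lemma below_PM: "below \<epsilon> n m \<in> sets PM"
proof -
  have "{w \<in> space PM. \<forall>m'\<in>{..m}. \<bar>Y (real m' / 2 ^ n) w\<bar> \<le> \<epsilon>} \<in> sets PM"
    by (intro sets.sets_Collect_finite_All Y_le_PM) simp_all
  then show ?thesis by (simp only: below_def space_PM Ball_def atMost_iff)
qed

lemma Y_sum_incr: "w \<in> space M \<Longrightarrow> Y (real m / 2 ^ n) w = (\<Sum>k<m. incr n k w)"
  by (induction m) (auto simp: Y_0 incr_def)

text \<open>Values at grid points are partial sums of increments, so
  \<open>below \<epsilon> n m\<close> depends on the first \<open>m\<close> increments only and is
  independent of the next one, which has index \<open>m\<close>.\<close>

lemma prob_below_incr: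
  assumes A: "A \<in> sets borel"
  shows "prob (below \<epsilon> n m \<inter> {w \<in> space M. incr n m w \<in> A}) = prob (below \<epsilon> n m) * p n A"
proof -
  let ?R = "\<lambda>I w. restrict (\<lambda>k. incr n k w) I"
  let ?S = "{f \<in> space (PiM {..<m} (\<lambda>_. borel)). \<forall>m'\<in>{..m}. \<bar>\<Sum>k<m'. f k :: real\<bar> \<le> \<epsilon>}"
  let ?T = "{f \<in> space (PiM {m} (\<lambda>_. borel)). f m \<in> A}"
  have iv: "indep_var (PiM {..<m} (\<lambda>_. borel)) (?R {..<m}) (PiM {m} (\<lambda>_. borel)) (?R {m})"
    by (rule indep_var_restrict[OF indep_incr]) auto
  have S: "?S \<in> sets (PiM {..<m} (\<lambda>_. borel))"
    by (intro sets.sets_Collect_finite_All borel_measurable_le borel_measurable_abs borel_measurable_sum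
        borel_measurable_const measurable_component_singleton) auto
  have T: "?T \<in> sets (PiM {m} (\<lambda>_. borel))"
  proof -
    have "(\<lambda>f. f m) \<in> borel_measurable (PiM {m} (\<lambda>_. borel :: real measure))"
      by (rule measurable_component_singleton) simp
    from measurable_sets[OF this A]
    have "(\<lambda>f. f m) -` A \<inter> space (PiM {m} (\<lambda>_. borel)) \<in> sets (PiM {m} (\<lambda>_. borel))" .
    moreover have "?T = (\<lambda>f. f m) -` A \<inter> space (PiM {m} (\<lambda>_. borel))" by auto
    ultimately show ?thesis by simp
  qed
  have 1: "?R {..<m} -` ?S \<inter> space M = below \<epsilon> n m"
  proof -
    have "(\<Sum>k<m'. ?R {..<m} w k) = Y (real m' / 2 ^ n) w" if "w \<in> space M" "m' \<le> m" for w m'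
      using that by (auto simp: Y_sum_incr intro!: sum.cong)
    then have "(\<forall>m'\<in>{..m}. \<bar>\<Sum>k<m'. ?R {..<m} w k\<bar> \<le> \<epsilon>) \<longleftrightarrow> (\<forall>m'\<le>m. \<bar>Y (real m' / 2 ^ n) w\<bar> \<le> \<epsilon>)"
      if "w \<in> space M" for w using that by (metis atMost_iff)
    moreover have "?R {..<m} w \<in> space (PiM {..<m} (\<lambda>_. borel))" for w by (simp add: space_PiM)
    ultimately show ?thesis unfolding below_def by blast
  qed
  have 2: "?R {m} -` ?T \<inter> space M = {w \<in> space M. incr n m w \<in> A}" by (auto simp: space_PiM)
  have 3: "(\<lambda>w. (?R {..<m} w, ?R {m} w)) -` (?S \<times> ?T) \<inter> space M =
      (?R {..<m} -` ?S \<inter> space M) \<inter> (?R {m} -` ?T \<inter> space M)" by auto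
  show ?thesis using indep_varD[OF iv S T] unfolding 3 1 2 prob_incr[OF A] .
qed

text \<open>Restriction to rational times makes it a countable intersection; right-continuity
  extends the bound to all times before \<open>\<delta>\<close> and to left limits.\<close>

definition calm :: "real \<Rightarrow> real \<Rightarrow> 'w set" where
  "calm \<delta> \<epsilon> = {w \<in> space M. \<forall>r\<in>\<rat> \<inter> {0..\<delta>}. \<bar>Y r w\<bar> \<le> \<epsilon>}"

lemma calm_PM: "calm \<delta> \<epsilon> \<in> sets PM"
proof -
  have "{w \<in> space PM. \<forall>q::rat. 0 \<le> real_of_rat q \<and> real_of_rat q \<le> \<delta> \<longrightarrow> \<bar>Y (real_of_rat q) w\<bar> \<le> \<epsilon>} \<in> sets PM"
  proof (intro sets.sets_Collect_countable_All)
    fix q :: rat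
    show "{w \<in> space PM. 0 \<le> real_of_rat q \<and> real_of_rat q \<le> \<delta> \<longrightarrow> \<bar>Y (real_of_rat q) w\<bar> \<le> \<epsilon>} \<in> sets PM"
    proof (cases "0 \<le> real_of_rat q \<and> real_of_rat q \<le> \<delta>")
      case True
      then show ?thesis using Y_le_PM[of "real_of_rat q" \<epsilon>] by simp
    next
      case False
      then have "{w \<in> space PM. 0 \<le> real_of_rat q \<and> real_of_rat q \<le> \<delta> \<longrightarrow> \<bar>Y (real_of_rat q) w\<bar> \<le> \<epsilon>} = space PM" by blast
      then show ?thesis by (simp only: sets.top)
    qed
  qed
  moreover have "calm \<delta> \<epsilon> = {w \<in> space PM. \<forall>q::rat. 0 \<le> real_of_rat q \<and> real_of_rat q \<le> \<delta> \<longrightarrow> \<bar>Y (real_of_rat q) w\<bar> \<le> \<epsilon>}"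
  proof -
    have "(\<forall>r\<in>\<rat> \<inter> {0..\<delta>}. R r) \<longleftrightarrow> (\<forall>q::rat. 0 \<le> real_of_rat q \<and> real_of_rat q \<le> \<delta> \<longrightarrow> R (real_of_rat q))" for R
    proof (intro iffI allI ballI impI)
      fix r assume R: "\<forall>q::rat. 0 \<le> real_of_rat q \<and> real_of_rat q \<le> \<delta> \<longrightarrow> R (real_of_rat q)" and "r \<in> \<rat> \<inter> {0..\<delta>}"
      then have "r \<in> \<rat>" "0 \<le> r" "r \<le> \<delta>" by simp_all
      from this(1) obtain q where "r = real_of_rat q" by (rule Rats_cases)
      then show "R r" using R \<open>0 \<le> r\<close> \<open>r \<le> \<delta>\<close> by blast
    qed simp
    then show ?thesis unfolding calm_def space_PM by (intro Collect_cong conj_cong refl)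
  qed
  ultimately show ?thesis by (simp only:)
qed

lemma calm_antimono: "\<delta> \<le> \<delta>' \<Longrightarrow> calm \<delta>' \<epsilon> \<subseteq> calm \<delta> \<epsilon>"
  by (auto simp: calm_def)

text \<open>The strict inequality \<open>t < \<delta>\<close> leaves room for rational times to the
  right of \<open>t\<close>.\<close>

lemma calmD:
  assumes w: "w \<in> calm \<delta> \<epsilon>" and t: "0 \<le> t" "t < \<delta>"
  shows "\<bar>Y t w\<bar> \<le> \<epsilon>"
proof (rule field_le_epsilon)
  fix e :: real assume e: "0 < e"
  have ws: "w \<in> space M" using w by (simp add: calm_def)
  obtain r where r: "0 < r" "\<And>u. t \<le> u \<and> u < t + r \<Longrightarrow> \<bar>Y u w - Y t w\<bar> < e"
    using cadlag_right[OF Y_cadlag[OF ws] t(1) e] by auto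
  obtain q where q: "q \<in> \<rat>" "t < q" "q < min \<delta> (t + r)" using Rats_dense_in_real[of t "min \<delta> (t + r)"] t r by auto
  then have "\<bar>Y q w\<bar> \<le> \<epsilon>" using w t by (auto simp: calm_def)
  moreover have "\<bar>Y q w - Y t w\<bar> < e" using r(2)[of q] q by auto
  ultimately show "\<bar>Y t w\<bar> \<le> \<epsilon> + e" by linarith
qed

lemma calm_left:
  assumes w: "w \<in> calm \<delta> \<epsilon>" and s: "0 < s" "s \<le> \<delta>"
  shows "\<bar>Y s w - dY w s\<bar> \<le> \<epsilon>"
proof (rule field_le_epsilon)
  fix e :: real assume e: "0 < e"
  have ws: "w \<in> space M" using w by (simp add: calm_def)
  obtain r where r: "0 < r" "\<And>u. s - r < u \<and> u < s \<Longrightarrow> \<bar>Y u w - (Y s w - dY w s)\<bar> < e"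
    using cadlag_left[OF Y_cadlag[OF ws] s(1) e] by auto
  define u where "u = max (s / 2) (s - r / 2)"
  have u: "s - r < u \<and> u < s" "0 \<le> u" "u < \<delta>" using r(1) s by (auto simp: u_def)
  have "\<bar>Y u w\<bar> \<le> \<epsilon>" by (rule calmD[OF w u(2,3)])
  with r(2)[OF u(1)] show "\<bar>Y s w - dY w s\<bar> \<le> \<epsilon> + e" by linarith
qed

text \<open>Every path starts at \<open>0\<close> and is right-continuous, so it is calm on a
  sufficiently short interval.\<close>

lemma calm_tendsto:
  assumes "0 < \<epsilon>"
  shows "(\<lambda>N. prob (calm (1 / 2 ^ N) \<epsilon>)) \<longlonglongrightarrow> 1"
proof -
  have "(\<lambda>N. prob (calm (1 / 2 ^ N) \<epsilon>)) \<longlonglongrightarrow> prob (\<Union>N. calm (1 / 2 ^ N) \<epsilon>)"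
  proof (rule finite_Lim_measure_incseq)
    show "range (\<lambda>N. calm (1 / 2 ^ N) \<epsilon>) \<subseteq> events" using PM_events[OF calm_PM] by auto
    show "incseq (\<lambda>N. calm (1 / 2 ^ N) \<epsilon>)"
      unfolding incseq_def by (intro allI impI calm_antimono divide_left_mono power_increasing) auto
  qed
  also have "(\<Union>N. calm (1 / 2 ^ N) \<epsilon>) = space M"
  proof (intro equalityI subsetI)
    fix w assume w: "w \<in> space M"
    obtain r where r: "0 < r" "\<And>u. 0 \<le> u \<and> u < 0 + r \<Longrightarrow> \<bar>Y u w - Y 0 w\<bar> < \<epsilon>"
      using cadlag_right[OF Y_cadlag[OF w] _ assms, of 0] by auto
    obtain N where N: "(1 / 2) ^ N < r" using real_arch_pow_inv[of r "1 / 2"] r by auto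
    have "w \<in> calm (1 / 2 ^ N) \<epsilon>" using w r(2) N by (auto simp: calm_def Y_0 power_one_over less_imp_le)
    then show "w \<in> (\<Union>N. calm (1 / 2 ^ N) \<epsilon>)" by blast
  qed (auto simp: calm_def)
  finally show ?thesis by (simp add: prob_space)
qed

lemma p_tendsto_0:
  assumes "0 < \<eta>"
  shows "(\<lambda>n. p n {x. \<eta> < \<bar>x\<bar>}) \<longlonglongrightarrow> 0"
proof (rule tendsto_sandwich[OF _ _ tendsto_const])
  have lim: "(\<lambda>N. 1 - prob (calm (1 / 2 ^ N) \<eta>)) \<longlonglongrightarrow> 1 - 1" by (intro tendsto_intros calm_tendsto assms)
  then show "(\<lambda>N. 1 - prob (calm (1 / 2 ^ N) \<eta>)) \<longlonglongrightarrow> 0" by simp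
  show "\<forall>\<^sub>F n in sequentially. p n {x. \<eta> < \<bar>x\<bar>} \<le> 1 - prob (calm (1 / 2 ^ n) \<eta>)"
  proof (rule always_eventually, rule allI)
    fix n
    have "p n {x. \<eta> < \<bar>x\<bar>} \<le> prob (space M - calm (1 / 2 ^ n) \<eta>)"
      unfolding p_def
    proof (rule finite_measure_mono)
      have rat: "(1 / 2 ^ n :: real) \<in> \<rat>" by (intro Rats_divide Rats_power) simp_all
      show "{w \<in> space M. Y (1 / 2 ^ n) w \<in> {x. \<eta> < \<bar>x\<bar>}} \<subseteq> space M - calm (1 / 2 ^ n) \<eta>"
      proof (intro subsetI)
        fix w assume w: "w \<in> {w \<in> space M. Y (1 / 2 ^ n) w \<in> {x. \<eta> < \<bar>x\<bar>}}"
        have "w \<notin> calm (1 / 2 ^ n) \<eta>"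
        proof
          assume "w \<in> calm (1 / 2 ^ n) \<eta>"
          then have "\<bar>Y (1 / 2 ^ n) w\<bar> \<le> \<eta>" using rat unfolding calm_def by simp
          with w show False by simp
        qed
        with w show "w \<in> space M - calm (1 / 2 ^ n) \<eta>" by blast
      qed
    qed (use PM_events[OF calm_PM] in auto)
    also have "\<dots> = 1 - prob (calm (1 / 2 ^ n) \<eta>)" by (rule prob_compl[OF PM_events[OF calm_PM]])
    finally show "p n {x. \<eta> < \<bar>x\<bar>} \<le> 1 - prob (calm (1 / 2 ^ n) \<eta>)" .
  qed
qed (simp add: p_def)

text \<open>
  If \<open>A\<close> keeps a distance more than \<open>2 * \<epsilon>\<close> from \<open>0\<close>, these events are disjoint, since the increment in \<open>A\<close> takes
  the path out of \<open>[-\<epsilon>, \<epsilon>]\<close>; so the probability of the union is a sum, bounded from above and below.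
\<close>

definition hit :: "real \<Rightarrow> real set \<Rightarrow> nat \<Rightarrow> nat \<Rightarrow> 'w set" where
  "hit \<epsilon> A n K = (\<Union>m<K. below \<epsilon> n m \<inter> {w \<in> space M. incr n m w \<in> A})"

lemma hit_PM: "A \<in> sets borel \<Longrightarrow> hit \<epsilon> A n K \<in> sets PM"
  unfolding hit_def by (intro sets.finite_UN ballI sets.Int below_PM incr_mem_PM) auto

text \<open>A calm path is in \<open>[-\<epsilon>, \<epsilon>]\<close> at all grid points before the
  horizon \<open>1 / 2 ^ N\<close>, so each \<open>below\<close> has probability at least
  \<open>1 / 2\<close>. The number \<open>2 ^ (n - N)\<close> counts the grid cells up to that
  horizon.\<close>

lemma prob_hit_ge:
  assumes A: "A \<in> sets borel" "\<And>x. x \<in> A \<Longrightarrow> 2 * \<epsilon> < \<bar>x\<bar>"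
    and \<delta>: "1 / 2 \<le> prob (calm (1 / 2 ^ N) \<epsilon>)" and n: "N \<le> n"
  shows "2 ^ (n - N) * p n A / 2 \<le> prob (hit \<epsilon> A n (2 ^ (n - N)))"
proof -
  let ?K = "2 ^ (n - N) :: nat"
  have ev: "{w \<in> space M. incr n m w \<in> A} \<in> events" for m using A(1) by measurable
  have "prob (hit \<epsilon> A n ?K) = (\<Sum>m<?K. prob (below \<epsilon> n m \<inter> {w \<in> space M. incr n m w \<in> A}))"
    unfolding hit_def
  proof (rule finite_measure_finite_Union)
    show "disjoint_family_on (\<lambda>m. below \<epsilon> n m \<inter> {w \<in> space M. incr n m w \<in> A}) {..<?K}"
    proof -
      have no: False if "w \<in> below \<epsilon> n m'" "w \<in> below \<epsilon> n m" "incr n m w \<in> A" "m < m'" for w m m'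
      proof -
        have "\<bar>Y (real (Suc m) / 2 ^ n) w\<bar> \<le> \<epsilon>" "\<bar>Y (real m / 2 ^ n) w\<bar> \<le> \<epsilon>"
          using that(1,2,4) unfolding below_def by (auto dest: spec[of _ "Suc m"])
        moreover have "2 * \<epsilon> < \<bar>incr n m w\<bar>" by (rule A(2)[OF that(3)])
        ultimately show False unfolding incr_def by linarith
      qed
      show ?thesis
      proof (rule disjoint_family_on_natI)
        fix m m' w assume "m < m'" "w \<in> below \<epsilon> n m \<inter> {w \<in> space M. incr n m w \<in> A}"
          "w \<in> below \<epsilon> n m' \<inter> {w \<in> space M. incr n m' w \<in> A}"
        then show False using no[of w m' m] by blast
      qed
    qed
  qed (use ev PM_events[OF below_PM] in auto)
  also have "\<dots> \<ge> (\<Sum>m<?K. p n A / 2)"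
  proof (rule sum_mono)
    fix m assume m: "m \<in> {..<?K}"
    have "calm (1 / 2 ^ N) \<epsilon> \<subseteq> below \<epsilon> n m"
    proof
      fix w assume w: "w \<in> calm (1 / 2 ^ N) \<epsilon>"
      have "\<bar>Y (real m' / 2 ^ n) w\<bar> \<le> \<epsilon>" if "m' \<le> m" for m'
      proof (rule calmD[OF w])
        have "m' < 2 ^ (n - N)" using m that by simp
        then have "real m' < real (2 ^ (n - N))" by (simp only: of_nat_less_iff)
        then have "real m' < 2 ^ (n - N)" by simp
        also have "(2::real) ^ (n - N) = 2 ^ n / 2 ^ N" using n by (simp add: power_diff)
        finally show "real m' / 2 ^ n < 1 / 2 ^ N" by (simp add: field_simps)
      qed simp
      then show "w \<in> below \<epsilon> n m" using w by (simp add: below_def calm_def)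
    qed
    then have "1 / 2 \<le> prob (below \<epsilon> n m)"
      using \<delta> finite_measure_mono[OF _ PM_events[OF below_PM]] by (meson order_trans)
    then have "1 / 2 * p n A \<le> prob (below \<epsilon> n m) * p n A" by (intro mult_right_mono) (auto simp: p_def)
    then show "p n A / 2 \<le> prob (below \<epsilon> n m \<inter> {w \<in> space M. incr n m w \<in> A})"
      unfolding prob_below_incr[OF A(1)] by simp
  qed
  finally show ?thesis by simp
qed

text \<open>Disjoint events have total probability at most \<open>1\<close>. This bounds
  \<open>2 ^ n * p n {x. \<eta> < \<bar>x\<bar>}\<close>, the expected number of large increments
  per unit of time, uniformly in the mesh.\<close>

lemma p_bound:
  assumes "0 < \<eta>"
  shows "\<exists>B N. \<forall>n\<ge>N. 2 ^ n * p n {x. \<eta> < \<bar>x\<bar>} \<le> B"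
proof -
  have "\<forall>\<^sub>F N in sequentially. 1 / 2 < prob (calm (1 / 2 ^ N) (\<eta> / 2))"
    using order_tendstoD(1)[OF calm_tendsto[of "\<eta> / 2"], of "1 / 2"] assms by simp
  then obtain N where "1 / 2 < prob (calm (1 / 2 ^ N) (\<eta> / 2))" unfolding eventually_sequentially by blast
  then have N: "1 / 2 \<le> prob (calm (1 / 2 ^ N) (\<eta> / 2))" by (rule less_imp_le)
  have "2 ^ n * p n {x. \<eta> < \<bar>x\<bar>} \<le> 2 * 2 ^ N" if "N \<le> n" for n
  proof -
    have "2 ^ (n - N) * p n {x. \<eta> < \<bar>x\<bar>} / 2 \<le> prob (hit (\<eta> / 2) {x. \<eta> < \<bar>x\<bar>} n (2 ^ (n - N)))"
      by (rule prob_hit_ge[OF _ _ N that]) auto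
    also have "\<dots> \<le> 1" by simp
    finally have "2 ^ N * (2 ^ (n - N) * p n {x. \<eta> < \<bar>x\<bar>}) \<le> 2 ^ N * 2" by (intro mult_left_mono) auto
    moreover have "(2::real) ^ N * 2 ^ (n - N) = 2 ^ n" using that by (simp add: power_add[symmetric])
    ultimately show ?thesis by (simp add: mult.assoc[symmetric])
  qed
  then show ?thesis by blast
qed

lemma prob_grid_union_le:
  assumes "A \<in> sets borel"
  shows "prob (\<Union>m<K. {w \<in> space M. incr n m w \<in> A}) \<le> real K * p n A"
proof -
  have "prob (\<Union>m<K. {w \<in> space M. incr n m w \<in> A}) \<le> (\<Sum>m<K. prob {w \<in> space M. incr n m w \<in> A})"
    using assms by (intro finite_measure_subadditive_finite) auto
  then show ?thesis using prob_incr[OF assms] by simp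
qed

text \<open>\<open>2 ^ n * p n A\<close> is the expected number of increments in \<open>A\<close>
  per unit of time. If it came arbitrarily close to \<open>0\<close> along finer meshes, jumps in
  \<open>A\<close> would be absent from every bounded interval, since a jump in an open set is
  eventually matched by an increment in that set.\<close>

lemma p_lower_bound:
  assumes A: "open A" and jumps: "\<not> (AE w in M. \<forall>s>0. dY w s \<notin> A)"
  shows "\<exists>c>0. \<exists>N. \<forall>n\<ge>N. c \<le> 2 ^ n * p n A"
proof (rule ccontr)
  assume no: "\<not> ?thesis"
  have "AE w in M. \<forall>s>0. s \<le> real T \<longrightarrow> dY w s \<notin> A" for T :: nat
  proof -
    let ?D = "\<lambda>n. \<Union>m<T * 2 ^ n. {w \<in> space M. incr n m w \<in> A}"
    have "AE w in M. \<not> (\<forall>\<^sub>F n in sequentially. w \<in> ?D n)"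
    proof (rule AE_not_eventually_mem)
      show "?D n \<in> events" for n using A by (intro sets.finite_UN ballI PM_events incr_mem_PM) auto
      fix c :: real and N :: nat assume "0 < c"
      \<comment> \<open>The \<open>+ 1\<close> admits \<open>T = 0\<close>.\<close>
      then have "0 < c / (real T + 1)" by simp
      with no obtain n where n: "N \<le> n" "2 ^ n * p n A < c / (real T + 1)" by (meson not_le)
      have "prob (?D n) \<le> real (T * 2 ^ n) * p n A" using A by (intro prob_grid_union_le) auto
      also have "\<dots> = real T * (2 ^ n * p n A)" by simp
      also have "\<dots> \<le> real T * (c / (real T + 1))" using n(2) by (intro mult_left_mono) auto
      also have "\<dots> \<le> c" using \<open>0 < c\<close> by (simp add: field_simps)
      finally show "\<exists>n\<ge>N. prob (?D n) \<le> c" using n(1) by blast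
    qed
    with AE_space show ?thesis
    proof eventually_elim
      case (elim w)
      show ?case
      proof (intro allI impI notI)
        fix s assume s: "0 < s" "s \<le> real T" "dY w s \<in> A"
        obtain e where e: "0 < e" "ball (dY w s) e \<subseteq> A" using A s(3) open_contains_ball by blast
        have "\<forall>\<^sub>F n in sequentially. w \<in> ?D n"
          using eventually_grid_increment[OF Y_cadlag[OF elim(1)] s(1) e(1)]
        proof eventually_elim
          case (elim n)
          then have "incr n (grid_cell n s) w \<in> ball (dY w s) e"
            by (simp add: incr_def dist_real_def abs_minus_commute)
          then have "incr n (grid_cell n s) w \<in> A" using e(2) by blast
          moreover have "grid_cell n s < T * 2 ^ n" using grid_cell(3)[OF s(1,2)] .
          ultimately show ?case using \<open>w \<in> space M\<close> by blast
        qed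
        with elim(2) show False by blast
      qed
    qed
  qed
  then have "AE w in M. \<forall>T::nat. \<forall>s>0. s \<le> real T \<longrightarrow> dY w s \<notin> A" by (simp add: AE_all_countable)
  then have "AE w in M. \<forall>s>0. dY w s \<notin> A"
    by eventually_elim (meson real_arch_simple)
  with jumps show False by blast
qed

text \<open>Openness of \<open>A\<close> lets increments detect its jumps; closedness of
  \<open>A'\<close> retains limits of increments. Hits before the horizon have probabilities bounded
  below uniformly in the mesh, so with positive probability infinitely many meshes are hit. The
  factor \<open>3\<close> provides the strict gap \<open>2 * \<epsilon> < \<bar>x\<bar>\<close> on
  \<open>A\<close>.\<close>

lemma early_jump:
  assumes A: "open A" "closed A'" "A \<subseteq> A'" "\<And>x. x \<in> A' \<Longrightarrow> 3 * \<epsilon> \<le> \<bar>x\<bar>" and \<epsilon>: "0 < \<epsilon>"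
    and jumps: "\<not> (AE w in M. \<forall>s>0. dY w s \<notin> A)"
  shows "\<exists>N0. \<forall>N\<ge>N0. \<exists>F\<in>sets PM. 0 < prob F \<and>
    (\<forall>w\<in>F. \<exists>s>0. s \<le> 1 / 2 ^ N \<and> dY w s \<in> A' \<and> \<bar>Y s w - dY w s\<bar> \<le> \<epsilon>)"
proof -
  obtain c N1 where c: "0 < c" "\<And>n. N1 \<le> n \<Longrightarrow> c \<le> 2 ^ n * p n A"
    using p_lower_bound[OF A(1) jumps] by blast
  have "\<forall>\<^sub>F N in sequentially. 1 / 2 < prob (calm (1 / 2 ^ N) \<epsilon>)"
    using order_tendstoD(1)[OF calm_tendsto[OF \<epsilon>], of "1 / 2"] by simp
  then obtain N0 where "\<And>N. N0 \<le> N \<Longrightarrow> 1 / 2 < prob (calm (1 / 2 ^ N) \<epsilon>)" unfolding eventually_sequentially by blast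
  then have N0: "\<And>N. N0 \<le> N \<Longrightarrow> 1 / 2 \<le> prob (calm (1 / 2 ^ N) \<epsilon>)" by (rule less_imp_le)
  have "\<exists>F\<in>sets PM. 0 < prob F \<and>
    (\<forall>w\<in>F. \<exists>s>0. s \<le> 1 / 2 ^ N \<and> dY w s \<in> A' \<and> \<bar>Y s w - dY w s\<bar> \<le> \<epsilon>)"
    if "N0 \<le> N" for N
  proof -
    define F where "F n = (if N \<le> n then hit \<epsilon> A n (2 ^ (n - N)) else {})" for n
    have F: "F n \<in> sets PM" for n unfolding F_def using A(1) by (auto intro!: hit_PM)
    have "c / 2 ^ N / 2 \<le> prob (F n)" if n: "max N N1 \<le> n" for n
    proof -
      have "2 * \<epsilon> < \<bar>x\<bar>" if "x \<in> A" for x using A(3,4) that \<epsilon> by fastforce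
      from prob_hit_ge[OF borel_open[OF A(1)] this N0[OF \<open>N0 \<le> N\<close>], of n] n
      have "2 ^ (n - N) * p n A / 2 \<le> prob (F n)" by (simp add: F_def)
      moreover have "c / 2 ^ N \<le> 2 ^ (n - N) * p n A"
        using c(2)[of n] n by (simp add: power_diff field_simps)
      ultimately show ?thesis by simp
    qed
    from prob_frequently_mem_ge[where F = F and N = "max N N1", OF PM_events[OF F] this]
    have "c / 2 ^ N / 2 \<le> prob (\<Inter>k. \<Union>n\<in>{k..}. F n)" by blast
    then have pos: "0 < prob (\<Inter>k. \<Union>n\<in>{k..}. F n)" using c(1) by (smt (verit) divide_pos_pos zero_less_power)
    have "(\<Inter>k. \<Union>n\<in>{k..}. F n) \<in> sets PM" using F by (intro sets.countable_INT' image_subsetI sets.countable_UN') auto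
    moreover have "\<exists>s>0. s \<le> 1 / 2 ^ N \<and> dY w s \<in> A' \<and> \<bar>Y s w - dY w s\<bar> \<le> \<epsilon>"
      if w: "w \<in> (\<Inter>k. \<Union>n\<in>{k..}. F n)" for w
    proof -
      have "w \<in> (\<Union>n\<in>{0..}. F n)" using w by blast
      then have ws: "w \<in> space M" by (auto simp: F_def hit_def split: if_splits)
      have "\<exists>s. 0 < s \<and> s \<le> 1 / 2 ^ N \<and> dY w s \<in> A' \<and> \<bar>Y s w - dY w s\<bar> \<le> \<epsilon>"
      proof (rule jump_from_grid[OF Y_cadlag[OF ws] _ A(2,4)])
        fix k
        have "w \<in> (\<Union>n\<in>{k..}. F n)" using w by blast
        then obtain n where n: "k \<le> n" "w \<in> F n" by blast
        then have nN: "N \<le> n" "w \<in> hit \<epsilon> A n (2 ^ (n - N))" by (auto simp: F_def split: if_splits)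
        then obtain m where m: "m < 2 ^ (n - N)" "w \<in> below \<epsilon> n m" "incr n m w \<in> A" by (auto simp: hit_def)
        have "Suc m \<le> 2 ^ (n - N)" using m(1) by simp
        then have "real (Suc m) \<le> real (2 ^ (n - N))" by (simp only: of_nat_le_iff)
        then have "real (Suc m) \<le> 2 ^ (n - N)" by simp
        then have "real (Suc m) / 2 ^ n \<le> 1 / 2 ^ N" using nN(1) by (simp add: power_diff field_simps)
        then show "\<exists>n\<ge>k. \<exists>m. real (Suc m) / 2 ^ n \<le> 1 / 2 ^ N \<and> \<bar>Y (real m / 2 ^ n) w\<bar> \<le> \<epsilon> \<and>
            Y (real (Suc m) / 2 ^ n) w - Y (real m / 2 ^ n) w \<in> A'"
          using n(1) m(2,3) A(3) by (intro exI[of _ n] conjI exI[of _ m]) (auto simp: below_def incr_def)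
      qed (use \<epsilon> in auto)
      then show ?thesis by blast
    qed
    ultimately show ?thesis using pos by blast
  qed
  then show ?thesis by blast
qed

text \<open>Over a grid of mesh \<open>2 ^ (- n)\<close>, the time \<open>\<tau>\<close> selects one increment, which is small by independence.\<close>

lemma no_jump_at_independent_time:
  assumes \<tau>: "\<And>a b. {w \<in> space M. a < \<tau> w \<and> \<tau> w \<le> b} \<in> events"
    and ind: "\<And>a b B. B \<in> sets PM \<Longrightarrow>
      prob ({w \<in> space M. a < \<tau> w \<and> \<tau> w \<le> b} \<inter> B) = prob {w \<in> space M. a < \<tau> w \<and> \<tau> w \<le> b} * prob B"
  shows "AE w in M. 0 < \<tau> w \<longrightarrow> dY w (\<tau> w) = 0"
proof -
  have "AE w in M. 0 < \<tau> w \<and> \<tau> w \<le> real T \<longrightarrow> \<bar>dY w (\<tau> w)\<bar> \<le> \<eta>" if \<eta>: "0 < \<eta>" for T :: nat and \<eta>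
  proof -
    let ?c = "\<lambda>n m. {w \<in> space M. real m / 2 ^ n < \<tau> w \<and> \<tau> w \<le> real (Suc m) / 2 ^ n}"
    let ?B = "\<lambda>n m. {w \<in> space M. incr n m w \<in> {x. \<eta> < \<bar>x\<bar>}}"
    let ?D = "\<lambda>n. \<Union>m<T * 2 ^ n. ?c n m \<inter> ?B n m"
    have B: "?B n m \<in> sets PM" for n m
      by (rule incr_mem_PM) simp
    have "AE w in M. \<not> (\<forall>\<^sub>F n in sequentially. w \<in> ?D n)"
    proof (rule AE_not_eventually_mem)
      show "?D n \<in> events" for n using \<tau> PM_events[OF B] by (intro sets.countable_UN') auto
      fix c :: real and N :: nat assume c: "0 < c"
      have "\<forall>\<^sub>F n in sequentially. p n {x. \<eta> < \<bar>x\<bar>} < c" using order_tendstoD(2)[OF p_tendsto_0[OF \<eta>] c] .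
      then obtain N' where "\<And>n. N' \<le> n \<Longrightarrow> p n {x. \<eta> < \<bar>x\<bar>} < c" unfolding eventually_sequentially by blast
      then have n: "N \<le> max N N'" "p (max N N') {x. \<eta> < \<bar>x\<bar>} < c" by simp_all
      define n where "n = max N N'"
      note n = n[folded n_def]
      have "prob (?D n) \<le> (\<Sum>m<T * 2 ^ n. prob (?c n m \<inter> ?B n m))"
        using \<tau> PM_events[OF B] by (intro finite_measure_subadditive_finite) auto
      also have "\<dots> = (\<Sum>m<T * 2 ^ n. prob (?c n m)) * p n {x. \<eta> < \<bar>x\<bar>}"
      proof -
        have "prob (?c n m \<inter> ?B n m) = prob (?c n m) * p n {x. \<eta> < \<bar>x\<bar>}" for m
          unfolding ind[OF B] by (subst prob_incr) auto
        then show ?thesis by (simp add: sum_distrib_right)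
      qed
      \<comment> \<open>The time lies in at most one cell, so the growing number of cells does not
        enter the bound.\<close>
      also have "(\<Sum>m<T * 2 ^ n. prob (?c n m)) = prob (\<Union>m<T * 2 ^ n. ?c n m)"
      proof (rule finite_measure_finite_Union[symmetric])
        have no: False if "w \<in> ?c n m" "w \<in> ?c n m'" "m < m'" for w m m'
        proof -
          have "real (Suc m) \<le> real m'" using that(3) by simp
          then have "real (Suc m) / 2 ^ n \<le> real m' / 2 ^ n" by (intro divide_right_mono) auto
          with that(1,2) show False by auto
        qed
        show "disjoint_family_on (?c n) {..<T * 2 ^ n}"
        proof (rule disjoint_family_on_natI)
          fix m m' w assume "m < m'" "w \<in> ?c n m" "w \<in> ?c n m'"
          then show False using no[of w m m'] by blast
        qed
      qed (use \<tau> in auto)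
      also have "\<dots> * p n {x. \<eta> < \<bar>x\<bar>} \<le> 1 * c" using n(2) c by (intro mult_mono) (auto simp: p_def)
      finally show "\<exists>n\<ge>N. prob (?D n) \<le> c" using n(1) by auto
    qed
    with AE_space show ?thesis
    proof eventually_elim
      case (elim w)
      show ?case
      proof (intro impI, rule ccontr)
        assume s: "0 < \<tau> w \<and> \<tau> w \<le> real T" and "\<not> \<bar>dY w (\<tau> w)\<bar> \<le> \<eta>"
        then have j: "0 < \<bar>dY w (\<tau> w)\<bar> - \<eta>" by simp
        have "\<forall>\<^sub>F n in sequentially. w \<in> ?D n"
          using eventually_grid_increment[OF Y_cadlag[OF elim(1)] _ j, of "\<tau> w", OF conjunct1[OF s]]
        proof eventually_elim
          case (elim n)
          then have "\<eta> < \<bar>incr n (grid_cell n (\<tau> w)) w\<bar>" unfolding incr_def by linarith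
          moreover have "grid_cell n (\<tau> w) < T * 2 ^ n" using grid_cell(3)[of "\<tau> w"] s by simp
          moreover have "w \<in> ?c n (grid_cell n (\<tau> w))" using grid_cell(1,2)[of "\<tau> w" n] s \<open>w \<in> space M\<close> by simp
          ultimately show ?case using \<open>w \<in> space M\<close> by blast
        qed
        with elim(2) show False by blast
      qed
    qed
  qed
  then have "AE w in M. 0 < \<tau> w \<and> \<tau> w \<le> real T \<longrightarrow> \<bar>dY w (\<tau> w)\<bar> \<le> 1 / real (Suc k)" for T k :: nat
    by simp
  then have "AE w in M. \<forall>T k :: nat. 0 < \<tau> w \<and> \<tau> w \<le> real T \<longrightarrow> \<bar>dY w (\<tau> w)\<bar> \<le> 1 / real (Suc k)"
    unfolding AE_all_countable by blast
  then show ?thesis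
  proof eventually_elim
    case (elim w)
    show ?case
    proof (rule impI, rule ccontr)
      assume \<tau>: "0 < \<tau> w" and "dY w (\<tau> w) \<noteq> 0"
      then obtain k where "inverse (real (Suc k)) < \<bar>dY w (\<tau> w)\<bar>" using reals_Archimedean[of "\<bar>dY w (\<tau> w)\<bar>"] by auto
      moreover obtain T :: nat where "\<tau> w \<le> real T" using real_arch_simple by blast
      ultimately show False using elim[rule_format, of T k] \<tau> by (simp add: inverse_eq_divide del: of_nat_Suc)
    qed
  qed
qed

end

text \<open>The expected number of cells in which both processes have a large increment is
  \<open>real T * 2 ^ n\<close> times the product of the two one-cell probabilities. One of these
  compensates the number of cells, and the other still tends to \<open>0\<close>.\<close>

lemma no_common_jumps:
  assumes Y: "levy M Y" and Y': "levy M Y'"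
    and ind: "\<And>A B. A \<in> path_events M borel Y \<Longrightarrow> B \<in> path_events M borel Y' \<Longrightarrow>
      measure M (A \<inter> B) = measure M A * measure M B"
  shows "AE w in M. \<forall>s>0. jump (\<lambda>t. Y t w) s = 0 \<or> jump (\<lambda>t. Y' t w) s = 0"
proof -
  interpret Y: levy M Y by fact
  interpret Y': levy M Y' by fact
  have "AE w in M. \<forall>s>0. s \<le> real T \<longrightarrow> \<bar>jump (\<lambda>t. Y t w) s\<bar> \<le> \<eta> \<or> \<bar>jump (\<lambda>t. Y' t w) s\<bar> \<le> \<eta>" if \<eta>: "0 < \<eta>" for T :: nat and \<eta>
  proof -
    let ?A = "{x::real. \<eta> < \<bar>x\<bar>}"
    let ?B = "\<lambda>n m. {w \<in> space M. Y.incr n m w \<in> ?A}"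
    let ?B' = "\<lambda>n m. {w \<in> space M. Y'.incr n m w \<in> ?A}"
    let ?D = "\<lambda>n. \<Union>m<T * 2 ^ n. ?B n m \<inter> ?B' n m"
    have B: "?B n m \<in> sets Y.PM" "?B' n m \<in> sets Y'.PM" for n m
      by (rule Y.incr_mem_PM, simp) (rule Y'.incr_mem_PM, simp)
    have BB: "?B n m \<inter> ?B' n m \<in> Y.events" for n m using Y.PM_events[OF B(1)] Y'.PM_events[OF B(2)] by auto
    obtain K N0 where K: "\<And>n. N0 \<le> n \<Longrightarrow> 2 ^ n * Y.p n ?A \<le> K" using Y.p_bound[OF \<eta>] by blast
    have "AE w in M. \<not> (\<forall>\<^sub>F n in sequentially. w \<in> ?D n)"
    proof (rule Y.AE_not_eventually_mem)
      show "?D n \<in> Y.events" for n using BB by (intro sets.countable_UN') auto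
      fix c :: real and N :: nat assume c: "0 < c"
      let ?c = "c / (real T * \<bar>K\<bar> + 1)"
      have "0 < ?c" using c by (intro divide_pos_pos) (auto intro!: add_nonneg_pos)
      then have "\<forall>\<^sub>F n in sequentially. Y'.p n ?A < ?c" by (rule order_tendstoD(2)[OF Y'.p_tendsto_0[OF \<eta>]])
      then obtain N1 where N1: "\<And>n. N1 \<le> n \<Longrightarrow> Y'.p n ?A < ?c" by (auto simp: eventually_sequentially)
      define n where "n = max N (max N0 N1)"
      have n: "N \<le> n" "2 ^ n * Y.p n ?A \<le> K" "Y'.p n ?A < ?c" using K[of n] N1[of n] by (auto simp: n_def)
      have "Y.prob (?D n) \<le> (\<Sum>m<T * 2 ^ n. Y.prob (?B n m \<inter> ?B' n m))"
        using BB by (intro Y.finite_measure_subadditive_finite) auto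
      also have "\<dots> = (\<Sum>m<T * 2 ^ n. Y.p n ?A * Y'.p n ?A)"
      proof (rule sum.cong[OF refl])
        fix m
        have A: "?A \<in> sets borel" by simp
        show "Y.prob (?B n m \<inter> ?B' n m) = Y.p n ?A * Y'.p n ?A"
          using ind[of "?B n m" "?B' n m"] B Y.prob_incr[OF A] Y'.prob_incr[OF A] by (simp add: Y.sets_PM Y'.sets_PM)
      qed
      also have "\<dots> = real T * (2 ^ n * Y.p n ?A) * Y'.p n ?A" by simp
      also have "\<dots> \<le> (real T * \<bar>K\<bar>) * ?c"
        using n(2,3) by (intro mult_mono mult_left_mono) (auto simp: Y.p_def Y'.p_def)
      also have "\<dots> \<le> c"
      proof -
        have "0 \<le> real T * \<bar>K\<bar>" by simp
        then show ?thesis using c by (simp add: divide_le_eq mult.commute add_nonneg_pos mult_right_mono)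
      qed
      finally show "\<exists>n\<ge>N. Y.prob (?D n) \<le> c" using n(1) by blast
    qed
    with AE_space show ?thesis
    proof eventually_elim
      case (elim w)
      show ?case
      proof (intro allI impI, rule ccontr)
        fix s assume s: "0 < s" "s \<le> real T" and "\<not> (\<bar>jump (\<lambda>t. Y t w) s\<bar> \<le> \<eta> \<or> \<bar>jump (\<lambda>t. Y' t w) s\<bar> \<le> \<eta>)"
        then have j: "0 < \<bar>jump (\<lambda>t. Y t w) s\<bar> - \<eta>" "0 < \<bar>jump (\<lambda>t. Y' t w) s\<bar> - \<eta>" by auto
        have "\<forall>\<^sub>F n in sequentially. w \<in> ?D n"
          using eventually_grid_increment[OF Y.Y_cadlag[OF elim(1)] s(1) j(1)]
            eventually_grid_increment[OF Y'.Y_cadlag[OF elim(1)] s(1) j(2)]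
        proof eventually_elim
          case (elim n)
          have "\<eta> < \<bar>Y.incr n (grid_cell n s) w\<bar>" using elim(1) unfolding Y.incr_def by linarith
          moreover have "\<eta> < \<bar>Y'.incr n (grid_cell n s) w\<bar>" using elim(2) unfolding Y'.incr_def by linarith
          moreover have "grid_cell n s < T * 2 ^ n" using grid_cell(3)[OF s] .
          ultimately show ?case using \<open>w \<in> space M\<close> by blast
        qed
        with elim(2) show False by blast
      qed
    qed
  qed
  then have "AE w in M. \<forall>T k :: nat. \<forall>s>0. s \<le> real T \<longrightarrow>
      \<bar>jump (\<lambda>t. Y t w) s\<bar> \<le> 1 / real (Suc k) \<or> \<bar>jump (\<lambda>t. Y' t w) s\<bar> \<le> 1 / real (Suc k)"
    by (simp add: AE_all_countable del: of_nat_Suc)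
  then show ?thesis
  proof eventually_elim
    case (elim w)
    show ?case
    proof (intro allI impI, rule ccontr)
      fix s :: real assume s: "0 < s" and "\<not> (jump (\<lambda>t. Y t w) s = 0 \<or> jump (\<lambda>t. Y' t w) s = 0)"
      then have "0 < min \<bar>jump (\<lambda>t. Y t w) s\<bar> \<bar>jump (\<lambda>t. Y' t w) s\<bar>" by auto
      then obtain k where "inverse (real (Suc k)) < min \<bar>jump (\<lambda>t. Y t w) s\<bar> \<bar>jump (\<lambda>t. Y' t w) s\<bar>" using reals_Archimedean by blast
      moreover obtain T :: nat where "s \<le> real T" using real_arch_simple by blast
      ultimately show False using elim[rule_format, of s T k] s by (auto simp: inverse_eq_divide simp del: of_nat_Suc)
    qed
  qed
qed

section \<open>The modulating chain on a dyadic grid\<close>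

lemma dyadic_between:
  fixes a b h :: real
  assumes "0 \<le> a" "a < b" "0 < h"
  shows "\<exists>n k. a < real k / 2 ^ n * h \<and> real k / 2 ^ n * h < b"
proof -
  have "0 < (b - a) / h / 2" using assms by simp
  then obtain n where "(1 / 2) ^ n < (b - a) / h / 2" using real_arch_pow_inv[of "(b - a) / h / 2" "1 / 2"] by auto
  then have n: "1 / 2 ^ n < (b - a) / h / 2" by (simp add: power_one_over)
  define k where "k = nat (\<lfloor>a / h * 2 ^ n\<rfloor> + 1)"
  have k: "real k = of_int \<lfloor>a / h * 2 ^ n\<rfloor> + 1" using assms by (simp add: k_def)
  have 1: "a / h < real k / 2 ^ n" using k floor_correct[of "a / h * 2 ^ n"] by (simp add: less_divide_eq)
  have "real k - 1 \<le> a / h * 2 ^ n" using k floor_correct[of "a / h * 2 ^ n"] by simp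
  then have "(real k - 1) / 2 ^ n \<le> a / h" by (simp add: divide_le_eq)
  then have "real k / 2 ^ n \<le> a / h + 1 / 2 ^ n" by (simp add: diff_divide_distrib)
  also have "\<dots> < a / h + (b - a) / h" using n assms by (smt (verit) divide_pos_pos field_sum_of_halves)
  also have "\<dots> = b / h" by (simp add: diff_divide_distrib)
  finally have 2: "real k / 2 ^ n < b / h" .
  from 1 2 assms have "a < real k / 2 ^ n * h \<and> real k / 2 ^ n * h < b" by (simp add: divide_less_eq less_divide_eq)
  then show ?thesis by blast
qed

lemma one_minus_le_power: "0 \<le> u \<Longrightarrow> u \<le> 1 \<Longrightarrow> k \<le> n \<Longrightarrow> 1 - real n * u \<le> (1 - u :: real) ^ k"
proof -
  assume u: "0 \<le> u" "u \<le> 1" "k \<le> n"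
  have "1 + real n * (- u) \<le> (1 + (- u)) ^ n" by (rule Bernoulli_inequality) (use u in simp)
  also have "\<dots> \<le> (1 + (- u)) ^ k" using u by (intro power_decreasing) auto
  finally show ?thesis by simp
qed

lemma grid_index_le:
  fixes h :: real
  assumes "0 < h" "real k / 2 ^ n * h < h"
  shows "k \<le> 2 ^ n"
proof -
  have "real k / 2 ^ n * h < 1 * h" using assms(2) by simp
  then have "real k / 2 ^ n < 1" using assms(1) by (simp only: mult_less_cancel_right_pos)
  then have "real k < real (2 ^ n)" by (simp add: divide_less_eq)
  then have "k < 2 ^ n" by (simp only: of_nat_less_iff)
  then show ?thesis by simp
qed

locale chain = prob_space M for M :: "'w measure" +
  fixes Q :: "real^'i::finite^'i" and i :: 'i and \<theta> :: "real \<Rightarrow> 'w \<Rightarrow> 'i"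
  assumes mc: "markov_chain_from M Q i \<theta>"
begin

text \<open>As with the Levy processes, events are located in the sigma-algebra of the path of the
  chain, where independence of the other sources is available.\<close>

definition CM :: "'w measure" where
  "CM = vimage_algebra (space M) (\<lambda>w. \<lambda>t\<in>{0..}. \<theta> t w) (PiM {0..} (\<lambda>_. count_space UNIV))"

lemma space_CM: "space CM = space M"
  by (simp add: CM_def)

lemma sets_CM: "sets CM = path_events M (count_space UNIV) \<theta>"
  by (simp add: CM_def path_events_def)

lemma \<theta>_CM: "0 \<le> t \<Longrightarrow> \<theta> t \<in> measurable CM (count_space UNIV)"
  unfolding CM_def by (rule measurable_path_component) auto

lemma CM_events: "A \<in> sets CM \<Longrightarrow> A \<in> events"
proof -
  have "subalgebra M CM" unfolding CM_def
    by (rule subalgebra_vimage_algebra, rule measurable_restrict) (use mc in \<open>auto simp: markov_chain_from_def\<close>)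
  then show "A \<in> sets CM \<Longrightarrow> A \<in> events" by (auto simp: subalgebra_def)
qed

lemma \<theta>_0: "w \<in> space M \<Longrightarrow> \<theta> 0 w = i" and step: "w \<in> space M \<Longrightarrow> step_path (\<lambda>t. \<theta> t w)"
  using mc by (auto simp: markov_chain_from_def)

lemma state_CM: "0 \<le> t \<Longrightarrow> {w \<in> space M. \<theta> t w = j} \<in> sets CM"
proof -
  assume "0 \<le> t"
  then have "\<theta> t -` {j} \<inter> space CM \<in> sets CM" by (intro measurable_sets[OF \<theta>_CM]) auto
  moreover have "\<theta> t -` {j} \<inter> space CM = {w \<in> space M. \<theta> t w = j}" by (auto simp: space_CM)
  ultimately show ?thesis by simp
qed

text \<open>Right-continuity makes the state jointly measurable in time and \<open>w\<close>, and
  integration over time preserves this. Measurability with respect to \<open>CM\<close> is what will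
  make occupation times independent of the Levy processes.\<close>

lemma occupation_CM:
  assumes r: "0 \<le> r"
  shows "(\<lambda>w. occupation (\<lambda>t. \<theta> t w) j r) \<in> borel_measurable CM"
proof -
  define F where "F t w = (if 0 \<le> t then of_bool (\<theta> t w = j) else (0 :: real))" for t w
  have "(\<lambda>(t, w). F t w) \<in> borel_measurable (borel \<Otimes>\<^sub>M CM)"
    unfolding F_def
  proof (rule borel_measurable_pair_right_continuous)
    fix t :: real and w assume t: "0 \<le> t" and w: "w \<in> space CM"
    then have "\<forall>\<^sub>F u in at_right t. \<theta> u w = \<theta> t w" using step[of w] by (simp add: step_path_def space_CM)
    then have "\<forall>\<^sub>F u in at_right t. (of_bool (\<theta> u w = j) :: real) = of_bool (\<theta> t w = j)" by eventually_elim simp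
    then show "((\<lambda>u. of_bool (\<theta> u w = j) :: real) \<longlongrightarrow> of_bool (\<theta> t w = j)) (at_right t)" by (rule tendsto_eventually)
  next
    fix t :: real assume "0 \<le> t"
    then show "(\<lambda>w. of_bool (\<theta> t w = j) :: real) \<in> borel_measurable CM"
      by (rule measurable_compose[OF \<theta>_CM]) simp
  qed
  moreover have "(\<lambda>q. indicator {..r} (fst q) :: real) \<in> borel_measurable (borel \<Otimes>\<^sub>M CM)"
    by (rule measurable_compose[OF measurable_fst borel_measurable_indicator]) (rule borel_closed, rule closed_atMost)
  ultimately have "(\<lambda>q. (case q of (t, w) \<Rightarrow> F t w) * indicator {..r} (fst q)) \<in> borel_measurable (borel \<Otimes>\<^sub>M CM)"
    by (rule borel_measurable_times)
  then have "(\<lambda>q. F (fst q) (snd q) * indicator {..r} (fst q)) \<in> borel_measurable (lborel \<Otimes>\<^sub>M CM)"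
    unfolding measurable_cong_sets[OF sets_pair_measure_cong[OF sets_lborel refl] refl] by (simp only: case_prod_beta)
  then have "(\<lambda>q. F (snd q) (fst q) * indicator {..r} (snd q)) \<in> borel_measurable (CM \<Otimes>\<^sub>M lborel)"
    using measurable_compose[OF measurable_pair_swap'[of CM lborel], of "\<lambda>q. F (fst q) (snd q) * indicator {..r} (fst q)" borel]
    by (simp add: case_prod_beta)
  then have "(\<lambda>w. \<integral>t. F t w * indicator {..r} t \<partial>lborel) \<in> borel_measurable CM"
    by (intro lborel.borel_measurable_lebesgue_integral) (simp add: case_prod_beta)
  moreover have "(\<integral>t. F t w * indicator {..r} t \<partial>lborel) = occupation (\<lambda>t. \<theta> t w) j r" for w
  proof -
    have "(\<lambda>t. F t w * indicator {..r} t) = indicator {s \<in> {0..r}. \<theta> s w = j}"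
      by (auto simp: F_def fun_eq_iff indicator_def)
    then show ?thesis by (simp add: occupation_def)
  qed
  ultimately show ?thesis by simp
qed

text \<open>Differentiability at \<open>0\<close> is reduced to first-order lower bounds, with one
  \<open>h0\<close> and one \<open>K\<close> for all pairs of states since there are finitely
  many.\<close>

lemma transition_bounds:
  obtains p :: "real \<Rightarrow> 'i \<Rightarrow> 'i \<Rightarrow> real" and K h0 :: real
  where "0 < h0" "0 \<le> K" "\<And>h a. 0 \<le> h \<Longrightarrow> h \<le> h0 \<Longrightarrow> 1 - K * h \<le> p h a a"
    "\<And>h a b. 0 \<le> h \<Longrightarrow> h \<le> h0 \<Longrightarrow> a \<noteq> b \<Longrightarrow> 0 < Q $ a $ b \<Longrightarrow> Q $ a $ b / 2 * h \<le> p h a b"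
    "\<And>n u y. 0 \<le> u \<Longrightarrow> y 0 = i \<Longrightarrow>
        prob {w \<in> space M. \<forall>k\<le>n. \<theta> (real k * u) w = y k} = (\<Prod>k<n. p u (y k) (y (Suc k)))"
proof -
  obtain p :: "real \<Rightarrow> 'i \<Rightarrow> 'i \<Rightarrow> real" where p0: "\<And>a b. p 0 a b = (if a = b then 1 else 0)"
    and pd: "\<And>a b. ((\<lambda>h. p h a b) has_real_derivative Q $ a $ b) (at 0 within {0..})"
    and pp: "\<And>n (\<tau>::nat \<Rightarrow> real) y. mono \<tau> \<and> \<tau> 0 = 0 \<and> y 0 = i \<Longrightarrow>
           measure M {w \<in> space M. \<forall>k\<le>n. \<theta> (\<tau> k) w = y k} = (\<Prod>k<n. p (\<tau> (Suc k) - \<tau> k) (y k) (y (Suc k)))"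
    using mc unfolding markov_chain_from_def by blast
  have lower: "\<exists>r>0. \<forall>h. 0 \<le> h \<and> h \<le> r \<longrightarrow> p 0 a b + (Q $ a $ b - \<eta>) * h \<le> p h a b" if \<eta>: "0 < \<eta>" for a b \<eta>
  proof -
    have "((\<lambda>h. (p h a b - p 0 a b) / (h - 0)) \<longlongrightarrow> Q $ a $ b) (at 0 within {0..})"
      using pd[of a b] by (simp add: has_field_derivative_iff)
    from tendstoD[OF this \<eta>] obtain d where d: "0 < d"
      "\<And>h. h \<in> {0..} \<Longrightarrow> h \<noteq> 0 \<Longrightarrow> dist h 0 < d \<Longrightarrow> dist ((p h a b - p 0 a b) / (h - 0)) (Q $ a $ b) < \<eta>"
      unfolding eventually_at by blast
    have "p 0 a b + (Q $ a $ b - \<eta>) * h \<le> p h a b" if h: "0 \<le> h" "h \<le> d / 2" for h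
    proof (cases "h = 0")
      case False
      then have "\<bar>(p h a b - p 0 a b) / h - Q $ a $ b\<bar> < \<eta>" using d(2)[of h] d(1) h by (simp add: dist_real_def)
      then have "Q $ a $ b - \<eta> \<le> (p h a b - p 0 a b) / h" by linarith
      then show ?thesis using False h by (simp add: pos_le_divide_eq)
    qed simp
    then show ?thesis using d(1) by (intro exI[of _ "d / 2"]) auto
  qed
  \<comment> \<open>For a positive entry the tolerance is half of it, which leaves the slope
    \<open>Q $ a $ b / 2\<close>; otherwise it is \<open>1\<close>, to be absorbed by
    \<open>K\<close>.\<close>
  have "\<forall>c. \<exists>r. 0 < r \<and> (\<forall>h. 0 \<le> h \<and> h \<le> r \<longrightarrow> p 0 (fst c) (snd c) +
      (Q $ fst c $ snd c - (if 0 < Q $ fst c $ snd c then Q $ fst c $ snd c / 2 else 1)) * h \<le> p h (fst c) (snd c))"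
    by (intro allI lower) simp
  from choice[OF this] obtain r' where r': "\<forall>c. 0 < r' c \<and> (\<forall>h. 0 \<le> h \<and> h \<le> r' c \<longrightarrow> p 0 (fst c) (snd c) +
      (Q $ fst c $ snd c - (if 0 < Q $ fst c $ snd c then Q $ fst c $ snd c / 2 else 1)) * h \<le> p h (fst c) (snd c))" ..
  define r where "r a b = r' (a, b)" for a b
  have r: "0 < r a b" "0 \<le> h \<Longrightarrow> h \<le> r a b \<Longrightarrow> p 0 a b + (Q $ a $ b - (if 0 < Q $ a $ b then Q $ a $ b / 2 else 1)) * h \<le> p h a b" for a b h
    using r'[THEN spec, of "(a, b)"] unfolding r_def fst_conv snd_conv by blast+
  define h0 where "h0 = Min (range (\<lambda>(a, b). r a b))"
  define K where "K = 1 + (\<Sum>a\<in>UNIV. \<bar>Q $ a $ a\<bar>)"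
  have "0 < h0" unfolding h0_def using r(1) by (subst Min_gr_iff) auto
  have h0: "h0 \<le> r a b" for a b
  proof -
    have "h0 \<le> (\<lambda>(a, b). r a b) (a, b)" unfolding h0_def by (rule Min_le) (rule finite_imageI, simp, rule rangeI)
    then show ?thesis by simp
  qed
  have K: "1 - K * h \<le> p h a a" if "0 \<le> h" "h \<le> h0" for h a
  proof -
    have "\<bar>Q $ a $ a\<bar> \<le> (\<Sum>a\<in>UNIV. \<bar>Q $ a $ a\<bar>)" by (rule member_le_sum) auto
    then have "- K \<le> Q $ a $ a - (if 0 < Q $ a $ a then Q $ a $ a / 2 else 1)" unfolding K_def by auto
    then have "- K * h \<le> (Q $ a $ a - (if 0 < Q $ a $ a then Q $ a $ a / 2 else 1)) * h" using that by (intro mult_right_mono)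
    with r(2)[OF that(1), of a a] h0[of a a] that p0[of a a] show ?thesis by auto
  qed
  have P: "Q $ a $ b / 2 * h \<le> p h a b" if "0 \<le> h" "h \<le> h0" "a \<noteq> b" "0 < Q $ a $ b" for h a b
    using r(2)[OF that(1), of a b] h0[of a b] that p0[of a b] by (auto simp: field_simps)
  have "prob {w \<in> space M. \<forall>k\<le>n. \<theta> (real k * u) w = y k} = (\<Prod>k<n. p u (y k) (y (Suc k)))"
    if "0 \<le> u" "y 0 = i" for n u y
  proof -
    have "mono (\<lambda>k. real k * u)" using that(1) by (auto intro!: monoI mult_right_mono)
    then show ?thesis using pp[of "\<lambda>k. real k * u" y n] that(2) by (simp add: algebra_simps)
  qed
  note G = this
  have "0 \<le> K" unfolding K_def by (intro add_nonneg_nonneg sum_nonneg) auto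
  show ?thesis by (rule that[OF \<open>0 < h0\<close> \<open>0 \<le> K\<close> K P G])
qed

definition grid_path :: "real \<Rightarrow> nat \<Rightarrow> (nat \<Rightarrow> 'i) \<Rightarrow> 'w set" where
  "grid_path h n y = {w \<in> space M. \<forall>k\<le>2 ^ n. \<theta> (real k / 2 ^ n * h) w = y k}"

lemma grid_path_CM: "0 \<le> h \<Longrightarrow> grid_path h n y \<in> sets CM"
proof -
  assume h: "0 \<le> h"
  have "{w \<in> space CM. \<forall>k\<in>{..2 ^ n}. \<theta> (real k / 2 ^ n * h) w = y k} \<in> sets CM"
    by (rule sets.sets_Collect_finite_All) (use state_CM h in \<open>auto simp: space_CM\<close>)
  then show ?thesis by (simp only: grid_path_def space_CM Ball_def atMost_iff)
qed

text \<open>The grid events decrease under refinement and keep probability at least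
  \<open>1 / 2\<close>, since by Bernoulli's inequality the losses of the single steps add up to at
  most \<open>K * h\<close>. Right-continuity extends constancy from dyadic times to all times
  before \<open>h\<close>.\<close>

lemma stay_event: "\<exists>h0>0. \<forall>h. 0 < h \<and> h \<le> h0 \<longrightarrow>
    (\<exists>E\<in>sets CM. 0 < prob E \<and> (\<forall>w\<in>E. \<forall>u. 0 \<le> u \<and> u < h \<longrightarrow> \<theta> u w = i))"
proof -
  obtain p :: "real \<Rightarrow> 'i \<Rightarrow> 'i \<Rightarrow> real" and K h0 :: real where h0: "0 < h0" "0 \<le> K"
    and diag: "\<And>h a. 0 \<le> h \<Longrightarrow> h \<le> h0 \<Longrightarrow> 1 - K * h \<le> p h a a"
    and off: "\<And>h a b. 0 \<le> h \<Longrightarrow> h \<le> h0 \<Longrightarrow> a \<noteq> b \<Longrightarrow> 0 < Q $ a $ b \<Longrightarrow> Q $ a $ b / 2 * h \<le> p h a b"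
    and pp: "\<And>n u y. 0 \<le> u \<Longrightarrow> y 0 = i \<Longrightarrow>
        prob {w \<in> space M. \<forall>k\<le>n. \<theta> (real k * u) w = y k} = (\<Prod>k<n. p u (y k) (y (Suc k)))"
    by (rule transition_bounds) (rule that)
  have "\<exists>E\<in>sets CM. 0 < prob E \<and> (\<forall>w\<in>E. \<forall>u. 0 \<le> u \<and> u < h \<longrightarrow> \<theta> u w = i)"
    if h: "0 < h" "h \<le> min h0 (1 / (2 * (K + 1)))" for h
  proof -
    \<comment> \<open>The bound \<open>1 / (2 * (K + 1))\<close> on \<open>h\<close> is made for
      this estimate; \<open>K + 1\<close> admits \<open>K = 0\<close>.\<close>
    have Kh: "K * h \<le> 1 / 2"
    proof -
      have "h \<le> 1 / (2 * (K + 1))" using h(2) by simp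
      then have "h * (2 * (K + 1)) \<le> 1" using h0 by (subst (asm) pos_le_divide_eq) auto
      then show ?thesis using h(1) by (simp add: algebra_simps)
    qed
    define E where "E = (\<Inter>n. grid_path h n (\<lambda>_. i))"
    have ev: "grid_path h n (\<lambda>_. i) \<in> events" for n using grid_path_CM[of h] h by (intro CM_events) auto
    have ge: "1 / 2 \<le> prob (grid_path h n (\<lambda>_. i))" for n
    proof -
      let ?u = "h / 2 ^ n"
      have u: "0 \<le> ?u" "?u \<le> h0" "K * ?u \<le> 1"
      proof -
        have "?u \<le> h" using h by (simp add: divide_le_eq self_le_power)
        then show "?u \<le> h0" using h by simp
        have "K * ?u \<le> K * h" using \<open>?u \<le> h\<close> h0(2) by (rule mult_left_mono)
        then show "K * ?u \<le> 1" using Kh by linarith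
      qed (use h in simp)
      have "1 / 2 \<le> 1 - real (2 ^ n) * (K * ?u)" using Kh by simp
      also have "\<dots> \<le> (1 - K * ?u) ^ (2 ^ n)" by (rule one_minus_le_power[OF mult_nonneg_nonneg[OF h0(2) u(1)] u(3)]) simp
      also have "\<dots> \<le> p ?u i i ^ (2 ^ n)" using u diag[of ?u i] by (intro power_mono) auto
      also have "\<dots> = prob (grid_path h n (\<lambda>_. i))"
        using pp[of ?u "\<lambda>_. i" "2 ^ n"] u by (simp add: grid_path_def)
      finally show ?thesis .
    qed
    have "(\<lambda>n. prob (grid_path h n (\<lambda>_. i))) \<longlonglongrightarrow> prob E"
      unfolding E_def
    proof (rule finite_Lim_measure_decseq)
      show "decseq (\<lambda>n. grid_path h n (\<lambda>_. i))"
      proof (rule decseq_SucI, rule subsetI)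
        fix n w assume w: "w \<in> grid_path h (Suc n) (\<lambda>_. i)"
        have "\<theta> (real k / 2 ^ n * h) w = i" if "k \<le> 2 ^ n" for k
        proof -
          have "\<theta> (real (2 * k) / 2 ^ Suc n * h) w = i" using w that unfolding grid_path_def by (auto dest: spec[of _ "2 * k"])
          then show ?thesis by simp
        qed
        then show "w \<in> grid_path h n (\<lambda>_. i)" using w by (simp add: grid_path_def)
      qed
    qed (use ev in auto)
    then have "1 / 2 \<le> prob E" by (rule LIMSEQ_le_const) (use ge in auto)
    moreover have "E \<in> sets CM" unfolding E_def using grid_path_CM[of h] h by (intro sets.countable_INT' image_subsetI) auto
    moreover have "\<theta> u w = i" if w: "w \<in> E" and u: "0 \<le> u" "u < h" for u w
    proof -
      have ws: "w \<in> space M" using w by (auto simp: E_def grid_path_def)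
      interpret steps "\<lambda>t. \<theta> t w" by unfold_locales (rule step[OF ws])
      obtain r where r: "r > u" "\<And>v. u \<le> v \<Longrightarrow> v < r \<Longrightarrow> \<theta> v w = \<theta> u w" using step_right[OF u(1)] by blast
      obtain n k where k: "u < real k / 2 ^ n * h" "real k / 2 ^ n * h < min r h"
        using dyadic_between[of u "min r h" h] u r(1) h by auto
      have "k \<le> 2 ^ n"
      proof -
        have "real k / 2 ^ n * h < h" using k(2) by simp
        then show ?thesis by (rule grid_index_le[OF h(1)])
      qed
      then have "\<theta> (real k / 2 ^ n * h) w = i" using w by (auto simp: E_def grid_path_def)
      then show ?thesis using r(2)[of "real k / 2 ^ n * h"] k by simp
    qed
    ultimately show ?thesis by (intro bexI[of _ E]) auto
  qed
  moreover have "0 < min h0 (1 / (2 * (K + 1)))" using h0 by simp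
  ultimately show ?thesis by blast
qed

text \<open>A path reading \<open>i\<close> up to grid index \<open>m\<close> and \<open>j\<close>
  afterwards has at least the probability of one transition times two factors \<open>1 / 2\<close>
  for waiting. The \<open>2 ^ n\<close> positions of the switch are disjoint, so the total is at
  least a fixed multiple of \<open>h\<close>, whatever the mesh. On the intersection over all meshes
  the chain passes from \<open>i\<close> to \<open>j\<close> without visiting other states.\<close>

lemma direct_jump_event:
  assumes ij: "i \<noteq> j" "0 < Q $ i $ j"
  shows "\<exists>h0>0. \<forall>h. 0 < h \<and> h \<le> h0 \<longrightarrow>
    (\<exists>E\<in>sets CM. 0 < prob E \<and> (\<forall>w\<in>E. \<exists>s. 0 < s \<and> s \<le> h \<and> \<theta> s w = j \<and> (\<forall>u. 0 \<le> u \<and> u < s \<longrightarrow> \<theta> u w = i)))"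
proof -
  obtain p :: "real \<Rightarrow> 'i \<Rightarrow> 'i \<Rightarrow> real" and K h0 :: real where h0: "0 < h0" "0 \<le> K"
    and diag: "\<And>h a. 0 \<le> h \<Longrightarrow> h \<le> h0 \<Longrightarrow> 1 - K * h \<le> p h a a"
    and off: "\<And>h a b. 0 \<le> h \<Longrightarrow> h \<le> h0 \<Longrightarrow> a \<noteq> b \<Longrightarrow> 0 < Q $ a $ b \<Longrightarrow> Q $ a $ b / 2 * h \<le> p h a b"
    and pp: "\<And>n u y. 0 \<le> u \<Longrightarrow> y 0 = i \<Longrightarrow>
        prob {w \<in> space M. \<forall>k\<le>n. \<theta> (real k * u) w = y k} = (\<Prod>k<n. p u (y k) (y (Suc k)))"
    by (rule transition_bounds) (rule that)
  have "\<exists>E\<in>sets CM. 0 < prob E \<and> (\<forall>w\<in>E. \<exists>s. 0 < s \<and> s \<le> h \<and> \<theta> s w = j \<and> (\<forall>u. 0 \<le> u \<and> u < s \<longrightarrow> \<theta> u w = i))"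
    if h: "0 < h" "h \<le> min h0 (1 / (2 * (K + 1)))" for h
  proof -
    have Kh: "K * h \<le> 1 / 2"
    proof -
      have "h \<le> 1 / (2 * (K + 1))" using h(2) by simp
      then have "h * (2 * (K + 1)) \<le> 1" using h0 by (subst (asm) pos_le_divide_eq) auto
      then show ?thesis using h(1) by (simp add: algebra_simps)
    qed
    define y where "y m k = (if k \<le> m then i else j)" for m k :: nat
    define D where "D n = (\<Union>m<2 ^ n. grid_path h n (y m))" for n
    define E where "E = (\<Inter>n. D n)"
    have gCM: "grid_path h n (y m) \<in> sets CM" for n m using grid_path_CM[of h] h by auto
    have DCM: "D n \<in> sets CM" for n unfolding D_def using gCM by (intro sets.finite_UN) auto
    have ge: "Q $ i $ j / 2 * h / 4 \<le> prob (D n)" for n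
    proof -
      let ?u = "h / 2 ^ n"
      have u: "0 \<le> ?u" "?u \<le> h0" "K * ?u \<le> 1"
      proof -
        have "?u \<le> h" using h by (simp add: divide_le_eq self_le_power)
        then show "?u \<le> h0" using h by simp
        have "K * ?u \<le> K * h" using \<open>?u \<le> h\<close> h0(2) by (rule mult_left_mono)
        then show "K * ?u \<le> 1" using Kh by linarith
      qed (use h in simp)
      have half: "1 / 2 \<le> p ?u a a ^ k" if "k \<le> 2 ^ n" for a k
      proof -
        have "1 / 2 \<le> 1 - real (2 ^ n) * (K * ?u)" using Kh by simp
        also have "\<dots> \<le> (1 - K * ?u) ^ k" by (rule one_minus_le_power[OF mult_nonneg_nonneg[OF h0(2) u(1)] u(3) that])
        also have "\<dots> \<le> p ?u a a ^ k" using u diag[of ?u a] by (intro power_mono) auto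
        finally show ?thesis .
      qed
      have one: "Q $ i $ j / 2 * ?u / 4 \<le> prob (grid_path h n (y m))" if m: "m < 2 ^ n" for m
      proof -
        have "prob (grid_path h n (y m)) = (\<Prod>k<2 ^ n. p ?u (y m k) (y m (Suc k)))"
          using pp[of ?u "y m" "2 ^ n"] u by (simp add: grid_path_def y_def)
        also have "{..<2 ^ n} = {..<m} \<union> {m} \<union> {Suc m..<2 ^ n}" using m by auto
        also have "(\<Prod>k\<in>{..<m} \<union> {m} \<union> {Suc m..<2 ^ n}. p ?u (y m k) (y m (Suc k))) =
            (\<Prod>k\<in>{..<m}. p ?u (y m k) (y m (Suc k))) * p ?u (y m m) (y m (Suc m)) * (\<Prod>k\<in>{Suc m..<2 ^ n}. p ?u (y m k) (y m (Suc k)))"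
        proof -
          have "(\<Prod>k\<in>{..<m} \<union> {m} \<union> {Suc m..<2 ^ n}. p ?u (y m k) (y m (Suc k))) =
            (\<Prod>k\<in>{..<m} \<union> {m}. p ?u (y m k) (y m (Suc k))) * (\<Prod>k\<in>{Suc m..<2 ^ n}. p ?u (y m k) (y m (Suc k)))"
            by (rule prod.union_disjoint) auto
          also have "(\<Prod>k\<in>{..<m} \<union> {m}. p ?u (y m k) (y m (Suc k))) =
            (\<Prod>k\<in>{..<m}. p ?u (y m k) (y m (Suc k))) * (\<Prod>k\<in>{m}. p ?u (y m k) (y m (Suc k)))"
            by (rule prod.union_disjoint) auto
          finally show ?thesis by simp
        qed
        also have "\<dots> = p ?u i i ^ m * p ?u i j * p ?u j j ^ (2 ^ n - Suc m)"
          by (simp add: y_def)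
        also have "\<dots> \<ge> (1 / 2) * (Q $ i $ j / 2 * ?u) * (1 / 2)"
        proof -
          have q: "0 \<le> Q $ i $ j / 2 * ?u" using ij(2) u(1) by (intro mult_nonneg_nonneg) auto
          have le: "Q $ i $ j / 2 * ?u \<le> p ?u i j" by (rule off[OF u(1,2) ij])
          have 1: "1 / 2 \<le> p ?u i i ^ m" by (rule half) (use m in simp)
          have 2: "1 / 2 \<le> p ?u j j ^ (2 ^ n - Suc m)" by (rule half) simp
          have "(1 / 2) * (Q $ i $ j / 2 * ?u) \<le> p ?u i i ^ m * p ?u i j"
            by (rule mult_mono[OF 1 le _ q]) (use 1 in linarith)
          then show ?thesis
            by (rule mult_mono[OF _ 2]) (use 1 le q in \<open>auto intro!: mult_nonneg_nonneg elim: order_trans[rotated]\<close>)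
        qed
        finally show ?thesis by simp
      qed
      have "Q $ i $ j / 2 * h / 4 = (\<Sum>m<2 ^ n::nat. Q $ i $ j / 2 * ?u / 4)" by simp
      also have "\<dots> \<le> (\<Sum>m<2 ^ n. prob (grid_path h n (y m)))" by (intro sum_mono one) simp
      also have "\<dots> = prob (D n)" unfolding D_def
      proof (rule finite_measure_finite_Union[symmetric])
        have no: False if "m < m'" "m' < 2 ^ n" "w \<in> grid_path h n (y m)" "w \<in> grid_path h n (y m')" for m m' w
        proof -
          have "\<theta> (real m' / 2 ^ n * h) w = y m m'" "\<theta> (real m' / 2 ^ n * h) w = y m' m'"
            using that(2-4) unfolding grid_path_def by auto
          then show False using that(1) ij(1) by (simp add: y_def)
        qed
        show "disjoint_family_on (\<lambda>m. grid_path h n (y m)) {..<2 ^ n}"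
          unfolding disjoint_family_on_def
        proof (intro ballI impI)
          fix m m' :: nat assume m: "m \<in> {..<2 ^ n}" "m' \<in> {..<2 ^ n}" "m \<noteq> m'"
          then consider "m < m'" | "m' < m" by linarith
          then show "grid_path h n (y m) \<inter> grid_path h n (y m') = {}"
            using no m by cases (blast dest: lessThan_iff[THEN iffD1])+
        qed
      qed (use gCM CM_events in auto)
      finally show ?thesis .
    qed
    have mem: "w \<in> D n \<longleftrightarrow> w \<in> space M \<and> (\<exists>m<2 ^ n. \<forall>k\<le>2 ^ n. \<theta> (real k / 2 ^ n * h) w = y m k)" for w n
      by (auto simp: D_def grid_path_def)
    have "(\<lambda>n. prob (D n)) \<longlonglongrightarrow> prob E"
      unfolding E_def
    proof (rule finite_Lim_measure_decseq)
      show "decseq D"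
      proof (rule decseq_SucI, rule subsetI)
        fix n w assume "w \<in> D (Suc n)"
        then obtain m where w: "w \<in> space M" and m: "m < 2 ^ Suc n" "\<And>k. k \<le> 2 ^ Suc n \<Longrightarrow> \<theta> (real k / 2 ^ Suc n * h) w = y m k"
          unfolding mem by blast
        \<comment> \<open>The coarser grid keeps the even indices, so the last index in state
          \<open>i\<close> is halved and rounded down.\<close>
        have "\<theta> (real k / 2 ^ n * h) w = y (m div 2) k" if "k \<le> 2 ^ n" for k
        proof -
          have "\<theta> (real (2 * k) / 2 ^ Suc n * h) w = y m (2 * k)" using that by (intro m(2)) simp
          then show ?thesis by (simp add: y_def) (auto split: if_splits)
        qed
        moreover have "m div 2 < 2 ^ n" using m(1) by auto
        ultimately show "w \<in> D n" unfolding mem using w by blast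
      qed
    qed (use DCM CM_events in auto)
    then have "Q $ i $ j / 2 * h / 4 \<le> prob E" by (rule LIMSEQ_le_const) (use ge in auto)
    moreover have "0 < Q $ i $ j / 2 * h / 4" using ij h by simp
    ultimately have pos: "0 < prob E" by linarith
    have ECM: "E \<in> sets CM" unfolding E_def using DCM by (intro sets.countable_INT' image_subsetI) auto
    have "\<exists>s. 0 < s \<and> s \<le> h \<and> \<theta> s w = j \<and> (\<forall>u. 0 \<le> u \<and> u < s \<longrightarrow> \<theta> u w = i)" if w: "w \<in> E" for w
    proof -
      have wD: "w \<in> D n" for n using w by (simp add: E_def)
      have ws: "w \<in> space M" using wD[of 0] mem by blast
      interpret steps "\<lambda>t. \<theta> t w" by unfold_locales (rule step[OF ws])
      have ex: "\<exists>m<2 ^ n. \<forall>k\<le>2 ^ n. \<theta> (real k / 2 ^ n * h) w = y m k" for n using wD[of n] mem by blast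
      have end_j: "\<theta> h w = j"
      proof -
        obtain m where "m < 2 ^ 0" "\<theta> (real 1 / 2 ^ 0 * h) w = y m 1" using ex[of 0] by auto
        then show ?thesis by (simp add: y_def)
      qed
      have dich: "\<theta> (real k / 2 ^ n * h) w = i \<or> \<theta> (real k / 2 ^ n * h) w = j" if "k \<le> 2 ^ n" for k n
        using ex[of n] that by (auto simp: y_def split: if_splits)
      \<comment> \<open>Both dyadic times lie on a common refinement, where the pattern is first
        \<open>i\<close>, then \<open>j\<close>.\<close>
      have up: "\<theta> (real k' / 2 ^ n' * h) w = j"
        if k: "k \<le> 2 ^ n" "k' \<le> 2 ^ n'" "real k / 2 ^ n \<le> real k' / 2 ^ n'" and j: "\<theta> (real k / 2 ^ n * h) w = j" for k n k' n'
      proof -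
        obtain m where m: "\<And>l. l \<le> 2 ^ (n + n') \<Longrightarrow> \<theta> (real l / 2 ^ (n + n') * h) w = y m l" using ex[of "n + n'"] by blast
        have le: "k * 2 ^ n' \<le> 2 ^ (n + n')" "k' * 2 ^ n \<le> 2 ^ (n + n')"
          using k(1,2) by (simp_all add: power_add mult.commute)
        have e: "real (k * 2 ^ n') / 2 ^ (n + n') = real k / 2 ^ n" "real (k' * 2 ^ n) / 2 ^ (n + n') = real k' / 2 ^ n'"
          by (simp_all add: power_add)
        have "real (k * 2 ^ n') \<le> real (k' * 2 ^ n)" using k(3) by (simp add: field_simps)
        then have "k * 2 ^ n' \<le> k' * 2 ^ n" by (simp only: of_nat_le_iff)
        moreover have "y m (k * 2 ^ n') = j" using m[OF le(1), unfolded e(1)] j by (simp only:)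
        ultimately have "y m (k' * 2 ^ n) = j" using ij(1) by (auto simp: y_def split: if_splits)
        then show ?thesis using m[OF le(2), unfolded e(2)] by (simp only:)
      qed
      define T where "T = {t. \<exists>k n. k \<le> 2 ^ n \<and> t = real k / 2 ^ n * h \<and> \<theta> t w = j}"
      have hT: "h \<in> T" unfolding T_def using end_j by (intro CollectI exI[of _ 1] exI[of _ 0]) simp
      have T0: "0 \<le> t" if "t \<in> T" for t using that h by (auto simp: T_def)
      have bdd: "bdd_below T" using T0 by (intro bdd_belowI) auto
      \<comment> \<open>The transition takes place at the infimum of the dyadic times in state
        \<open>j\<close>: earlier dyadic times are in \<open>i\<close>, later ones in
        \<open>j\<close>, and right-continuity settles the remaining times, including
        \<open>s\<close>.\<close>
      define s where "s = Inf T"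
      have sh: "s \<le> h" unfolding s_def by (rule cInf_lower[OF hT bdd])
      have s0: "0 \<le> s" unfolding s_def using hT T0 by (intro cInf_greatest) auto
      have before: "\<theta> u w = i" if u: "0 \<le> u" "u < s" for u
      proof -
        obtain r where r: "r > u" "\<And>v. u \<le> v \<Longrightarrow> v < r \<Longrightarrow> \<theta> v w = \<theta> u w" using step_right[OF u(1)] by blast
        obtain n k where k: "u < real k / 2 ^ n * h" "real k / 2 ^ n * h < min r s"
          using dyadic_between[of u "min r s" h] u r(1) h by auto
        have k2: "k \<le> 2 ^ n"
        proof -
          have "real k / 2 ^ n * h < h" using k(2) sh by simp
          then show ?thesis by (rule grid_index_le[OF h(1)])
        qed
        have "\<theta> (real k / 2 ^ n * h) w \<noteq> j"
        proof
          assume "\<theta> (real k / 2 ^ n * h) w = j"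
          then have "real k / 2 ^ n * h \<in> T" unfolding T_def using k2 by blast
          then have "s \<le> real k / 2 ^ n * h" unfolding s_def by (rule cInf_lower[OF _ bdd])
          then show False using k(2) by simp
        qed
        then have "\<theta> (real k / 2 ^ n * h) w = i" using dich[OF k2] by blast
        then show ?thesis using r(2)[of "real k / 2 ^ n * h"] k by simp
      qed
      have at_s: "\<theta> s w = j"
      proof (cases "s = h")
        case False
        then have "s < h" using sh by simp
        obtain r where r: "r > s" "\<And>v. s \<le> v \<Longrightarrow> v < r \<Longrightarrow> \<theta> v w = \<theta> s w" using step_right[OF s0] by blast
        obtain n' k' where k': "s < real k' / 2 ^ n' * h" "real k' / 2 ^ n' * h < min r h"
          using dyadic_between[of s "min r h" h] s0 r(1) h \<open>s < h\<close> by auto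
        have k2': "k' \<le> 2 ^ n'"
        proof -
          have "real k' / 2 ^ n' * h < h" using k'(2) by simp
          then show ?thesis by (rule grid_index_le[OF h(1)])
        qed
        obtain t where t: "t \<in> T" "t < real k' / 2 ^ n' * h"
          using cInf_lessD[of T "real k' / 2 ^ n' * h"] hT k'(1) unfolding s_def by blast
        then obtain k n where k: "k \<le> 2 ^ n" "t = real k / 2 ^ n * h" "\<theta> t w = j" unfolding T_def by blast
        have "real k / 2 ^ n * h \<le> real k' / 2 ^ n' * h" using t(2) k(2) by simp
        then have le: "real k / 2 ^ n \<le> real k' / 2 ^ n'" by (rule mult_right_le_imp_le) (rule h(1))
        have "\<theta> (real k' / 2 ^ n' * h) w = j"
          by (rule up[OF k(1) k2' le]) (use k in simp)
        then show ?thesis using r(2)[of "real k' / 2 ^ n' * h"] k' by simp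
      qed (use end_j in simp)
      have "s \<noteq> 0" using at_s \<theta>_0[OF ws] ij(1) by metis
      then show ?thesis using s0 sh at_s before by (intro exI[of _ s]) auto
    qed
    with ECM pos show ?thesis by blast
  qed
  moreover have "0 < min h0 (1 / (2 * (K + 1)))" using h0 by simp
  ultimately show ?thesis by blast
qed

end

section \<open>Small jumps of a given type\<close>

text \<open>\<open>Z\<close> is prescribed at nonnegative times only, so regularity has to pass
  between paths that agree there.\<close>

lemma regular_path_cong:
  assumes "regular_path z" "\<And>t. 0 \<le> t \<Longrightarrow> z' t = z t"
  shows "regular_path z'"
proof -
  have o: "ordinate z' t = ordinate z t" if "0 \<le> t" for t using assms(2)[OF that] by (simp add: ordinate_def)
  have right: "\<forall>\<^sub>F u in at_right t. z' u = z u \<and> ordinate z' u = ordinate z u" if "0 \<le> t" for t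
    unfolding eventually_at_right_field using that assms(2) o by (intro exI[of _ "t + 1"]) auto
  have left: "\<forall>\<^sub>F u in at_left t. ordinate z u = ordinate z' u" if "0 < t" for t
    unfolding eventually_at_left_field using that o by (intro exI[of _ 0]) auto
  show ?thesis
    unfolding regular_path_def
  proof (intro conjI allI impI)
    show "z' 0 \<noteq> None" using assms unfolding regular_path_def by force
  next
    fix t :: real assume t: "0 \<le> t" "z' t \<noteq> None"
    then have zt: "z t \<noteq> None" using assms(2) by simp
    have r: "(\<forall>s\<in>{0..t}. z s \<noteq> None)" "(\<forall>\<^sub>F u in at_right t. z u \<noteq> None)" "(ordinate z \<longlongrightarrow> ordinate z t) (at_right t)"
      using assms(1) t(1) zt unfolding regular_path_def by blast+
    show "\<forall>s\<in>{0..t}. z' s \<noteq> None"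
    proof
      fix s assume s: "s \<in> {0..t}"
      then show "z' s \<noteq> None" using r(1) assms(2)[of s] by simp
    qed
    show "\<forall>\<^sub>F u in at_right t. z' u \<noteq> None" using r(2) right[OF t(1)] by eventually_elim simp
    have "\<forall>\<^sub>F u in at_right t. ordinate z u = ordinate z' u" using right[OF t(1)] by eventually_elim simp
    with r(3) show "(ordinate z' \<longlongrightarrow> ordinate z' t) (at_right t)"
      unfolding o[OF t(1)] by (rule Lim_transform_eventually)
  next
    fix t :: real assume t: "0 < t" "z' t \<noteq> None"
    then have "z t \<noteq> None" using assms(2) by simp
    then obtain l where "(ordinate z \<longlongrightarrow> l) (at_left t)" using assms(1) t(1) unfolding regular_path_def by blast
    then show "\<exists>l. (ordinate z' \<longlongrightarrow> l) (at_left t)" using Lim_transform_eventually[OF _ left[OF t(1)]] by blast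
  qed
qed

text \<open>At \<open>\<epsilon> = 0\<close> the expression is \<open>1 - exp (- b)\<close>. It
  bounds the size of a jump in the exponential scale when the ordinate is within
  \<open>K * \<epsilon>\<close> of \<open>0\<close> just before and then drops by at most
  \<open>b + 2 * (K * \<epsilon>)\<close>.\<close>

lemma exponential_margin:
  fixes b c K :: real
  assumes "0 < c"
  shows "\<exists>\<epsilon>>0. \<epsilon> \<le> c \<and> exp (K * \<epsilon>) - exp (- 3 * (K * \<epsilon>) - b) < 1"
proof -
  have "((\<lambda>\<epsilon>. exp (K * \<epsilon>) - exp (- 3 * (K * \<epsilon>) - b)) \<longlongrightarrow> exp (K * 0) - exp (- 3 * (K * 0) - b)) (at_right 0)"
    by (intro tendsto_intros)
  then have "\<forall>\<^sub>F \<epsilon> in at_right 0. exp (K * \<epsilon>) - exp (- 3 * (K * \<epsilon>) - b) < 1"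
    by (rule order_tendstoD) simp
  then obtain r where r: "0 < r" "\<And>\<epsilon>. 0 < \<epsilon> \<Longrightarrow> \<epsilon> < r \<Longrightarrow> exp (K * \<epsilon>) - exp (- 3 * (K * \<epsilon>) - b) < 1"
    unfolding eventually_at_right_field by blast
  then show ?thesis using assms by (intro exI[of _ "min c (r / 2)"] conjI r(2)) auto
qed

text \<open>Countably many bounded intervals away from \<open>0\<close> exhaust the negative
  half-line. Both bounds matter later: \<open>c\<close> separates the jump from small fluctuations,
  and \<open>b\<close> limits its size.\<close>

lemma negative_mass_bounded:
  fixes N :: "real measure"
  assumes "sets N = sets borel" "0 < emeasure N {..<0}"
  shows "\<exists>b c. 0 < c \<and> c \<le> b \<and> 0 < emeasure N {- b<..<- c}"
proof (rule ccontr)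
  assume no: "\<not> ?thesis"
  have "{- real (Suc n + 1)<..<- (1 / real (Suc n))} \<in> null_sets N" for n
  proof -
    have "1 / real (Suc n) \<le> 1" "1 \<le> real (Suc n + 1)" by simp_all
    then have "0 < 1 / real (Suc n)" "1 / real (Suc n) \<le> real (Suc n + 1)" by (simp, rule order_trans)
    with no have "emeasure N {- real (Suc n + 1)<..<- (1 / real (Suc n))} = 0" by (metis not_gr_zero)
    then show ?thesis using assms(1) by (simp add: null_sets_def)
  qed
  then have "(\<Union>n. {- real (Suc n + 1)<..<- (1 / real (Suc n))}) \<in> null_sets N" by (intro null_sets_UN) 
  moreover have "{..<0} \<subseteq> (\<Union>n. {- real (Suc n + 1)<..<- (1 / real (Suc n))})"
  proof
    fix x :: real assume "x \<in> {..<0}"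
    then have x: "x < 0" by simp
    obtain n1 where n1: "inverse (real (Suc n1)) < - x" using reals_Archimedean[of "- x"] x by auto
    obtain n2 :: nat where n2: "- x < real n2" using reals_Archimedean2 by blast
    define n where "n = max n1 n2"
    have "inverse (real (Suc n)) \<le> inverse (real (Suc n1))" by (simp add: n_def)
    with n1 have "x < - (1 / real (Suc n))" by (simp only: inverse_eq_divide)
    moreover have "- real (Suc n + 1) < x" using n2 by (simp add: n_def)
    ultimately have "x \<in> {- real (Suc n + 1)<..<- (1 / real (Suc n))}" by (simp only: greaterThanLessThan_iff)
    then show "x \<in> (\<Union>n. {- real (Suc n + 1)<..<- (1 / real (Suc n))})" by (rule UN_I[OF UNIV_I])
  qed
  ultimately have "emeasure N {..<0} \<le> 0" using emeasure_mono[of "{..<0}" "(\<Union>n. {- real (Suc n + 1)<..<- (1 / real (Suc n))})" N]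
    by (auto simp: null_sets_def)
  then show False using assms(2) by simp
qed

lemma eventually_mesh_le: "0 < h \<Longrightarrow> \<forall>\<^sub>F N in sequentially. 1 / 2 ^ N \<le> (h :: real)"
proof -
  assume "0 < h"
  have "(\<lambda>N. (1 / 2 :: real) ^ N) \<longlonglongrightarrow> 0" by (intro LIMSEQ_realpow_zero) auto
  from order_tendstoD(2)[OF this \<open>0 < h\<close>] show ?thesis by eventually_elim (simp add: power_one_over less_imp_le)
qed

locale map_law = prob_space M for M :: "'w measure" +
  fixes Q :: "real^'i::finite^'i" and \<psi> \<Lambda> \<Lambda>U and i :: 'i and \<theta> Y e U TU and Z :: "real \<Rightarrow> 'w \<Rightarrow> (real \<times> 'i) option" and D :: "real \<Rightarrow> 'w \<Rightarrow> 'i" and \<alpha> :: real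
  assumes ms: "map_sources Q \<psi> \<Lambda> \<Lambda>U M i \<theta> Y e U TU"
    and Z: "\<And>w t. w \<in> space M \<Longrightarrow> 0 \<le> t \<Longrightarrow> Z t w = build_path (\<lambda>t. \<theta> t w) (\<lambda>j k t. Y j k t w) (\<lambda>j. e j w) (\<lambda>n a b. U n a b w) t"
    and D: "\<And>w s. w \<in> space M \<Longrightarrow> 0 < s \<Longrightarrow> D s w = build_marks (\<lambda>t. \<theta> t w) (\<lambda>j k t. Y j k t w) (\<lambda>n a b. TU n a b w) s"
begin

abbreviation dY :: "'i \<Rightarrow> 'i \<Rightarrow> 'w \<Rightarrow> real \<Rightarrow> real" where
  "dY a k w \<equiv> jump (\<lambda>t. Y a k t w)"

abbreviation cj :: "'w \<Rightarrow> real set" where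
  "cj w \<equiv> chain_jumps (\<lambda>t. \<theta> t w)"

abbreviation occ :: "'w \<Rightarrow> 'i \<Rightarrow> real \<Rightarrow> real" where
  "occ w \<equiv> occupation (\<lambda>t. \<theta> t w)"

abbreviation path :: "'w \<Rightarrow> 'i marked_path" where
  "path w \<equiv> ssmp \<alpha> Z D 1 w"

sublocale chain M Q i \<theta>
  using ms by unfold_locales (simp add: map_sources_def)

lemma levy_Y: "levy M (Y j k)"
  using ms by unfold_locales (simp add: map_sources_def)

lemma sources_path:
  assumes "w \<in> space M"
  shows "sources (\<lambda>t. \<theta> t w) (\<lambda>j k t. Y j k t w) (\<lambda>j. e j w)"
proof
  show "step_path (\<lambda>t. \<theta> t w)" by (rule step[OF assms])
  show "cadlag (\<lambda>t. Y j k t w)" "Y j k 0 w = 0" for j k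
    using levy.Y_cadlag[OF levy_Y assms] levy.Y_0[OF levy_Y assms] by blast+
  show "0 < e j w" for j using ms assms by (simp add: map_sources_def)
qed

lemma regular_Z: "w \<in> space M \<Longrightarrow> regular_path (\<lambda>t. Z t w)"
  by (rule regular_path_cong[OF sources.regular_z[OF sources_path]]) (use Z in auto)

lemma Z_0: "w \<in> space M \<Longrightarrow> Z 0 w = Some (0, i)"
  using sources.z_0[OF sources_path, of w "\<lambda>n a b. U n a b w"] Z[of w 0] \<theta>_0[of w] by simp

lemma start:
  assumes "w \<in> space M" "0 < x"
  shows "fst (ssmp \<alpha> Z D x w) 0 = Some (x, i)"
proof -
  interpret regular \<alpha> "\<lambda>t. Z t w" by unfold_locales (rule regular_Z[OF assms(1)])
  show ?thesis unfolding ssmp_def lamperti_0[OF assms(2)] by (simp add: Z_0[OF assms(1)])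
qed

text \<open>The jump of the ordinate at \<open>s\<close>, in the form given by
  \<open>\<xi>_left\<close>.\<close>

definition \<Delta> :: "'w \<Rightarrow> real \<Rightarrow> real" where
  "\<Delta> w s = (let l = left_state (\<lambda>t. \<theta> t w) s in
     (if s \<in> cj w
      then U (card (cj w \<inter> {0<..<s})) l (\<theta> s w) w else 0) +
     (\<Sum>k\<in>UNIV. dY l k w (occ w l s)))"

definition X :: "'w \<Rightarrow> real \<Rightarrow> real" where
  "X w s = ordinate (\<lambda>t. Z t w) s"

lemma X_left:
  assumes w: "w \<in> space M" and s: "0 < s" "Z s w \<noteq> None"
  shows "(ordinate (\<lambda>t. Z t w) \<longlongrightarrow> X w s - \<Delta> w s) (at_left s)"
proof -
  interpret S: sources "\<lambda>t. \<theta> t w" "\<lambda>j k t. Y j k t w" "\<lambda>j. e j w" "\<lambda>n a b. U n a b w" by (rule sources_path[OF w])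
  have zs: "S.z s \<noteq> None" using Z[OF w, of s] s by simp
  have d: "(if s \<in> cj w then S.V s else 0) +
      (\<Sum>k\<in>UNIV. jump (\<lambda>t. Y (left_state (\<lambda>t. \<theta> t w) s) k t w) (occ w (left_state (\<lambda>t. \<theta> t w) s) s)) = \<Delta> w s"
    by (simp add: \<Delta>_def Let_def S.V_def)
  have "(ordinate S.z \<longlongrightarrow> S.\<xi> s - \<Delta> w s) (at_left s)"
    using S.ordinate_left[OF s(1) zs S.\<xi>_left(2)[OF s(1)]] unfolding d .
  moreover have "\<forall>\<^sub>F u in at_left s. ordinate S.z u = ordinate (\<lambda>t. Z t w) u"
    unfolding eventually_at_left_field using s Z[OF w] by (intro exI[of _ 0]) (simp add: ordinate_def)
  moreover have "X w s = S.\<xi> s" using S.ordinate_z[OF zs] Z[OF w, of s] s by (simp add: X_def ordinate_def)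
  ultimately show ?thesis by (simp add: Lim_transform_eventually)
qed

lemma ssmp_jump:
  assumes w: "w \<in> space M" and s: "0 < s" "Z s w \<noteq> None"
  shows "\<exists>t>0. alive (path w) t \<and> snd (path w) t = D s w \<and>
    jump (pos (path w)) t = exp (X w s) - exp (X w s - \<Delta> w s)"
proof -
  interpret regular \<alpha> "\<lambda>t. Z t w" by unfold_locales (rule regular_Z[OF w])
  have "0 < clock s" using clock_less[of 0 s] s clock_0 by simp
  then show ?thesis
    unfolding ssmp_def X_def
    using lamperti_clock(1,3)[of s "\<lambda>s. D s w"] jump_lamperti[OF s X_left[OF w s], of "\<lambda>s. D s w"] s
    by (intro exI[of _ "clock s"]) (simp add: X_def)
qed

text \<open>Every living time of the cell is a value of the clock, so excluding jumps of the
  additive process excludes jumps of the cell. \<open>ssmp_jump\<close> serves the opposite purpose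
  of exhibiting them.\<close>

lemma ssmp_jump_converse:
  assumes w: "w \<in> space M" and t: "0 < t" "alive (path w) t"
  shows "\<exists>s>0. Z s w \<noteq> None \<and> snd (path w) t = D s w \<and>
    jump (pos (path w)) t = exp (X w s) - exp (X w s - \<Delta> w s)"
proof -
  interpret regular \<alpha> "\<lambda>t. Z t w" by unfold_locales (rule regular_Z[OF w])
  obtain s where s: "0 < s" "Z s w \<noteq> None" "t = clock s" using alive_lamperti[OF t(1), of "\<lambda>s. D s w"] t(2) unfolding ssmp_def by blast
  then show ?thesis
    unfolding ssmp_def X_def
    using lamperti_clock(1,3)[of s "\<lambda>s. D s w"] jump_lamperti[OF s(1,2) X_left[OF w s(1,2)], of "\<lambda>s. D s w"]
    by (intro exI[of _ s]) (simp add: X_def)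
qed

section \<open>Independence of the sources and null events\<close>

lemma indep: "indep_sets (source_events M \<theta> Y e U TU) UNIV"
  using ms by (simp add: map_sources_def)

lemma source_event: "A \<in> source_events M \<theta> Y e U TU r \<Longrightarrow> A \<in> events"
  using indep unfolding indep_sets_def by blast

lemma indep_pair:
  assumes "r \<noteq> r'" "A \<in> source_events M \<theta> Y e U TU r" "B \<in> source_events M \<theta> Y e U TU r'"
  shows "prob (A \<inter> B) = prob A * prob B"
  using indep_setsD[OF indep, of "{r, r'}" "\<lambda>s. if s = r then A else B"] assms by (auto simp: Int_commute)

text \<open>Outside transitions the mark of a jump is a choice among the components that jump;
  almost surely there is at most one candidate.\<close>

lemma no_simultaneous_jumps:
  "AE w in M. \<forall>a k k'. k \<noteq> k' \<longrightarrow> (\<forall>s>0. dY a k w s = 0 \<or> dY a k' w s = 0)"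
proof -
  have "AE w in M. k \<noteq> k' \<longrightarrow> (\<forall>s>0. dY a k w s = 0 \<or> dY a k' w s = 0)" for a k k'
  proof (cases "k = k'")
    case False
    have "AE w in M. \<forall>s>0. dY a k w s = 0 \<or> dY a k' w s = 0"
    proof (rule no_common_jumps[OF levy_Y levy_Y])
      fix A B assume "A \<in> path_events M borel (Y a k)" "B \<in> path_events M borel (Y a k')"
      then show "prob (A \<inter> B) = prob A * prob B"
        using False by (intro indep_pair[of "Levy a k" "Levy a k'"]) (simp_all add: source_events_def)
    qed
    then show ?thesis by simp
  qed simp
  then show ?thesis unfolding AE_all_countable by blast
qed

text \<open>Occupation times at fixed times depend on the chain alone and are independent of each
  Levy process. Rational times suffice, because after the chain has left a state the occupation time
  of that state is frozen on an interval.\<close>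

lemma no_jump_at_occupation:
  "AE w in M. \<forall>a k. \<forall>q::rat. 0 \<le> q \<longrightarrow> 0 < occ w a (real_of_rat q) \<longrightarrow>
     dY a k w (occ w a (real_of_rat q)) = 0"
proof -
  have "AE w in M. 0 \<le> q \<longrightarrow> 0 < occ w a (real_of_rat q) \<longrightarrow>
     dY a k w (occ w a (real_of_rat q)) = 0" for a k and q :: rat
  proof (cases "0 \<le> q")
    case True
    let ?\<tau> = "\<lambda>w. occ w a (real_of_rat q)"
    have m: "?\<tau> \<in> borel_measurable CM" by (rule occupation_CM) (use True in simp)
    have c: "{w \<in> space M. b < ?\<tau> w \<and> ?\<tau> w \<le> c} \<in> sets CM" for b c
    proof -
      have "?\<tau> -` {b<..c} \<inter> space CM \<in> sets CM" by (rule measurable_sets[OF m]) simp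
      moreover have "?\<tau> -` {b<..c} \<inter> space CM = {w \<in> space M. b < ?\<tau> w \<and> ?\<tau> w \<le> c}" by (auto simp: space_CM)
      ultimately show ?thesis by simp
    qed
    interpret L: levy M "Y a k" by (rule levy_Y)
    have "AE w in M. 0 < ?\<tau> w \<longrightarrow> dY a k w (?\<tau> w) = 0"
    proof (rule L.no_jump_at_independent_time)
      show "{w \<in> space M. b < ?\<tau> w \<and> ?\<tau> w \<le> c} \<in> events" for b c by (rule CM_events[OF c])
      fix b c B assume "B \<in> sets L.PM"
      then show "prob ({w \<in> space M. b < ?\<tau> w \<and> ?\<tau> w \<le> c} \<inter> B) = prob {w \<in> space M. b < ?\<tau> w \<and> ?\<tau> w \<le> c} * prob B"
        using c[of b c] by (intro indep_pair[of Chain "Levy a k"]) (simp_all add: source_events_def sets_CM L.sets_PM)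
    qed
    then show ?thesis by eventually_elim simp
  qed simp
  then show ?thesis unfolding AE_all_countable by blast
qed

text \<open>The Levy measure is the integral of a count that is not known to be measurable and stops
  at time \<open>1\<close>. A jump at an arbitrary time is therefore first converted by
  \<open>early_jump\<close> into an event \<open>F\<close> of positive probability with a jump
  before time \<open>1\<close>; its indicator is a measurable minorant of the count.\<close>

lemma no_negative_levy_jumps:
  assumes "emeasure (\<Lambda> a k) {..<0} = 0"
  shows "AE w in M. \<forall>s>0. \<not> dY a k w s < 0"
proof -
  interpret L: levy M "Y a k" by (rule levy_Y)
  have LM: "sets (\<Lambda> a k) = sets borel"
    "\<And>A. A \<in> sets borel \<Longrightarrow> 0 \<notin> A \<Longrightarrow> emeasure (\<Lambda> a k) A =
      (\<integral>\<^sup>+ w. emeasure (count_space UNIV) {s. 0 < s \<and> s \<le> 1 \<and> dY a k w s \<in> A} \<partial>M)"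
    using ms by (auto simp: map_sources_def has_levy_measure_def)
  have "AE w in M. \<forall>s>0. dY a k w s \<notin> {- real (Suc n)<..<- (1 / real (Suc n))}" for n
  proof (rule ccontr)
    assume no: "\<not> ?thesis"
    define c where "c = 1 / real (Suc n)"
    define b where "b = real (Suc n)"
    have c: "0 < c" by (simp add: c_def)
    have A: "open {- b<..<- c}" "closed {- b..- c}" "{- b<..<- c} \<subseteq> {- b..- c}" by auto
    have A3: "3 * (c / 3) \<le> \<bar>x\<bar>" if "x \<in> {- b..- c}" for x using that by auto
    have A4: "0 < c / 3" using c by simp
    obtain N F where F: "F \<in> sets L.PM" "0 < prob F"
      "\<forall>w\<in>F. \<exists>s>0. s \<le> 1 / 2 ^ N \<and> dY a k w s \<in> {- b..- c} \<and> \<bar>Y a k s w - dY a k w s\<bar> \<le> c / 3"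
      using L.early_jump[OF A A3 A4 no[folded c_def b_def]] by blast
    have "emeasure M F = (\<integral>\<^sup>+ w. indicator F w \<partial>M)" using L.PM_events[OF F(1)] by simp
    also have "\<dots> \<le> (\<integral>\<^sup>+ w. emeasure (count_space UNIV) {s. 0 < s \<and> s \<le> 1 \<and> dY a k w s \<in> {- b..- c}} \<partial>M)"
    proof (rule nn_integral_mono)
      fix w
      show "indicator F w \<le> emeasure (count_space UNIV) {s. 0 < s \<and> s \<le> 1 \<and> dY a k w s \<in> {- b..- c}}"
      proof (cases "w \<in> F")
        case True
        then obtain s where s: "0 < s" "s \<le> 1 / 2 ^ N" "dY a k w s \<in> {- b..- c}" using F(3) by blast
        have "(1::real) / 2 ^ N \<le> 1" by simp
        with s(2) have "s \<le> 1" by (rule order_trans)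
        with s have "{s} \<subseteq> {s. 0 < s \<and> s \<le> 1 \<and> dY a k w s \<in> {- b..- c}}" by auto
        then have "emeasure (count_space UNIV) {s} \<le> emeasure (count_space UNIV) {s. 0 < s \<and> s \<le> 1 \<and> dY a k w s \<in> {- b..- c}}"
          by (rule emeasure_mono) simp
        then show ?thesis using True by simp
      qed simp
    qed
    also have "\<dots> = emeasure (\<Lambda> a k) {- b..- c}" using c by (intro LM(2)[symmetric]) auto
    also have "\<dots> \<le> emeasure (\<Lambda> a k) {..<0}" using c LM(1) by (intro emeasure_mono) auto
    finally show False using assms F(2) by (simp add: emeasure_eq_measure)
  qed
  then have "AE w in M. \<forall>n. \<forall>s>0. dY a k w s \<notin> {- real (Suc n)<..<- (1 / real (Suc n))}"
    unfolding AE_all_countable by blast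
  then show ?thesis
  proof eventually_elim
    case (elim w)
    show ?case
    proof (intro allI impI notI)
      fix s :: real assume s: "0 < s" and neg: "dY a k w s < 0"
      define x where "x = dY a k w s"
      obtain n1 where n1: "inverse (real (Suc n1)) < - x" using reals_Archimedean[of "- x"] neg by (auto simp: x_def)
      obtain n2 :: nat where n2: "- x < real n2" using reals_Archimedean2 by blast
      define n where "n = max n1 n2"
      have "inverse (real (Suc n)) \<le> inverse (real (Suc n1))" by (simp add: n_def)
      with n1 have "x < - (1 / real (Suc n))" by (simp only: inverse_eq_divide)
      moreover have "- real (Suc n) < x" using n2 by (simp add: n_def)
      ultimately show False using elim s by (auto simp: x_def simp del: of_nat_Suc)
    qed
  qed
qed

lemma special_event:
  assumes A: "A \<in> sets borel"
  shows "{w \<in> space M. U n a b w \<in> A \<and> TU n a b w = k} \<in> source_events M \<theta> Y e U TU (Special n a b)"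
proof -
  have "A \<times> {k} \<in> sets (borel \<Otimes>\<^sub>M count_space UNIV)" using A by (intro pair_measureI) auto
  then have "(\<lambda>w. (U n a b w, TU n a b w)) -` (A \<times> {k}) \<inter> space M \<in> source_events M \<theta> Y e U TU (Special n a b)"
    by (simp add: source_events_def in_vimage_algebra)
  moreover have "(\<lambda>w. (U n a b w, TU n a b w)) -` (A \<times> {k}) \<inter> space M = {w \<in> space M. U n a b w \<in> A \<and> TU n a b w = k}" by auto
  ultimately show ?thesis by simp
qed

lemma emeasure_special: "A \<in> sets borel \<Longrightarrow> emeasure M {w \<in> space M. U n a b w \<in> A \<and> TU n a b w = k} = emeasure (\<Lambda>U a b k) A"
  using ms by (simp add: map_sources_def)

lemma no_negative_special_jumps:
  assumes "emeasure (\<Lambda>U a b k) {..<0} = 0"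
  shows "AE w in M. \<forall>n. \<not> (U n a b w < 0 \<and> TU n a b w = k)"
proof -
  have "AE w in M. \<not> (U n a b w < 0 \<and> TU n a b w = k)" for n
  proof -
    have "{w \<in> space M. U n a b w \<in> {..<0} \<and> TU n a b w = k} \<in> null_sets M"
      using emeasure_special[of "{..<0}" n a b k] source_event[OF special_event[of "{..<0}" n a b k]] assms
      by (auto simp: null_sets_def)
    from AE_not_in[OF this] AE_space show ?thesis by eventually_elim auto
  qed
  then show ?thesis unfolding AE_all_countable by blast
qed

text \<open>At a transition the Levy processes of the state being left do not jump, so the jump and
  its mark come from one special variable. At any other jump time exactly one component jumps, and
  the mark names it. In both cases a negative jump of type \<open>k0\<close> would be charged by a
  measure that vanishes on the negative half-line.\<close>

lemma no_negative_jumps_of_type: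
  assumes levy0: "\<And>a. emeasure (\<Lambda> a k0) {..<0} = 0" and special0: "\<And>a b. emeasure (\<Lambda>U a b k0) {..<0} = 0"
  shows "AE w in M. \<forall>t\<in>neg_jumps (path w). snd (path w) t \<noteq> k0"
proof -
  have F1: "AE w in M. \<forall>a. \<forall>s>0. \<not> dY a k0 w s < 0"
    unfolding AE_all_countable using no_negative_levy_jumps[OF levy0] by blast
  have F4: "AE w in M. \<forall>a b n. \<not> (U n a b w < 0 \<and> TU n a b w = k0)"
  proof -
    have "AE w in M. \<forall>n. \<not> (U n a b w < 0 \<and> TU n a b w = k0)" for a b by (rule no_negative_special_jumps[OF special0])
    then have "AE w in M. \<forall>b n. \<not> (U n a b w < 0 \<and> TU n a b w = k0)" for a by (subst AE_all_countable) blast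
    then show ?thesis by (subst AE_all_countable) blast
  qed
  from F1 F4 no_simultaneous_jumps no_jump_at_occupation AE_space show ?thesis
  proof eventually_elim
    case (elim w)
    note F1 = elim(1) and F4 = elim(2) and F2 = elim(3) and F3 = elim(4) and w = elim(5)
    interpret S: sources "\<lambda>t. \<theta> t w" "\<lambda>j k t. Y j k t w" "\<lambda>j. e j w" "\<lambda>n a b. U n a b w" by (rule sources_path[OF w])
    show ?case
    proof (intro ballI notI)
      fix t assume t: "t \<in> neg_jumps (path w)" and k0: "snd (path w) t = k0"
      then have "0 < t" "alive (path w) t" "jump (pos (path w)) t < 0" by (auto simp: neg_jumps_def)
      from ssmp_jump_converse[OF w this(1,2)] this(3) k0 obtain s where s: "0 < s" "D s w = k0"
        and "exp (X w s) - exp (X w s - \<Delta> w s) < 0" by auto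
      then have neg: "\<Delta> w s < 0" by simp
      define l where "l = left_state (\<lambda>t. \<theta> t w) s"
      define o' where "o' = occ w l s"
      have o': "0 < o'" unfolding o'_def l_def by (rule S.\<xi>_left(1)[OF s(1)])
      have Ds: "D s w = build_marks (\<lambda>t. \<theta> t w) (\<lambda>j k t. Y j k t w) (\<lambda>n a b. TU n a b w) s" by (rule D[OF w s(1)])
      show False
      proof (cases "s \<in> cj w")
        case True
        then have ne: "l \<noteq> \<theta> s w" using S.chain_jumps_iff[of s] by (simp add: l_def)
        obtain r where r: "r > s" "\<And>u. s \<le> u \<Longrightarrow> u < r \<Longrightarrow> \<theta> u w = \<theta> s w" using S.step_right[of s] s(1) by auto
        \<comment> \<open>A rational time soon after the transition: the chain has left
          \<open>l\<close>, so the occupation time of \<open>l\<close> is still its value at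
          \<open>s\<close>.\<close>
        obtain q where q: "s < real_of_rat q" "real_of_rat q < r" using of_rat_dense[OF r(1)] by blast
        have "\<theta> u w = \<theta> s w" if "s < u" "u < real_of_rat q" for u by (rule r(2)) (use that q in auto)
        then have "occ w l (real_of_rat q) = o'"
          using S.occupation_in_state[of s "real_of_rat q" "\<theta> s w" l] s(1) q(1) ne by (simp add: o'_def)
        moreover have "0 \<le> q" using q(1) s(1) by (metis less_imp_le less_trans zero_le_of_rat_iff)
        ultimately have "dY l k w o' = 0" for k using F3 o' by metis
        then have "\<Delta> w s = U (card (cj w \<inter> {0<..<s})) l (\<theta> s w) w"
          using True by (simp add: \<Delta>_def Let_def l_def[symmetric] o'_def[symmetric])
        moreover have "TU (card (cj w \<inter> {0<..<s})) l (\<theta> s w) w = k0"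
          using s(2) True unfolding Ds by (simp add: build_marks_def l_def)
        ultimately show False using F4 neg by metis
      next
        case False
        then have l: "\<theta> s w = l" using S.chain_jumps_iff[of s] s(1) by (simp add: l_def)
        have \<Delta>: "\<Delta> w s = (\<Sum>k\<in>UNIV. dY l k w o')"
          using False by (simp add: \<Delta>_def Let_def l_def[symmetric] o'_def[symmetric])
        have "\<exists>k. dY l k w o' \<noteq> 0"
        proof (rule ccontr)
          assume "\<nexists>k. dY l k w o' \<noteq> 0"
          then show False using neg \<Delta> by simp
        qed
        then have "jump (\<lambda>t. Y l (SOME k. dY l k w o' \<noteq> 0) t w) o' \<noteq> 0" by (rule someI_ex)
        moreover have "(SOME k. dY l k w o' \<noteq> 0) = k0"
          using s(2) False unfolding Ds by (simp add: build_marks_def l o'_def)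
        ultimately have "dY l k0 w o' \<noteq> 0" by simp
        then have "dY l k w o' = 0" if "k \<noteq> k0" for k using F2 o' that by blast
        then have "\<Delta> w s = dY l k0 w o'"
          unfolding \<Delta> by (subst sum.remove[of _ k0]) auto
        then show False using F1 o' neg by auto
      qed
    qed
  qed
qed

text \<open>A pathwise criterion. Before \<open>s\<close> the chain has not moved, so the ordinate
  is the sum of \<open>CARD('i)\<close> Levy paths whose left limits at \<open>s\<close> are within
  \<open>\<epsilon>\<close>, and the cell is close to \<open>1\<close>; the choice of
  \<open>\<epsilon>\<close> keeps the drop below \<open>1\<close>. The index \<open>0\<close> of
  \<open>U\<close> and \<open>TU\<close> belongs to the first transition.\<close>

lemma early_small_jump:
  assumes w: "w \<in> space M" and s: "0 < s" "s < h" and e: "\<And>a. ereal h < e a w"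
    and \<theta>: "\<And>u. 0 \<le> u \<Longrightarrow> u < s \<Longrightarrow> \<theta> u w = i"
    and calm: "\<And>k. \<bar>Y i k s w - dY i k w s\<bar> \<le> \<epsilon>"
    and J: "J = (if \<theta> s w = i then 0 else U 0 i (\<theta> s w) w) + (\<Sum>k\<in>UNIV. dY i k w s)"
    and J_neg: "J < 0" and J_ge: "- b - 2 * (real CARD('i) * \<epsilon>) \<le> J"
    and \<epsilon>: "exp (real CARD('i) * \<epsilon>) - exp (- 3 * (real CARD('i) * \<epsilon>) - b) < 1"
    and mark: "if \<theta> s w = i then (SOME k. dY i k w s \<noteq> 0) = k0 else TU 0 i (\<theta> s w) w = k0"
  shows "\<exists>t\<in>neg_jumps (path w). snd (path w) t = k0 \<and> \<not> 1 \<le> \<bar>jump (pos (path w)) t\<bar>"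
proof -
  interpret S: sources "\<lambda>t. \<theta> t w" "\<lambda>j k t. Y j k t w" "\<lambda>j. e j w" "\<lambda>n a b. U n a b w" by (rule sources_path[OF w])
  have \<theta>': "\<theta> u w = i" if "0 < u" "u < s" for u using \<theta> that by simp
  have l: "left_state (\<lambda>t. \<theta> t w) s = i"
  proof (rule S.left_state_eqI)
    show "\<forall>\<^sub>F u in at_left s. \<theta> u w = i" unfolding eventually_at_left_field using s(1) \<theta>' by blast
  qed
  have occ_s: "occ w a s = (if a = i then s else 0)" for a
    using S.occupation_in_state[of 0 s i a] s(1) \<theta>' S.occupation_0 by simp
  have cj_iff: "s \<in> cj w \<longleftrightarrow> \<theta> s w \<noteq> i" using S.chain_jumps_iff[of s] l s(1) by auto
  have "cj w \<inter> {0<..<s} = {}" by (rule S.no_chain_jumps_const[of 0 s i]) (use \<theta>' in auto)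
  then have c0: "card (cj w \<inter> {0<..<s}) = 0" by simp
  have "ereal (occ w a s) < e a w" for a
  proof -
    have "ereal (occ w a s) \<le> ereal h" using occ_s[of a] s by simp
    then show ?thesis using e[of a] by (rule le_less_trans)
  qed
  then have alive: "S.z s \<noteq> None" unfolding S.alive_z_iff by blast
  then have Zs: "Z s w \<noteq> None" using Z[OF w, of s] s by simp
  have X: "X w s = S.\<xi> s" using S.ordinate_z[OF alive] Z[OF w, of s] s by (simp add: X_def ordinate_def)
  have \<Delta>: "\<Delta> w s = J"
    using cj_iff by (simp add: \<Delta>_def Let_def l c0 J occ_s)
  have "S.\<xi> 0 = 0" by (simp add: S.\<xi>_def S.occupation_0 S.Y_0)
  moreover have "Y i k 0 w = 0" for k by (rule S.Y_0)
  ultimately have "S.\<xi> s = (\<Sum>k\<in>UNIV. Y i k s w) + (if \<theta> s w = i then 0 else U 0 i (\<theta> s w) w)"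
    using S.\<xi>_increment[of 0 s i] s(1) \<theta>' cj_iff by (simp add: S.occupation_0 S.V_def l c0)
  then have "X w s - \<Delta> w s = (\<Sum>k\<in>UNIV. Y i k s w - dY i k w s)"
    unfolding X \<Delta> J by (simp add: sum_subtractf)
  moreover have "\<bar>\<Sum>k\<in>UNIV. Y i k s w - dY i k w s\<bar> \<le> (\<Sum>k\<in>(UNIV::'i set). \<epsilon>)"
    by (rule order_trans[OF sum_abs sum_mono]) (rule calm)
  ultimately have left: "\<bar>X w s - \<Delta> w s\<bar> \<le> real CARD('i) * \<epsilon>" by simp
  have size: "\<bar>exp (X w s) - exp (X w s - \<Delta> w s)\<bar> < 1" and negj: "exp (X w s) - exp (X w s - \<Delta> w s) < 0"
  proof -
    show neg: "exp (X w s) - exp (X w s - \<Delta> w s) < 0" using J_neg by (simp add: \<Delta>)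
    have "exp (X w s - \<Delta> w s) \<le> exp (real CARD('i) * \<epsilon>)" using left by simp
    moreover have "exp (- 3 * (real CARD('i) * \<epsilon>) - b) \<le> exp (X w s)"
    proof -
      have "- 3 * (real CARD('i) * \<epsilon>) - b \<le> X w s" using left J_ge \<Delta> by linarith
      then show ?thesis by simp
    qed
    ultimately show "\<bar>exp (X w s) - exp (X w s - \<Delta> w s)\<bar> < 1" using neg \<epsilon> by linarith
  qed
  have "D s w = k0"
    using D[OF w s(1)] mark cj_iff occ_s by (auto simp: build_marks_def l c0 split: if_splits)
  then show ?thesis using ssmp_jump[OF w s(1) Zs] size negj
    by (auto simp: neg_jumps_def)
qed

section \<open>Joint realization of the sources\<close>

lemma killing_event: "{w \<in> space M. ereal h < e a w} \<in> source_events M \<theta> Y e U TU (Kill a)"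
proof -
  have "e a -` {ereal h<..} \<inter> space M \<in> source_events M \<theta> Y e U TU (Kill a)"
    by (simp add: source_events_def in_vimage_algebra)
  moreover have "e a -` {ereal h<..} \<inter> space M = {w \<in> space M. ereal h < e a w}" by auto
  ultimately show ?thesis by simp
qed

text \<open>Killing times are strictly positive, so a short horizon is survived with probability
  tending to \<open>1\<close>.\<close>

lemma eventually_not_killed: "\<forall>\<^sub>F N in sequentially. \<forall>a. 0 < prob {w \<in> space M. ereal (1 / 2 ^ N) < e a w}"
proof (rule eventually_all_finite)
  fix a
  have "(\<lambda>N. prob {w \<in> space M. ereal (1 / 2 ^ N) < e a w}) \<longlonglongrightarrow> prob (\<Union>N. {w \<in> space M. ereal (1 / 2 ^ N) < e a w})"
  proof (rule finite_Lim_measure_incseq)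
    show "range (\<lambda>N. {w \<in> space M. ereal (1 / 2 ^ N) < e a w}) \<subseteq> events" using source_event[OF killing_event] by auto
    show "incseq (\<lambda>N. {w \<in> space M. ereal (1 / 2 ^ N) < e a w})"
    proof (rule incseq_SucI, rule subsetI)
      fix N w assume w: "w \<in> {w \<in> space M. ereal (1 / 2 ^ N) < e a w}"
      have "ereal (1 / 2 ^ Suc N) \<le> ereal (1 / 2 ^ N)" by (simp add: field_simps)
      also have "\<dots> < e a w" using w by blast
      finally show "w \<in> {w \<in> space M. ereal (1 / 2 ^ Suc N) < e a w}" using w by blast
    qed
  qed
  also have "(\<Union>N. {w \<in> space M. ereal (1 / 2 ^ N) < e a w}) = space M"
  proof (intro equalityI subsetI)
    fix w assume w: "w \<in> space M"
    have "0 < e a w" using ms w by (simp add: map_sources_def)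
    then obtain q where q: "0 < ereal q" "ereal q < e a w" using ereal_dense2 by blast
    then obtain N where "(1 / 2) ^ N < q" using real_arch_pow_inv[of q "1 / 2"] by auto
    then have "ereal (1 / 2 ^ N) < ereal q" by (simp add: power_one_over)
    then have "ereal (1 / 2 ^ N) < e a w" using q(2) by (rule less_trans)
    with w show "w \<in> (\<Union>N. {w \<in> space M. ereal (1 / 2 ^ N) < e a w})" by blast
  qed auto
  finally have "(\<lambda>N. prob {w \<in> space M. ereal (1 / 2 ^ N) < e a w}) \<longlonglongrightarrow> 1" by (simp add: prob_space)
  from order_tendstoD(1)[OF this, of 0] show "\<forall>\<^sub>F N in sequentially. 0 < prob {w \<in> space M. ereal (1 / 2 ^ N) < e a w}" by simp
qed

text \<open>A refutation scheme: finitely many independent events of positive probability occur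
  together with positive probability and cannot almost surely exclude each other. Each event belongs
  to one source; the event of the special jump is a parameter, so that it can be chosen trivial when
  no transition is involved.\<close>

lemma joint_event:
  assumes E: "E \<in> sets CM" "0 < prob E"
    and F: "\<And>k. F k \<in> path_events M borel (Y i k)" "\<And>k. 0 < prob (F k)"
    and kill: "\<And>a. 0 < prob {w \<in> space M. ereal h < e a w}"
    and S: "S \<in> source_events M \<theta> Y e U TU (Special 0 i j)" "0 < prob S"
    and bad: "AE w in M. w \<in> E \<longrightarrow> (\<forall>k. w \<in> F k) \<longrightarrow> (\<forall>a. ereal h < e a w) \<longrightarrow> w \<in> S \<longrightarrow> False"
  shows False
proof -
  let ?J = "{Chain} \<union> range (Levy i) \<union> range Kill \<union> {Special 0 i j}"
  define A where "A r = (case r of Chain \<Rightarrow> E | Levy a k \<Rightarrow> F k | Kill a \<Rightarrow> {w \<in> space M. ereal h < e a w} | Special n a b \<Rightarrow> S)" for r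
  have A: "A r \<in> source_events M \<theta> Y e U TU r" "0 < prob (A r)" if "r \<in> ?J" for r
    using that E F kill S killing_event by (auto simp: A_def sets_CM source_events_def[of _ _ _ _ _ _ Chain] source_events_def[of _ _ _ _ _ _ "Levy _ _"])
  have "prob (\<Inter>r\<in>?J. A r) = (\<Prod>r\<in>?J. prob (A r))"
    by (rule indep_setsD[OF indep]) (use A in auto)
  also have "\<dots> > 0" by (rule prod_pos) (use A in auto)
  finally have pos: "0 < prob (\<Inter>r\<in>?J. A r)" .
  have ev: "(\<Inter>r\<in>?J. A r) \<in> events"
    by (rule sets.finite_INT) (use A source_event in auto)
  have "AE w in M. w \<notin> (\<Inter>r\<in>?J. A r)"
    using bad
  proof eventually_elim
    case (elim w)
    show ?case
    proof
      assume "w \<in> (\<Inter>r\<in>?J. A r)"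
      then have "w \<in> A Chain" "\<And>k. w \<in> A (Levy i k)" "\<And>a. w \<in> A (Kill a)" "w \<in> A (Special 0 i j)" by auto
      then show False using elim by (auto simp: A_def)
    qed
  qed
  then have "(\<Inter>r\<in>?J. A r) \<in> null_sets M" using ev by (simp add: AE_iff_null_sets)
  then show False using pos by (simp add: null_sets_def emeasure_eq_measure)
qed

lemma eventually_calm:
  assumes "0 < \<epsilon>"
  shows "\<forall>\<^sub>F N in sequentially. \<forall>k. 0 < prob (levy.calm M (Y i k) (1 / 2 ^ N) \<epsilon>)"
proof (rule eventually_all_finite)
  fix k
  interpret L: levy M "Y i k" by (rule levy_Y)
  show "\<forall>\<^sub>F N in sequentially. 0 < prob (L.calm (1 / 2 ^ N) \<epsilon>)"
    using order_tendstoD(1)[OF L.calm_tendsto[OF assms], of 0] by simp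
qed

text \<open>One Levy process makes the jump while the chain rests and the other processes are calm.
  Almost surely none of these jumps at the same time, so the mark is \<open>k0\<close> and the jump
  is not compensated.\<close>

lemma small_levy_jump:
  assumes pos: "0 < emeasure (\<Lambda> i k0) {..<0}"
  shows "\<not> (AE w in M. \<forall>t\<in>neg_jumps (path w). snd (path w) t = k0 \<longrightarrow> 1 \<le> \<bar>jump (pos (path w)) t\<bar>)"
proof
  assume large: "AE w in M. \<forall>t\<in>neg_jumps (path w). snd (path w) t = k0 \<longrightarrow> 1 \<le> \<bar>jump (pos (path w)) t\<bar>"
  interpret L: levy M "Y i k0" by (rule levy_Y)
  have LM: "sets (\<Lambda> i k0) = sets borel"
    "\<And>A. A \<in> sets borel \<Longrightarrow> 0 \<notin> A \<Longrightarrow> emeasure (\<Lambda> i k0) A =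
      (\<integral>\<^sup>+ w. emeasure (count_space UNIV) {s. 0 < s \<and> s \<le> 1 \<and> dY i k0 w s \<in> A} \<partial>M)"
    using ms by (auto simp: map_sources_def has_levy_measure_def)
  obtain b c where bc: "0 < c" "c \<le> b" "0 < emeasure (\<Lambda> i k0) {- b<..<- c}"
    using negative_mass_bounded[OF LM(1) pos] by blast
  \<comment> \<open>Positive mass of the Levy measure is a positive expected count, which is
    impossible if almost surely nothing is counted.\<close>
  have jumps: "\<not> (AE w in M. \<forall>s>0. dY i k0 w s \<notin> {- b<..<- c})"
  proof
    assume "AE w in M. \<forall>s>0. dY i k0 w s \<notin> {- b<..<- c}"
    then have "AE w in M. emeasure (count_space UNIV) {s. 0 < s \<and> s \<le> 1 \<and> dY i k0 w s \<in> {- b<..<- c}} = 0"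
    proof eventually_elim
      case (elim w)
      then have "{s. 0 < s \<and> s \<le> 1 \<and> dY i k0 w s \<in> {- b<..<- c}} = {}" by blast
      then show ?case by (simp only: emeasure_empty)
    qed
    then have "(\<integral>\<^sup>+ w. emeasure (count_space UNIV) {s. 0 < s \<and> s \<le> 1 \<and> dY i k0 w s \<in> {- b<..<- c}} \<partial>M) = (\<integral>\<^sup>+ w. 0 \<partial>M)"
      by (rule nn_integral_cong_AE)
    moreover have "emeasure (\<Lambda> i k0) {- b<..<- c} =
        (\<integral>\<^sup>+ w. emeasure (count_space UNIV) {s. 0 < s \<and> s \<le> 1 \<and> dY i k0 w s \<in> {- b<..<- c}} \<partial>M)"
      using bc by (intro LM(2)) auto
    ultimately show False using bc(3) by simp
  qed
  obtain \<epsilon> where \<epsilon>: "0 < \<epsilon>" "\<epsilon> \<le> c / 3" "exp (real CARD('i) * \<epsilon>) - exp (- 3 * (real CARD('i) * \<epsilon>) - b) < 1"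
    using exponential_margin[of "c / 3" "real CARD('i)" b] bc(1) by auto
  have A: "open {- b<..<- c}" "closed {- b..- c}" "{- b<..<- c} \<subseteq> {- b..- c}" by auto
  have A3: "3 * \<epsilon> \<le> \<bar>x\<bar>" if "x \<in> {- b..- c}" for x using that \<epsilon>(2) by auto
  from L.early_jump[OF A A3 \<epsilon>(1) jumps] obtain N0 where N0: "\<And>N. N0 \<le> N \<Longrightarrow> \<exists>F\<in>sets L.PM. 0 < prob F \<and>
    (\<forall>w\<in>F. \<exists>s>0. s \<le> 1 / 2 ^ N \<and> dY i k0 w s \<in> {- b..- c} \<and> \<bar>Y i k0 s w - dY i k0 w s\<bar> \<le> \<epsilon>)" by blast
  obtain h0 where h0: "0 < h0" "\<And>h. 0 < h \<and> h \<le> h0 \<Longrightarrow> \<exists>E\<in>sets CM. 0 < prob E \<and> (\<forall>w\<in>E. \<forall>u. 0 \<le> u \<and> u < h \<longrightarrow> \<theta> u w = i)"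
    using stay_event by blast
  have "\<forall>\<^sub>F N in sequentially. N0 \<le> N \<and> 1 / 2 ^ N \<le> h0 \<and> (\<forall>a. 0 < prob {w \<in> space M. ereal (1 / 2 ^ N) < e a w}) \<and>
      (\<forall>k. 0 < prob (levy.calm M (Y i k) (1 / 2 ^ N) \<epsilon>))"
    by (intro eventually_conj eventually_ge_at_top eventually_mesh_le[OF h0(1)] eventually_not_killed eventually_calm[OF \<epsilon>(1)])
  then obtain N where N: "N0 \<le> N" "1 / 2 ^ N \<le> h0" "\<And>a. 0 < prob {w \<in> space M. ereal (1 / 2 ^ N) < e a w}"
      "\<And>k. 0 < prob (levy.calm M (Y i k) (1 / 2 ^ N) \<epsilon>)" unfolding eventually_sequentially by blast
  obtain E where E: "E \<in> sets CM" "0 < prob E" "\<And>w u. w \<in> E \<Longrightarrow> 0 \<le> u \<Longrightarrow> u < 1 / 2 ^ N \<Longrightarrow> \<theta> u w = i"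
    using h0(2)[of "1 / 2 ^ N"] N(2) by auto
  \<comment> \<open>The jump is sought on half of the horizon, so that it occurs strictly before
    \<open>1 / 2 ^ N\<close>, while the chain is still in \<open>i\<close>.\<close>
  have "N0 \<le> Suc N" using N(1) by simp
  from N0[OF this] obtain F0 where F0: "F0 \<in> sets L.PM" "0 < prob F0"
    "\<And>w. w \<in> F0 \<Longrightarrow> \<exists>s>0. s \<le> 1 / 2 ^ Suc N \<and> dY i k0 w s \<in> {- b..- c} \<and> \<bar>Y i k0 s w - dY i k0 w s\<bar> \<le> \<epsilon>"
    by blast
  define F where "F k = (if k = k0 then F0 else levy.calm M (Y i k) (1 / 2 ^ N) \<epsilon>)" for k
  have half: "(1::real) / 2 ^ Suc N < 1 / 2 ^ N" by (simp add: field_simps)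
  show False
  \<comment> \<open>No transition takes part, so the special source contributes
    \<open>space M\<close>.\<close>
  proof (rule joint_event[OF E(1,2), of F "1 / 2 ^ N" "space M" i])
    fix k
    interpret Lk: levy M "Y i k" by (rule levy_Y)
    show "F k \<in> path_events M borel (Y i k)" using F0(1) Lk.calm_PM by (auto simp: F_def L.sets_PM[symmetric] Lk.sets_PM[symmetric])
    show "0 < prob (F k)" using F0(2) N(4) by (simp add: F_def)
  next
    show "0 < prob {w \<in> space M. ereal (1 / 2 ^ N) < e a w}" for a by (rule N(3))
    show "space M \<in> source_events M \<theta> Y e U TU (Special 0 i i)"
      using special_event[of UNIV 0 i i] sets.top[of "vimage_algebra (space M) (\<lambda>w. (U 0 i i w, TU 0 i i w)) (borel \<Otimes>\<^sub>M count_space UNIV)"]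
      by (simp add: source_events_def)
    show "0 < prob (space M)" by (simp add: prob_space)
    show "AE w in M. w \<in> E \<longrightarrow> (\<forall>k. w \<in> F k) \<longrightarrow> (\<forall>a. ereal (1 / 2 ^ N) < e a w) \<longrightarrow> w \<in> space M \<longrightarrow> False"
      using large no_simultaneous_jumps
    proof eventually_elim
      case (elim w)
      show ?case
      proof (intro impI)
        assume wE: "w \<in> E" and wF: "\<forall>k. w \<in> F k" and we: "\<forall>a. ereal (1 / 2 ^ N) < e a w" and w: "w \<in> space M"
        have "w \<in> F0" using wF[THEN spec, of k0] by (simp add: F_def)
        then obtain s where s: "0 < s" "s \<le> 1 / 2 ^ Suc N" "dY i k0 w s \<in> {- b..- c}"
          "\<bar>Y i k0 s w - dY i k0 w s\<bar> \<le> \<epsilon>" using F0(3) by blast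
        have sN: "s < 1 / 2 ^ N" using s(2) half by (rule le_less_trans)
        have others: "dY i k w s = 0" if "k \<noteq> k0" for k
        proof -
          have "dY i k0 w s \<noteq> 0" using s(3) bc(1) by auto
          moreover have "\<forall>s>0. dY i k w s = 0 \<or> dY i k0 w s = 0" using elim(2) that by blast
          ultimately show ?thesis using s(1) by blast
        qed
        have ts: "\<theta> s w = i" by (rule E(3)[OF wE]) (use s(1) sN in auto)
        have sum: "(\<Sum>k\<in>UNIV. dY i k w s) = dY i k0 w s"
          using others by (subst sum.remove[of _ k0]) auto
        have "\<exists>t\<in>neg_jumps (path w). snd (path w) t = k0 \<and> \<not> 1 \<le> \<bar>jump (pos (path w)) t\<bar>"
        proof (rule early_small_jump[OF w s(1) sN])
          show "ereal (1 / 2 ^ N) < e a w" for a using we by blast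
          show "\<theta> u w = i" if "0 \<le> u" "u < s" for u by (rule E(3)[OF wE]) (use that sN in auto)
          show "\<bar>Y i k s w - dY i k w s\<bar> \<le> \<epsilon>" for k
          proof (cases "k = k0")
            case False
            interpret Lk: levy M "Y i k" by (rule levy_Y)
            have "w \<in> Lk.calm (1 / 2 ^ N) \<epsilon>" using wF[THEN spec, of k] False by (simp add: F_def)
            then show ?thesis by (rule Lk.calm_left) (use s(1) sN in auto)
          qed (use s(4) in simp)
          show "(\<Sum>k\<in>UNIV. dY i k w s) = (if \<theta> s w = i then 0 else U 0 i (\<theta> s w) w) + (\<Sum>k\<in>UNIV. dY i k w s)"
            using ts by simp
          show "(\<Sum>k\<in>UNIV. dY i k w s) < 0" unfolding sum using s(3) bc(1) by simp
          have "0 \<le> real CARD('i) * \<epsilon>" using \<epsilon>(1) by simp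
          then show "- b - 2 * (real CARD('i) * \<epsilon>) \<le> (\<Sum>k\<in>UNIV. dY i k w s)" unfolding sum using s(3) by simp
          show "exp (real CARD('i) * \<epsilon>) - exp (- 3 * (real CARD('i) * \<epsilon>) - b) < 1" by (rule \<epsilon>(3))
          have "(SOME k. dY i k w s \<noteq> 0) = k0"
            by (rule some_equality) (use s(3) bc(1) others in auto)
          then show "if \<theta> s w = i then (SOME k. dY i k w s \<noteq> 0) = k0 else TU 0 i (\<theta> s w) w = k0" using ts by simp
        qed
        with elim(1) show False by blast
      qed
    qed
  qed
qed

text \<open>The chain leaves \<open>i\<close> for \<open>j\<close> early, and this first transition
  brings a special jump below \<open>- c\<close>. The calm Levy processes may jump as well, but only
  by \<open>2 * (K * \<epsilon>)\<close> altogether, which cannot make the total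
  nonnegative.\<close>

lemma small_special_jump:
  assumes pos: "0 < emeasure (\<Lambda>U i j k0) {..<0}" and \<Lambda>U: "sets (\<Lambda>U i j k0) = sets borel" and ij: "i \<noteq> j" "0 < Q $ i $ j"
  shows "\<not> (AE w in M. \<forall>t\<in>neg_jumps (path w). snd (path w) t = k0 \<longrightarrow> 1 \<le> \<bar>jump (pos (path w)) t\<bar>)"
proof
  assume large: "AE w in M. \<forall>t\<in>neg_jumps (path w). snd (path w) t = k0 \<longrightarrow> 1 \<le> \<bar>jump (pos (path w)) t\<bar>"
  obtain b c where bc: "0 < c" "c \<le> b" "0 < emeasure (\<Lambda>U i j k0) {- b<..<- c}"
    using negative_mass_bounded[OF \<Lambda>U pos] by blast
  define K where "K = real CARD('i)"
  have K: "1 \<le> K" by (simp add: K_def Suc_leI)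
  \<comment> \<open>Chosen so that \<open>3 * (K * \<epsilon>) \<le> c\<close>, which exceeds the
    \<open>2 * (K * \<epsilon>)\<close> that the Levy processes can contribute.\<close>
  have "0 < c / (3 * K)" using bc(1) K by simp
  then obtain \<epsilon> where \<epsilon>: "0 < \<epsilon>" "\<epsilon> \<le> c / (3 * K)" "exp (K * \<epsilon>) - exp (- 3 * (K * \<epsilon>) - b) < 1"
    using exponential_margin[of "c / (3 * K)" K b] by auto
  have K\<epsilon>: "3 * (K * \<epsilon>) \<le> c" using \<epsilon>(2) K by (simp add: field_simps)
  obtain h0 where h0: "0 < h0" "\<And>h. 0 < h \<and> h \<le> h0 \<Longrightarrow> \<exists>E\<in>sets CM. 0 < prob E \<and>
      (\<forall>w\<in>E. \<exists>s. 0 < s \<and> s \<le> h \<and> \<theta> s w = j \<and> (\<forall>u. 0 \<le> u \<and> u < s \<longrightarrow> \<theta> u w = i))"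
    using direct_jump_event[OF ij] by blast
  have "\<forall>\<^sub>F N in sequentially. 1 / 2 ^ N \<le> h0 \<and> (\<forall>a. 0 < prob {w \<in> space M. ereal (1 / 2 ^ N) < e a w}) \<and>
      (\<forall>k. 0 < prob (levy.calm M (Y i k) (1 / 2 ^ N) \<epsilon>))"
    by (intro eventually_conj eventually_mesh_le[OF h0(1)] eventually_not_killed eventually_calm[OF \<epsilon>(1)])
  then obtain N where N: "1 / 2 ^ N \<le> h0" "\<And>a. 0 < prob {w \<in> space M. ereal (1 / 2 ^ N) < e a w}"
      "\<And>k. 0 < prob (levy.calm M (Y i k) (1 / 2 ^ N) \<epsilon>)" unfolding eventually_sequentially by blast
  have half: "(1::real) / 2 ^ Suc N < 1 / 2 ^ N" by (simp add: field_simps)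
  have "(0::real) < 1 / 2 ^ Suc N \<and> 1 / 2 ^ Suc N \<le> h0" using N(1) half by simp
  from h0(2)[OF this] obtain E where E: "E \<in> sets CM" "0 < prob E"
    "\<And>w. w \<in> E \<Longrightarrow> \<exists>s. 0 < s \<and> s \<le> 1 / 2 ^ Suc N \<and> \<theta> s w = j \<and> (\<forall>u. 0 \<le> u \<and> u < s \<longrightarrow> \<theta> u w = i)" by blast
  define S where "S = {w \<in> space M. U 0 i j w \<in> {- b<..<- c} \<and> TU 0 i j w = k0}"
  show False
  proof (rule joint_event[OF E(1,2), of "\<lambda>k. levy.calm M (Y i k) (1 / 2 ^ N) \<epsilon>" "1 / 2 ^ N" S j])
    fix k
    interpret Lk: levy M "Y i k" by (rule levy_Y)
    show "Lk.calm (1 / 2 ^ N) \<epsilon> \<in> path_events M borel (Y i k)" using Lk.calm_PM by (simp add: Lk.sets_PM[symmetric])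
    show "0 < prob (Lk.calm (1 / 2 ^ N) \<epsilon>)" by (rule N(3))
  next
    show "0 < prob {w \<in> space M. ereal (1 / 2 ^ N) < e a w}" for a by (rule N(2))
    show "S \<in> source_events M \<theta> Y e U TU (Special 0 i j)" unfolding S_def by (rule special_event) simp
    have "emeasure M S = emeasure (\<Lambda>U i j k0) {- b<..<- c}" unfolding S_def by (rule emeasure_special) simp
    then have "0 < ennreal (prob S)" using bc(3) by (simp only: emeasure_eq_measure)
    then show "0 < prob S" by simp
    show "AE w in M. w \<in> E \<longrightarrow> (\<forall>k. w \<in> levy.calm M (Y i k) (1 / 2 ^ N) \<epsilon>) \<longrightarrow> (\<forall>a. ereal (1 / 2 ^ N) < e a w) \<longrightarrow> w \<in> S \<longrightarrow> False"
      using large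
    proof eventually_elim
      case (elim w)
      show ?case
      proof (intro impI)
        assume wE: "w \<in> E" and wF: "\<forall>k. w \<in> levy.calm M (Y i k) (1 / 2 ^ N) \<epsilon>" and we: "\<forall>a. ereal (1 / 2 ^ N) < e a w" and wS: "w \<in> S"
        have w: "w \<in> space M" using wS by (simp add: S_def)
        obtain s where s: "0 < s" "s \<le> 1 / 2 ^ Suc N" "\<theta> s w = j" "\<And>u. 0 \<le> u \<Longrightarrow> u < s \<Longrightarrow> \<theta> u w = i"
          using E(3)[OF wE] by blast
        have sN: "s < 1 / 2 ^ N" using s(2) half by (rule le_less_trans)
        \<comment> \<open>A calm path is within \<open>\<epsilon>\<close> of \<open>0\<close> both
          at \<open>s\<close> and just before, so its jump is at most
          \<open>2 * \<epsilon>\<close>.\<close>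
        have left: "\<bar>Y i k s w - dY i k w s\<bar> \<le> \<epsilon>" and small: "\<bar>dY i k w s\<bar> \<le> 2 * \<epsilon>" for k
        proof -
          interpret Lk: levy M "Y i k" by (rule levy_Y)
          have wk: "w \<in> Lk.calm (1 / 2 ^ N) \<epsilon>" using wF by blast
          show l: "\<bar>Y i k s w - dY i k w s\<bar> \<le> \<epsilon>" by (rule Lk.calm_left[OF wk]) (use s(1) sN in auto)
          have "\<bar>Y i k s w\<bar> \<le> \<epsilon>" by (rule Lk.calmD[OF wk]) (use s(1) sN in auto)
          with l show "\<bar>dY i k w s\<bar> \<le> 2 * \<epsilon>" by linarith
        qed
        define R where "R = (\<Sum>k\<in>UNIV. dY i k w s)"
        have "\<bar>R\<bar> \<le> (\<Sum>k\<in>(UNIV::'i set). 2 * \<epsilon>)" unfolding R_def by (rule order_trans[OF sum_abs sum_mono]) (rule small)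
        then have R: "\<bar>R\<bar> \<le> 2 * (K * \<epsilon>)" by (simp add: K_def)
        have U: "- b < U 0 i j w" "U 0 i j w < - c" "TU 0 i j w = k0" using wS by (auto simp: S_def)
        have "\<exists>t\<in>neg_jumps (path w). snd (path w) t = k0 \<and> \<not> 1 \<le> \<bar>jump (pos (path w)) t\<bar>"
        proof (rule early_small_jump[OF w s(1) sN])
          show "ereal (1 / 2 ^ N) < e a w" for a using we by blast
          show "\<theta> u w = i" if "0 \<le> u" "u < s" for u by (rule s(4)[OF that])
          show "\<bar>Y i k s w - dY i k w s\<bar> \<le> \<epsilon>" for k by (rule left)
          show "U 0 i j w + R = (if \<theta> s w = i then 0 else U 0 i (\<theta> s w) w) + (\<Sum>k\<in>UNIV. dY i k w s)"
            using s(3) ij(1) by (simp add: R_def)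
          have "0 < K * \<epsilon>" using K \<epsilon>(1) by simp
          then show "U 0 i j w + R < 0" using U(2) R K\<epsilon> by linarith
          show "- b - 2 * (real CARD('i) * \<epsilon>) \<le> U 0 i j w + R" using U(1) R unfolding K_def by linarith
          show "exp (real CARD('i) * \<epsilon>) - exp (- 3 * (real CARD('i) * \<epsilon>) - b) < 1" using \<epsilon>(3) unfolding K_def .
          show "if \<theta> s w = i then (SOME k. dY i k w s \<noteq> 0) = k0 else TU 0 i (\<theta> s w) w = k0" using s(3) ij(1) U(3) by auto
        qed
        with elim show False by blast
      qed
    qed
  qed
qed

end

section \<open>From the Markov additive process to the cell system\<close>

theorem proposition4p7:
  fixes Q :: "real^'i::finite^'i"
    and \<psi> :: "'i \<Rightarrow> complex \<Rightarrow> complex"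
    and \<Lambda> :: "'i \<Rightarrow> 'i \<Rightarrow> real measure"
    and \<Lambda>U :: "'i \<Rightarrow> 'i \<Rightarrow> 'i \<Rightarrow> real measure"
    and P :: "'i \<Rightarrow> 'w measure"
    and Z :: "real \<Rightarrow> 'w \<Rightarrow> (real \<times> 'i) option"
    and D :: "real \<Rightarrow> 'w \<Rightarrow> 'i"
    and \<alpha> :: real
    and L :: "real \<Rightarrow> 'i \<Rightarrow> 'i marked_path measure"
    and v_minus v_plus :: "real^'i"
    and \<omega>_minus \<omega>_plus :: real
    and x :: real and i :: 'i
    and M :: "'c measure"
    and C :: "nat list \<Rightarrow> 'c \<Rightarrow> 'i marked_path"
    and b :: "nat list \<Rightarrow> 'c \<Rightarrow> real"
  assumes MAP: "typed_MAP Q \<psi> \<Lambda> \<Lambda>U P Z D"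
    and random_path: "\<And>y j. 0 < y \<Longrightarrow> ssmp \<alpha> Z D y \<in> measurable (P j) cell_space"
    and L_def: "L = ssmp_law \<alpha> P Z D"
    and absorbed: "absorbed_or_vanishing L"
    and irreducible: "\<And>q. m_finite L q \<Longrightarrow> irreducible_matrix (m_matrix L q)"
    and root: "\<exists>q. m_finite L q \<and> growth_rate L q = 0"
    and cramer: "cramer_condition L Q \<psi> \<Lambda> \<Lambda>U v_minus \<omega>_minus v_plus \<omega>_plus"
    and start: "0 < x"
    and cells: "cell_system L x i M C b"
  shows "AE w in M. (\<lambda>n. genealogical_sum C v_plus \<omega>_plus n w) \<longlonglongrightarrow> 0"
proof -
  have P_prob: "prob_space (P l)" for l using MAP by (simp add: typed_MAP_def)
  have law: "\<exists>\<theta> Y e U TU. map_law (P l) Q \<psi> \<Lambda> \<Lambda>U l \<theta> Y e U TU Z D" for l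
  proof -
    have "\<exists>\<theta> Y e U TU. map_sources Q \<psi> \<Lambda> \<Lambda>U (P l) l \<theta> Y e U TU \<and>
        (\<forall>w\<in>space (P l).
           (\<forall>t\<ge>0. Z t w = build_path (\<lambda>t. \<theta> t w) (\<lambda>j k t. Y j k t w) (\<lambda>j. e j w) (\<lambda>n a b. U n a b w) t) \<and>
           (\<forall>s>0. D s w = build_marks (\<lambda>t. \<theta> t w) (\<lambda>j k t. Y j k t w) (\<lambda>n a b. TU n a b w) s))"
      using MAP unfolding typed_MAP_def by (elim conjE) (erule allE)
    then obtain \<theta> Y e U TU where s: "map_sources Q \<psi> \<Lambda> \<Lambda>U (P l) l \<theta> Y e U TU"
        "\<forall>w\<in>space (P l).
           (\<forall>t\<ge>0. Z t w = build_path (\<lambda>t. \<theta> t w) (\<lambda>j k t. Y j k t w) (\<lambda>j. e j w) (\<lambda>n a b. U n a b w) t) \<and>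
           (\<forall>s>0. D s w = build_marks (\<lambda>t. \<theta> t w) (\<lambda>j k t. Y j k t w) (\<lambda>n a b. TU n a b w) s)"
      by (elim exE conjE)
    have "map_law (P l) Q \<psi> \<Lambda> \<Lambda>U l \<theta> Y e U TU Z D"
      by (intro map_law.intro map_law_axioms.intro P_prob s(1)) (use s(2) in blast)+
    then show ?thesis by blast
  qed
  have Ly: "L y l = distr (P l) cell_space (ssmp \<alpha> Z D y)" for y l by (simp add: L_def ssmp_law_def)
  have L_prob: "prob_space (L y l)" if "0 < y" for y l
    unfolding Ly by (rule prob_space.prob_space_distr[OF P_prob random_path[OF that]])
  have L_sets: "sets (L y l) = sets cell_space" for y l by (simp add: Ly)
  have L_start: "AE c in L y l. fst c 0 = Some (y, l)" if y: "0 < y" for y l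
  proof -
      obtain \<theta> Y e U TU where "map_law (P l) Q \<psi> \<Lambda> \<Lambda>U l \<theta> Y e U TU Z D" using law by blast
      then interpret ml: map_law "P l" Q \<psi> \<Lambda> \<Lambda>U l \<theta> Y e U TU Z D \<alpha> .
      have "{c \<in> cell_paths. \<exists>r\<in>{y}. fst c 0 = Some (r, l)} \<in> sets cell_space"
        unfolding sets_cell_space by (intro sigma_sets.Basic UnI1 CollectI exI[of _ 0] exI[of _ "{y}"] exI[of _ l]) auto
      then have "{c \<in> space cell_space. fst c 0 = Some (y, l)} \<in> sets cell_space" by simp
      from AE_distr_iff[OF random_path[OF y] this] show ?thesis
        unfolding Ly using ml.start[OF _ y] by simp
  qed
  interpret cells L x i M C b by (rule cells.intro[OF cells start L_prob L_sets L_start])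
  have c: "0 < \<omega>_minus" "\<omega>_minus < \<omega>_plus" and adm: "admissible L v_minus \<omega>_minus" "admissible L v_plus \<omega>_plus"
    using cramer by (auto simp: cramer_condition_def)
  have eig: "m_matrix L \<omega>_minus *v v_minus = v_minus" "m_matrix L \<omega>_plus *v v_plus = v_plus"
    using adm by (auto simp: admissible_def)
  \<comment> \<open>The laws for all initial sizes are images of the same \<open>P j\<close>, so the
    jump sums can be compared path by path under one integral.\<close>
  have scaling: "(\<integral>\<^sup>+ c. jump_sum f k c \<partial>L y j) = (\<integral>\<^sup>+ c. jump_sum (\<lambda>z. f (y * z)) k c \<partial>L 1 j)"
    if f: "f \<in> borel_measurable borel" and y: "0 < y" for f k j y
  proof -
    have f': "(\<lambda>z. f (y * z)) \<in> borel_measurable borel" by (rule measurable_compose[OF _ f]) simp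
    have "(\<integral>\<^sup>+ c. jump_sum f k c \<partial>L y j) = (\<integral>\<^sup>+ w. jump_sum f k (ssmp \<alpha> Z D y w) \<partial>P j)"
      unfolding Ly by (rule nn_integral_distr[OF random_path[OF y]]) (simp add: measurable_jump_sum[OF f])
    also have "\<dots> = (\<integral>\<^sup>+ w. jump_sum (\<lambda>z. f (y * z)) k (ssmp \<alpha> Z D 1 w) \<partial>P j)"
    proof (rule nn_integral_cong)
      fix w assume "w \<in> space (P j)"
      then have "ssmp \<alpha> Z D 1 w \<in> space cell_space" by (rule measurable_space[OF random_path, rotated]) simp
      then show "jump_sum f k (ssmp \<alpha> Z D y w) = jump_sum (\<lambda>z. f (y * z)) k (ssmp \<alpha> Z D 1 w)"
        unfolding ssmp_def by (intro jump_sum_lamperti_scale[OF y]) simp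
    qed
    also have "\<dots> = (\<integral>\<^sup>+ c. jump_sum (\<lambda>z. f (y * z)) k c \<partial>L 1 j)"
      unfolding Ly by (rule nn_integral_distr[OF random_path[OF zero_less_one], symmetric]) (simp add: measurable_jump_sum[OF f'])
    finally show ?thesis .
  qed
  define k0 where "k0 = arg_max (\<lambda>l. v_minus $ l / v_plus $ l) (\<lambda>_. True)"
  have k0: "v_minus $ l / v_plus $ l \<le> v_minus $ k0 / v_plus $ k0" for l
  proof -
    have "finite (range (\<lambda>l. v_minus $ l / v_plus $ l))" by simp
    then obtain k where k: "\<And>l. v_minus $ l / v_plus $ l \<le> v_minus $ k / v_plus $ k"
      using Max_in[of "range (\<lambda>l. v_minus $ l / v_plus $ l)"] Max_ge[of "range (\<lambda>l. v_minus $ l / v_plus $ l)"]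
      by (metis (no_types, lifting) UNIV_not_empty image_iff image_is_empty rangeI)
    have "is_arg_max (\<lambda>l. v_minus $ l / v_plus $ l) (\<lambda>_. True) k0"
      unfolding k0_def arg_max_def by (rule someI[of _ k]) (use k in \<open>auto simp: is_arg_max_def not_less\<close>)
    then show ?thesis by (auto simp: is_arg_max_def not_less)
  qed
  \<comment> \<open>Type \<open>k0\<close> lies on a cycle of positive entries; the last step of
    that cycle starts from a type \<open>l\<close> whose cells have jumps of type
    \<open>k0\<close>.\<close>
  have "(k0, k0) \<in> {(a, b). 0 < m_matrix L \<omega>_minus $ a $ b}\<^sup>+"
    using irreducible[of \<omega>_minus] adm(1) by (simp add: irreducible_matrix_def admissible_def)
  then obtain l where l: "0 < m_matrix L \<omega>_minus $ l $ k0" by (cases rule: trancl.cases) auto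
  have "\<exists>i0. \<not> (AE w in P i0. \<forall>t\<in>neg_jumps (ssmp \<alpha> Z D 1 w). snd (ssmp \<alpha> Z D 1 w) t = k0 \<longrightarrow> 1 \<le> \<bar>jump (pos (ssmp \<alpha> Z D 1 w)) t\<bar>)"
  proof (cases "\<exists>a. 0 < emeasure (\<Lambda> a k0) {..<0}")
    case True
    then obtain a where a: "0 < emeasure (\<Lambda> a k0) {..<0}" by blast
    obtain \<theta> Y e U TU where "map_law (P a) Q \<psi> \<Lambda> \<Lambda>U a \<theta> Y e U TU Z D" using law by blast
    then interpret ml: map_law "P a" Q \<psi> \<Lambda> \<Lambda>U a \<theta> Y e U TU Z D \<alpha> .
    show ?thesis using ml.small_levy_jump[OF a] by blast
  next
    case False
    then have levy0: "emeasure (\<Lambda> a k0) {..<0} = 0" for a by (simp add: not_gr_zero)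
    \<comment> \<open>If special jumps did not produce negative jumps of type \<open>k0\<close>
      either, the positive entry of \<open>m\<close> found above would be an integral of
      \<open>0\<close>.\<close>
    have "\<exists>a b. 0 < emeasure (\<Lambda>U a b k0) {..<0}"
    proof (rule ccontr)
      assume "\<not> ?thesis"
      then have special0: "emeasure (\<Lambda>U a b k0) {..<0} = 0" for a b by (simp add: not_gr_zero)
      obtain \<theta> Y e U TU where "map_law (P l) Q \<psi> \<Lambda> \<Lambda>U l \<theta> Y e U TU Z D" using law by blast
      then interpret ml: map_law "P l" Q \<psi> \<Lambda> \<Lambda>U l \<theta> Y e U TU Z D \<alpha> .
      let ?f = "\<lambda>y. ennreal (y powr \<omega>_minus)"
      have "m_entry L \<omega>_minus l k0 = (\<integral>\<^sup>+ w. jump_sum ?f k0 (ssmp \<alpha> Z D 1 w) \<partial>P l)"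
        unfolding m_entry_eq Ly by (rule nn_integral_distr[OF random_path[OF zero_less_one]]) (simp add: measurable_jump_sum)
      also have "\<dots> = (\<integral>\<^sup>+ w. 0 \<partial>P l)"
      proof (rule nn_integral_cong_AE)
        show "AE w in P l. jump_sum ?f k0 (ssmp \<alpha> Z D 1 w) = 0"
          using ml.no_negative_jumps_of_type[OF levy0 special0]
        proof eventually_elim
          case (elim w)
          then have "{s \<in> neg_jumps (ssmp \<alpha> Z D 1 w). snd (ssmp \<alpha> Z D 1 w) s = k0} = {}" by blast
          then show ?case by (simp add: jump_sum_def nn_integral_empty)
        qed
      qed
      finally show False using l by (simp add: m_matrix_def)
    qed
    then obtain a b where ab: "0 < emeasure (\<Lambda>U a b k0) {..<0}" by blast
    have sets: "sets (\<Lambda>U a b k) = sets borel" for k using MAP by (simp add: typed_MAP_def)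
    have total: "(\<Sum>k\<in>UNIV. emeasure (\<Lambda>U a b k) UNIV) = 1" using MAP by (simp add: typed_MAP_def)
    \<comment> \<open>In both degenerate cases the special jump is \<open>0\<close> with full mass,
      which leaves nothing for the negative half-line.\<close>
    have "\<not> (a = b \<or> Q $ a $ b = 0)"
    proof
      assume "a = b \<or> Q $ a $ b = 0"
      moreover have "\<forall>a b. a = b \<or> Q $ a $ b = 0 \<longrightarrow> (\<Sum>k\<in>UNIV. emeasure (\<Lambda>U a b k) {0}) = 1"
        using MAP unfolding typed_MAP_def by (elim conjE)
      ultimately have zero: "(\<Sum>k\<in>UNIV. emeasure (\<Lambda>U a b k) {0}) = 1" by blast
      have "(\<Sum>k\<in>UNIV. emeasure (\<Lambda>U a b k) {0}) + emeasure (\<Lambda>U a b k0) {..<0} \<le>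
          (\<Sum>k\<in>UNIV. emeasure (\<Lambda>U a b k) {0}) + (\<Sum>k\<in>UNIV. emeasure (\<Lambda>U a b k) {..<0})"
        by (intro add_left_mono member_le_sum) auto
      also have "\<dots> = (\<Sum>k\<in>UNIV. emeasure (\<Lambda>U a b k) ({0} \<union> {..<0}))"
        unfolding sum.distrib[symmetric] using sets by (intro sum.cong refl plus_emeasure) auto
      also have "\<dots> \<le> (\<Sum>k\<in>UNIV. emeasure (\<Lambda>U a b k) UNIV)"
        using sets by (intro sum_mono emeasure_mono) auto
      finally have "1 + emeasure (\<Lambda>U a b k0) {..<0} \<le> 1 + 0" unfolding zero total by simp
      then show False using ab by (subst (asm) ennreal_add_left_cancel_le) auto
    qed
    moreover have "a \<noteq> b \<Longrightarrow> 0 \<le> Q $ a $ b" using MAP by (simp add: typed_MAP_def intensity_matrix_def)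
    ultimately have q: "a \<noteq> b" "0 < Q $ a $ b" by auto
    obtain \<theta> Y e U TU where "map_law (P a) Q \<psi> \<Lambda> \<Lambda>U a \<theta> Y e U TU Z D" using law by blast
    then interpret ml: map_law "P a" Q \<psi> \<Lambda> \<Lambda>U a \<theta> Y e U TU Z D \<alpha> .
    show ?thesis using ml.small_special_jump[OF ab sets q] by blast
  qed
  then obtain i0 where i0: "\<not> (AE w in P i0. \<forall>t\<in>neg_jumps (ssmp \<alpha> Z D 1 w). snd (ssmp \<alpha> Z D 1 w) t = k0 \<longrightarrow>
      1 \<le> \<bar>jump (pos (ssmp \<alpha> Z D 1 w)) t\<bar>)" by blast
  \<comment> \<open>An almost sure statement under the image law pulls back to \<open>P i0\<close>
    whether or not the set of paths in question is measurable.\<close>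
  have "\<not> (AE c in L 1 i0. \<forall>s\<in>neg_jumps c. snd c s = k0 \<longrightarrow> 1 \<le> \<bar>jump (pos c) s\<bar>)"
  proof
    assume "AE c in L 1 i0. \<forall>s\<in>neg_jumps c. snd c s = k0 \<longrightarrow> 1 \<le> \<bar>jump (pos c) s\<bar>"
    then have "AE w in P i0. \<forall>s\<in>neg_jumps (ssmp \<alpha> Z D 1 w). snd (ssmp \<alpha> Z D 1 w) s = k0 \<longrightarrow> 1 \<le> \<bar>jump (pos (ssmp \<alpha> Z D 1 w)) s\<bar>"
      unfolding Ly by (rule AE_distrD[OF random_path[OF zero_less_one]])
    with i0 show False by blast
  qed
  from genealogical_sum_tendsto_0[OF _ _ c _ _ eig irreducible scaling k0 this] adm
  show ?thesis unfolding admissible_def by blast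
qed

end
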